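(* Let $\delta>0$. Let $X$ be a random $n\times p$ matrix whose rows $x_i$, $i=1,\dots,n$, are i.i.d. and have the form $x_i=\Gamma^{1/2}z_i$, where the $z_i\in\mathbb{R}^p$ have i.i.d. entries with mean zero, unit variance and uniformly bounded $(8+\delta)$-th moment, and $\Gamma$ is an invertible $p\times p$ covariance matrix. Let $Q = I_n - X(X^\top X)^{-1}X^\top$, $T=Q\odot Q$ and $\gamma_{p,n}=p/n$. Then, as $n,p\to\infty$ such that $\limsup\gamma_{p,n}<1/2$, for any fixed $\xi>0$ and all sufficiently large $n$, the eigenvalue bounds $$\lambda_{\max}(T) < 1-\gamma_{p,n}+\xi$$ and $$\lambda_{\min}(T) > (1-\gamma_{p,n})(1-2\gamma_{p,n})-\xi$$ hold with probability at least $1-Cn^{-1-\delta/4}\xi^{-4-\delta/2}$, for some positive constant $C$ not depending on $\xi$.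
   Context: All objects ($X$, $\Gamma=\Gamma_p$, the $z_i$) are indexed by a sequence of pairs $(n,p)$ with $n,p\to\infty$; the bound on the $(8+\delta)$-th absolute moment of the entries of the $z_i$ is uniform along this sequence. $\Gamma^{1/2}$ is the symmetric square root of $\Gamma$. $I_n$ is the identity matrix; $M\odot M$ is the Hadamard (entrywise) product of $M$ with itself, $(M\odot M)_{ij}=M_{ij}^2$. $\lambda_{\max}$ and $\lambda_{\min}$ denote the largest and smallest eigenvalues of a symmetric matrix. $Q$ is defined on the event that $X^\top X$ is invertible; on the complementary event the eigenvalue bounds are counted as failing. *)

theory Defs
  imports "HOL-Probability.Probability" "Jordan_Normal_Form.Spectral_Radius"
    "Jordan_Normal_Form.Gauss_Jordan_Elimination"
begin

definition pos_semidef_mat :: "real mat \<Rightarrow> bool" where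
  "pos_semidef_mat A \<longleftrightarrow> square_mat A \<and> transpose_mat A = A \<and>
     (\<forall>v\<in>carrier_vec (dim_row A). 0 \<le> scalar_prod v (A *\<^sub>v v))"

text \<open>The positive semidefinite square root of a positive semidefinite matrix exists and is
  unique, so for such matrices the choice below is no choice at all. For other matrices the
  value is unspecified.\<close>

definition sqrt_mat :: "real mat \<Rightarrow> real mat" where
  "sqrt_mat A = (SOME B. pos_semidef_mat B \<and> B * B = A)"

definition hadamard_prod :: "real mat \<Rightarrow> real mat \<Rightarrow> real mat"  (infixl \<open>\<odot>\<close> 70) where
  "A \<odot> B = mat (dim_row A) (dim_col A) (\<lambda>(i, j). A $$ (i, j) * B $$ (i, j))"

text \<open>Meaningful for symmetric matrices of positive dimension, whose real eigenvalues form a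
  finite nonempty set.\<close>

definition lambda_max :: "real mat \<Rightarrow> real" where
  "lambda_max A = Max (spectrum A)"

definition lambda_min :: "real mat \<Rightarrow> real" where
  "lambda_min A = Min (spectrum A)"

definition design_mat :: "nat \<Rightarrow> nat \<Rightarrow> real mat \<Rightarrow> (nat \<Rightarrow> nat \<Rightarrow> real) \<Rightarrow> real mat" where
  "design_mat n p \<Gamma> z = mat\<^sub>r n p (\<lambda>i. sqrt_mat \<Gamma> *\<^sub>v vec p (\<lambda>j. z i j))"

text \<open>Meaningful only if the Gram matrix of \<open>X\<close> is invertible; otherwise \<open>mat_inverse\<close> yields
  \<open>None\<close>.\<close>

definition resid_mat :: "real mat \<Rightarrow> real mat" where
  "resid_mat X = 1\<^sub>m (dim_row X) -
     X * the (mat_inverse (transpose_mat X * X)) * transpose_mat X"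

end

theory Submission
  imports Defs "HOL-Real_Asymp.Real_Asymp"
begin

text \<open>
  The matrix \<open>Q\<close> projects orthogonally onto the complement of the column space of \<open>X\<close>, so it does
  not see \<open>\<Gamma>\<close>: with \<open>Z\<close> the matrix of the \<open>z i j\<close> and \<open>Z'\<close> its transpose,
  \<open>Q = 1 - Z (Z' Z)^(-1) Z'\<close> (\<open>design_mat_gram\<close>). Because \<open>Q\<^sup>2 = Q\<close>, row \<open>i\<close> of the entrywise
  square \<open>T\<close> sums to \<open>Q i i\<close>, while its diagonal entry is \<open>(Q i i)\<^sup>2\<close>. Gershgorin's theorem
  therefore puts every eigenvalue of \<open>T\<close> between \<open>2 (Q i i)\<^sup>2 - Q i i\<close> and \<open>Q i i\<close> for some \<open>i\<close>
  (\<open>spectrum_square_projection\<close>), and \<open>2 (1 - \<gamma>)\<^sup>2 - (1 - \<gamma>) = (1 - \<gamma>) (1 - 2 \<gamma>)\<close>. Both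
  bounds follow once every \<open>Q i i\<close> is within a fraction of \<open>\<xi>\<close> of \<open>1 - \<gamma>\<close>. Since the trace of \<open>Q\<close>
  is \<open>n - p\<close>, it is enough that the \<open>Q i i\<close> are close to each other.

  Let \<open>A i\<close> be the inverse Gram matrix of all rows except row \<open>i\<close>, and \<open>z i\<close> that row. Then
  \<open>Q i i = 1 / (1 + z i \<bullet> A i (z i))\<close>, and as long as the Gram matrices have no eigenvalue below
  \<open>\<kappa>\<close>, the trace of \<open>A i\<close> is within \<open>1 / \<kappa>\<close> of a number that does not depend on \<open>i\<close>
  (\<open>leave_one_out\<close>). What remains is the deviation of the quadratic form from the trace. As \<open>z i\<close>
  is independent of \<open>A i\<close>, its moment of order \<open>q = 4 + \<delta> / 2\<close> is at most a constant times
  \<open>(tr (A i)\<^sup>2)\<close> to the power \<open>q / 2\<close> (\<open>quadratic_form_moment\<close>), and this trace is at most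
  \<open>p / \<kappa>\<^sup>2\<close>, of order \<open>1 / n\<close> if \<open>\<kappa>\<close> is of order \<open>n\<close>. Markov's inequality and a union over
  the \<open>n\<close> rows give \<open>n * n powr (- q / 2) * \<xi> powr (- q)\<close>, the claimed rate.

  The remaining ingredient is that the smallest eigenvalue of a Gram matrix of \<open>m\<close> rows is of order
  \<open>m\<close> except with exponentially small probability (\<open>smallest_eigenvalue_bound\<close>). It is proved with
  a barrier in the style of Batson, Spielman and Srivastava. The rows are added one at a time to a
  matrix \<open>S\<close>, and after each row a level \<open>l\<close> is raised by an amount that keeps \<open>tr D\<^sup>2\<close> from growing,
  where \<open>D\<close> dominates the inverse of \<open>S - l\<close>. Bounding \<open>tr D\<^sup>2\<close>, rather than \<open>tr D\<close>, forces the
  operator norm of \<open>D\<close> to be of order \<open>1 / sqrt m\<close>, so that the quadratic forms governing one step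
  concentrate. The raises are bounded and have conditional mean at least \<open>1 / (2 (1 + p / (\<alpha> m)))\<close>
  up to small errors, the level starts at \<open>- \<alpha> m\<close>, and \<open>m\<close> such raises take it to a positive multiple
  of \<open>m\<close> exactly when \<open>\<alpha> + p / m < 1 / 2\<close>. This is where the bound on \<open>\<gamma>\<close> enters.
\<close>

section \<open>Symmetric matrices in coordinates\<close>

text \<open>The number \<open>p\<close> of columns varies along the sequence, so it cannot be part of a type. Vectors
  and square matrices are functions on \<open>nat\<close> whose values at indices from \<open>p\<close> on are irrelevant.\<close>

definition dotp :: "nat \<Rightarrow> (nat \<Rightarrow> real) \<Rightarrow> (nat \<Rightarrow> real) \<Rightarrow> real" where
  "dotp p x y = (\<Sum>i<p. x i * y i)"

definition mv :: "nat \<Rightarrow> (nat \<Rightarrow> nat \<Rightarrow> real) \<Rightarrow> (nat \<Rightarrow> real) \<Rightarrow> nat \<Rightarrow> real" where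
  "mv p A x = (\<lambda>i. dotp p (A i) x)"

definition symf :: "nat \<Rightarrow> (nat \<Rightarrow> nat \<Rightarrow> real) \<Rightarrow> bool" where
  "symf p A \<longleftrightarrow> (\<forall>i<p. \<forall>j<p. A i j = A j i)"

definition psdf :: "nat \<Rightarrow> (nat \<Rightarrow> nat \<Rightarrow> real) \<Rightarrow> bool" where
  "psdf p A \<longleftrightarrow> symf p A \<and> (\<forall>v. 0 \<le> dotp p v (mv p A v))"

definition trf :: "nat \<Rightarrow> (nat \<Rightarrow> nat \<Rightarrow> real) \<Rightarrow> real" where
  "trf p A = (\<Sum>i<p. A i i)"

text \<open>The squared Frobenius norm. For a symmetric matrix it is the trace of the square; likewise
  \<open>tr3\<close> below is then the trace of the cube.\<close>

definition fro2 :: "nat \<Rightarrow> (nat \<Rightarrow> nat \<Rightarrow> real) \<Rightarrow> real" where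
  "fro2 p A = (\<Sum>i<p. dotp p (A i) (A i))"

definition tr3 :: "nat \<Rightarrow> (nat \<Rightarrow> nat \<Rightarrow> real) \<Rightarrow> real" where
  "tr3 p A = (\<Sum>i<p. dotp p (A i) (mv p A (A i)))"

lemma dotp_commute: "dotp p x y = dotp p y x"
  by (simp add: dotp_def mult.commute)

lemma dotp_cong: "(\<And>i. i < p \<Longrightarrow> x i = x' i) \<Longrightarrow> (\<And>i. i < p \<Longrightarrow> y i = y' i) \<Longrightarrow>
    dotp p x y = dotp p x' y'"
  by (simp add: dotp_def)

lemma dotp_linear:
  "dotp p (\<lambda>i. x i + y i) z = dotp p x z + dotp p y z"
  "dotp p (\<lambda>i. x i - y i) z = dotp p x z - dotp p y z"
  "dotp p (\<lambda>i. c * x i) z = c * dotp p x z"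
  "dotp p z (\<lambda>i. x i + y i) = dotp p z x + dotp p z y"
  "dotp p z (\<lambda>i. x i - y i) = dotp p z x - dotp p z y"
  "dotp p z (\<lambda>i. c * x i) = c * dotp p z x"
  by (simp_all add: dotp_def algebra_simps sum.distrib sum_subtractf sum_distrib_left)

lemma mv_linear:
  "mv p A (\<lambda>i. x i + y i) = (\<lambda>i. mv p A x i + mv p A y i)"
  "mv p A (\<lambda>i. x i - y i) = (\<lambda>i. mv p A x i - mv p A y i)"
  "mv p A (\<lambda>i. c * x i) = (\<lambda>i. c * mv p A x i)"
  by (simp_all add: mv_def dotp_linear)

lemma dotp_self_nonneg: "0 \<le> dotp p x x"
  by (simp add: dotp_def sum_nonneg)

lemma dotp_self_eq_0: "dotp p x x = 0 \<longleftrightarrow> (\<forall>i<p. x i = 0)"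
  by (auto simp: dotp_def sum_nonneg_eq_0_iff)

lemma fro2_nonneg: "0 \<le> fro2 p A"
  by (simp add: fro2_def sum_nonneg dotp_self_nonneg)

lemma dotp_mv_sym:
  assumes "symf p A"
  shows "dotp p x (mv p A y) = dotp p (mv p A x) y"
proof -
  have "dotp p x (mv p A y) = (\<Sum>i<p. \<Sum>j<p. x i * A i j * y j)"
    by (simp add: dotp_def mv_def sum_distrib_left mult.assoc)
  also have "\<dots> = (\<Sum>j<p. \<Sum>i<p. x i * A i j * y j)" by (rule sum.swap)
  also have "\<dots> = (\<Sum>j<p. \<Sum>i<p. A j i * x i * y j)"
    using assms by (intro sum.cong refl) (auto simp: symf_def)
  also have "\<dots> = dotp p (mv p A x) y"
    by (simp add: dotp_def mv_def sum_distrib_right)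
  finally show ?thesis .
qed

text \<open>No sign of \<open>c\<close> is given: the hypothesis itself excludes \<open>c < 0\<close>, and forces \<open>b = 0\<close> if \<open>c = 0\<close>.\<close>

lemma discriminant_nonneg:
  fixes a b c :: real
  assumes "\<And>t. 0 \<le> a + 2 * t * b + t\<^sup>2 * c" 
  shows "b\<^sup>2 \<le> a * c"
proof (cases "c = 0")
  case True
  have "b = 0"
  proof (rule ccontr)
    assume b: "b \<noteq> 0"
    have "0 \<le> a + 2 * (- (a + 1) / (2 * b)) * b" using assms[of "- (a + 1) / (2 * b)"] True by simp
    also have "\<dots> = - 1" using b by (simp add: field_simps)
    finally show False by simp
  qed
  then show ?thesis using True by simp
next
  case False
  have "c > 0"
  proof (rule ccontr)
    assume "\<not> c > 0" then have c: "c < 0" using False by simp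
    define t where "t = (\<bar>a\<bar> + 1 + 2 * \<bar>b\<bar>) / (- c) + 1"
    have t: "t \<ge> 1" using c divide_nonneg_pos[of "\<bar>a\<bar> + 1 + 2 * \<bar>b\<bar>" "- c"] unfolding t_def by simp
    have ct: "t * c = - (\<bar>a\<bar> + 1 + 2 * \<bar>b\<bar>) + c" using c unfolding t_def by (simp add: field_simps)
    have "a + 2 * t * b + t\<^sup>2 * c = a + t * (2 * b + t * c)"
      by (simp add: power2_eq_square algebra_simps)
    also have "\<dots> \<le> a + t * (- \<bar>a\<bar> - 1)"
      using t ct c by (intro add_left_mono mult_left_mono) auto
    also have "\<dots> \<le> a + 1 * (- \<bar>a\<bar> - 1)"
      using t mult_right_mono_neg[of 1 t "- \<bar>a\<bar> - 1"] by simp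
    also have "\<dots> < 0" by simp
    finally show False using assms[of t] by simp
  qed
  have "0 \<le> a + 2 * (- b / c) * b + (- b / c)\<^sup>2 * c" by (rule assms)
  also have "\<dots> = a - b\<^sup>2 / c" using \<open>c > 0\<close> by (simp add: field_simps power2_eq_square)
  finally show ?thesis using \<open>c > 0\<close> by (simp add: field_simps)
qed

lemma psdf_Cauchy_Schwarz:
  assumes "psdf p A"
  shows "(dotp p x (mv p A y))\<^sup>2 \<le> dotp p x (mv p A x) * dotp p y (mv p A y)"
proof (rule discriminant_nonneg)
  fix t :: real
  have s: "symf p A" using assms by (simp add: psdf_def)
  have "0 \<le> dotp p (\<lambda>i. x i + t * y i) (mv p A (\<lambda>i. x i + t * y i))"
    using assms by (simp add: psdf_def)
  also have "\<dots> = dotp p x (mv p A x) + 2 * t * dotp p x (mv p A y) + t\<^sup>2 * dotp p y (mv p A y)"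
    using dotp_mv_sym[OF s, of y x] dotp_commute[of p "mv p A y" x]
    by (simp add: mv_linear dotp_linear power2_eq_square algebra_simps)
  finally show "0 \<le> dotp p x (mv p A x) + 2 * t * dotp p x (mv p A y) + t\<^sup>2 * dotp p y (mv p A y)" .
qed

lemma dotp_Cauchy_Schwarz: "(dotp p x y)\<^sup>2 \<le> dotp p x x * dotp p y y"
proof (rule discriminant_nonneg)
  fix t :: real
  have "0 \<le> dotp p (\<lambda>i. x i + t * y i) (\<lambda>i. x i + t * y i)" by (rule dotp_self_nonneg)
  also have "\<dots> = dotp p x x + 2 * t * dotp p x y + t\<^sup>2 * dotp p y y"
    using dotp_commute[of p y x]
    by (simp add: dotp_linear power2_eq_square algebra_simps)
  finally show "0 \<le> dotp p x x + 2 * t * dotp p x y + t\<^sup>2 * dotp p y y" .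
qed

lemma mv_norm_le_fro2: "dotp p (mv p A x) (mv p A x) \<le> fro2 p A * dotp p x x"
proof -
  have "dotp p (mv p A x) (mv p A x) = (\<Sum>i<p. (dotp p (A i) x)\<^sup>2)"
    unfolding dotp_def[of p "mv p A x"] by (simp add: mv_def power2_eq_square)
  also have "\<dots> \<le> (\<Sum>i<p. dotp p (A i) (A i) * dotp p x x)"
    by (intro sum_mono dotp_Cauchy_Schwarz)
  also have "\<dots> = fro2 p A * dotp p x x" by (simp add: fro2_def sum_distrib_right)
  finally show ?thesis .
qed

lemma quadratic_form_le_fro2:
  assumes "fro2 p A \<le> \<nu>\<^sup>2" "0 \<le> \<nu>"
  shows "dotp p x (mv p A x) \<le> \<nu> * dotp p x x"
proof -
  have "(dotp p x (mv p A x))\<^sup>2 \<le> dotp p x x * dotp p (mv p A x) (mv p A x)"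
    by (rule dotp_Cauchy_Schwarz)
  also have "\<dots> \<le> dotp p x x * (fro2 p A * dotp p x x)"
    by (intro mult_left_mono mv_norm_le_fro2 dotp_self_nonneg)
  also have "\<dots> \<le> dotp p x x * (\<nu>\<^sup>2 * dotp p x x)"
    using assms by (intro mult_left_mono mult_right_mono dotp_self_nonneg)
  also have "\<dots> = (\<nu> * dotp p x x)\<^sup>2" by (simp add: power2_eq_square)
  finally show ?thesis
    using assms dotp_self_nonneg[of p x] by - (rule power2_le_imp_le, auto)
qed

text \<open>This is \<open>A\<^sup>2 \<le> \<nu> A\<close> in the Loewner order. It follows from Cauchy--Schwarz for the form of \<open>A\<close>,
  applied to \<open>x\<close> and \<open>A x\<close>.\<close>

lemma psdf_norm_mv_le:
  assumes A: "psdf p A" and \<nu>: "\<And>x. dotp p x (mv p A x) \<le> \<nu> * dotp p x x"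
  shows "dotp p (mv p A x) (mv p A x) \<le> \<nu> * dotp p x (mv p A x)"
proof -
  let ?y = "mv p A x"
  have s: "symf p A" using A by (simp add: psdf_def)
  have nn: "0 \<le> dotp p x ?y" using A by (simp add: psdf_def)
  have "(dotp p ?y ?y)\<^sup>2 = (dotp p x (mv p A ?y))\<^sup>2" using dotp_mv_sym[OF s, of x ?y] by simp
  also have "\<dots> \<le> dotp p x ?y * dotp p ?y (mv p A ?y)" by (rule psdf_Cauchy_Schwarz[OF A])
  also have "\<dots> \<le> dotp p x ?y * (\<nu> * dotp p ?y ?y)" by (intro mult_left_mono \<nu> nn)
  finally have *: "dotp p ?y ?y * dotp p ?y ?y \<le> (\<nu> * dotp p x ?y) * dotp p ?y ?y"
    by (simp add: power2_eq_square mult_ac)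
  show ?thesis
  proof (cases "dotp p ?y ?y = 0")
    case False
    then have "dotp p ?y ?y > 0" using dotp_self_nonneg[of p ?y] by linarith
    then show ?thesis using * by (simp only: mult_le_cancel_right not_less_iff_gr_or_eq)
  next
    case True
    have z: "\<forall>i<p. ?y i = 0" using True by (simp add: dotp_self_eq_0)
    have "dotp p x ?y = 0" using z by (simp add: dotp_def)
    then show ?thesis using True by simp
  qed
qed

lemma trf_sq_le: "(trf p A)\<^sup>2 \<le> real p * fro2 p A"
proof -
  have "(trf p A)\<^sup>2 = (dotp p (\<lambda>i. A i i) (\<lambda>_. 1))\<^sup>2" by (simp add: trf_def dotp_def)
  also have "\<dots> \<le> dotp p (\<lambda>i. A i i) (\<lambda>i. A i i) * dotp p (\<lambda>_. 1) (\<lambda>_. 1)"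
    by (rule dotp_Cauchy_Schwarz)
  also have "\<dots> = real p * (\<Sum>i<p. (A i i)\<^sup>2)" by (simp add: dotp_def power2_eq_square)
  also have "\<dots> \<le> real p * fro2 p A"
    unfolding fro2_def dotp_def power2_eq_square
    by (intro mult_left_mono sum_mono, rule member_le_sum) auto
  finally show ?thesis .
qed

lemma psdf_diag_nonneg: assumes "psdf p A" "i < p" shows "0 \<le> A i i"
proof -
  let ?e = "\<lambda>j. if j = i then 1 else (0::real)"
  have "0 \<le> dotp p ?e (mv p A ?e)" using assms by (simp add: psdf_def)
  also have "\<dots> = A i i" using assms(2) by (simp add: dotp_def mv_def if_distrib if_distribR sum.delta cong: if_cong)
  finally show ?thesis .
qed

text \<open>The trace of the cube sums the values of the form of \<open>A\<close> at the rows of \<open>A\<close>. If all of them vanish,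
  then by Cauchy--Schwarz \<open>A\<close> maps its own rows to \<open>0\<close>, so \<open>A\<^sup>2 = 0\<close> and the rows are zero.\<close>

lemma psdf_tr3_pos:
  assumes A: "psdf p A" and pos: "0 < fro2 p A"
  shows "0 < tr3 p A"
proof (rule ccontr)
  assume "\<not> 0 < tr3 p A"
  moreover have nn: "\<And>i. 0 \<le> dotp p (A i) (mv p A (A i))" using A by (simp add: psdf_def)
  ultimately have "tr3 p A = 0" unfolding tr3_def by (meson sum_nonneg order_antisym not_less)
  then have z: "dotp p (A i) (mv p A (A i)) = 0" if "i < p" for i
    using that nn unfolding tr3_def by (subst (asm) sum_nonneg_eq_0_iff) auto
  have "dotp p (A i) (A i) = 0" if i: "i < p" for i
  proof -
    have "(dotp p x (mv p A (A i)))\<^sup>2 \<le> 0" for x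
      using psdf_Cauchy_Schwarz[OF A, of x "A i"] z[OF i] by simp
    then have "dotp p (mv p A (A i)) (mv p A (A i)) = 0" by simp
    then have "mv p A (A i) i = 0" using i by (simp add: dotp_self_eq_0)
    then show ?thesis by (simp add: mv_def)
  qed
  then have "fro2 p A = 0" by (simp add: fro2_def)
  then show False using pos by simp
qed

section \<open>The two moves of the barrier argument\<close>

text \<open>By the Sherman--Morrison formula this is the inverse of \<open>D^(-1) + x x'\<close> when \<open>D\<close> is
  invertible.\<close>

definition rank1_down :: "nat \<Rightarrow> (nat \<Rightarrow> nat \<Rightarrow> real) \<Rightarrow> (nat \<Rightarrow> real) \<Rightarrow> nat \<Rightarrow> nat \<Rightarrow> real" where
  "rank1_down p D x = (\<lambda>i j. D i j - mv p D x i * mv p D x j / (1 + dotp p x (mv p D x)))"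

context
  fixes p :: nat and D :: "nat \<Rightarrow> nat \<Rightarrow> real" and x u :: "nat \<Rightarrow> real" and q1 s :: real
    and D1 :: "nat \<Rightarrow> nat \<Rightarrow> real"
  assumes D: "psdf p D"
  defines "u \<equiv> mv p D x"
  defines "q1 \<equiv> dotp p x u"
  defines "s \<equiv> 1 / (1 + q1)"
  defines "D1 \<equiv> rank1_down p D x"
begin

lemma rank1_q1: "0 \<le> q1" using D by (simp add: q1_def u_def psdf_def)

lemma rank1_s: "0 < s" "s * (1 + q1) = 1" "s * q1 \<le> 1" "s \<le> 1"
  using rank1_q1 by (auto simp: s_def field_simps)

lemma rank1_row: "D1 i = (\<lambda>j. D i j - (s * u i) * u j)"
  by (auto simp: D1_def rank1_down_def s_def q1_def u_def)

lemma rank1_mv: "mv p D1 y = (\<lambda>i. mv p D y i - (s * dotp p u y) * u i)"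
  unfolding mv_def[of p D1] rank1_row dotp_linear by (simp add: mv_def algebra_simps)

lemma rank1_quad: "dotp p y (mv p D1 y) = dotp p y (mv p D y) - s * (dotp p u y)\<^sup>2"
  unfolding rank1_mv dotp_linear by (simp add: dotp_commute[of p y u] power2_eq_square)

lemma rank1_sym_D: "symf p D" using D by (simp add: psdf_def)

lemma rank1_psdf: "psdf p D1"
  unfolding psdf_def
proof (intro conjI allI)
  show "symf p D1" using rank1_sym_D by (simp add: symf_def rank1_row)
  fix y
  have "(dotp p u y)\<^sup>2 = (dotp p x (mv p D y))\<^sup>2"
    using dotp_mv_sym[OF rank1_sym_D, of x y] by (simp add: u_def)
  also have "\<dots> \<le> q1 * dotp p y (mv p D y)"
    unfolding q1_def u_def by (rule psdf_Cauchy_Schwarz[OF D])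
  finally have "s * (dotp p u y)\<^sup>2 \<le> s * (q1 * dotp p y (mv p D y))"
    using rank1_s by (intro mult_left_mono) auto
  also have "\<dots> = (s * q1) * dotp p y (mv p D y)" by simp
  also have "\<dots> \<le> 1 * dotp p y (mv p D y)"
    using rank1_s D by (intro mult_right_mono) (auto simp: psdf_def)
  finally show "0 \<le> dotp p y (mv p D1 y)" unfolding rank1_quad by simp
qed

lemma rank1_sum_rows: "(\<Sum>i<p. u i * dotp p (D i) y) = dotp p u (mv p D y)"
  by (simp add: dotp_def[of p u] mv_def)

text \<open>Expanding the square yields a gain of twice \<open>s * q3\<close> with \<open>q3 = u \<bullet> D u\<close>, and a loss
  \<open>s\<^sup>2 * (u \<bullet> u)\<^sup>2\<close>. Cauchy--Schwarz in the form of \<open>D\<close> bounds the loss by half the gain.\<close>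

lemma rank1_fro2: "fro2 p D1 \<le> fro2 p D - s * dotp p u (mv p D u)"
proof -
  let ?a = "dotp p u u" and ?b = "dotp p u (mv p D u)"
  have "fro2 p D1 = (\<Sum>i<p. dotp p (D i) (D i) - 2 * s * (u i * dotp p (D i) u) + s\<^sup>2 * ((u i * u i) * ?a))"
    unfolding fro2_def rank1_row dotp_linear dotp_commute[of p u "D _"]
    by (intro sum.cong refl) (simp add: algebra_simps power2_eq_square)
  also have "\<dots> = fro2 p D - 2 * s * (\<Sum>i<p. u i * dotp p (D i) u) + s\<^sup>2 * ((\<Sum>i<p. u i * u i) * ?a)"
    by (simp only: sum.distrib sum_subtractf fro2_def sum_distrib_left[symmetric] sum_distrib_right[symmetric])
  also have "\<dots> = fro2 p D - 2 * s * ?b + s\<^sup>2 * ?a\<^sup>2"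
    unfolding rank1_sum_rows by (simp add: dotp_def[symmetric] power2_eq_square)
  also have "s\<^sup>2 * ?a\<^sup>2 \<le> s * ?b"
  proof -
    have "?a\<^sup>2 = (dotp p x (mv p D u))\<^sup>2" using dotp_mv_sym[OF rank1_sym_D, of x u] by (simp add: u_def)
    also have "\<dots> \<le> q1 * ?b" unfolding q1_def using psdf_Cauchy_Schwarz[OF D, of x u] by (simp add: u_def)
    finally have "s\<^sup>2 * ?a\<^sup>2 \<le> s\<^sup>2 * (q1 * ?b)" by (intro mult_left_mono) auto
    also have "\<dots> = (s * q1) * (s * ?b)" by (simp add: power2_eq_square)
    also have "\<dots> \<le> 1 * (s * ?b)"
      using rank1_s D by (intro mult_right_mono) (auto simp: psdf_def)
    finally show ?thesis by simp
  qed
  finally show ?thesis by simp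
qed

text \<open>The trace of the cube is monotone in the Loewner order. Here the difference is explicit, and its
  one term of the wrong sign is controlled by Cauchy--Schwarz together with positivity of \<open>D1\<close> at \<open>u\<close>.\<close>

lemma rank1_tr3: "tr3 p D1 \<le> tr3 p D"
proof -
  let ?w = "mv p D u"
  define a where "a = dotp p u u"
  define b where "b = dotp p u ?w"
  define c where "c = dotp p ?w ?w"
  have u1: "mv p D1 u = (\<lambda>i. ?w i - (s * a) * u i)" by (simp add: rank1_mv a_def)
  have rw: "dotp p (D1 i) (mv p D1 (D1 i)) =
      dotp p (D i) (mv p D (D i)) - s * (?w i * ?w i) - 2 * s * (u i * dotp p (D i) (mv p D1 u))
       + s\<^sup>2 * ((u i * u i) * dotp p u (mv p D1 u))" for i
  proof -
    have "dotp p (D1 i) (mv p D1 (D1 i)) = dotp p (D i) (mv p D1 (D i))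
        - (s * u i) * (dotp p (D i) (mv p D1 u) + dotp p u (mv p D1 (D i)))
        + (s * u i)\<^sup>2 * dotp p u (mv p D1 u)"
      unfolding rank1_row mv_linear dotp_linear by (simp add: algebra_simps power2_eq_square)
    also have "dotp p u (mv p D1 (D i)) = dotp p (D i) (mv p D1 u)"
      using rank1_psdf dotp_mv_sym[of p D1 u "D i"] dotp_commute[of p "mv p D1 u" "D i"]
      by (simp add: psdf_def)
    also have "dotp p (D i) (mv p D1 (D i)) = dotp p (D i) (mv p D (D i)) - s * (?w i * ?w i)"
      unfolding rank1_quad by (simp add: mv_def dotp_commute power2_eq_square)
    finally show ?thesis by (simp add: algebra_simps power2_eq_square)
  qed
  have "tr3 p D1 = tr3 p D - s * (\<Sum>i<p. ?w i * ?w i) - 2 * s * (\<Sum>i<p. u i * dotp p (D i) (mv p D1 u))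
      + s\<^sup>2 * ((\<Sum>i<p. u i * u i) * dotp p u (mv p D1 u))"
    unfolding tr3_def rw
    by (simp only: sum.distrib sum_subtractf sum_distrib_left[symmetric] sum_distrib_right[symmetric])
  also have "(\<Sum>i<p. ?w i * ?w i) = c" by (simp add: c_def dotp_def)
  also have "(\<Sum>i<p. u i * u i) = a" by (simp add: a_def dotp_def)
  also have "(\<Sum>i<p. u i * dotp p (D i) (mv p D1 u)) = c - s * a * b"
  proof -
    have "(\<Sum>i<p. u i * dotp p (D i) (mv p D1 u)) = dotp p ?w (mv p D1 u)"
      unfolding rank1_sum_rows using dotp_mv_sym[OF rank1_sym_D] by simp
    also have "\<dots> = c - s * a * b"
      unfolding u1 dotp_linear by (simp add: c_def b_def dotp_commute)
    finally show ?thesis .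
  qed
  also have ud: "dotp p u (mv p D1 u) = b - s * a\<^sup>2"
    unfolding u1 dotp_linear by (simp add: a_def b_def power2_eq_square)
  finally have eq: "tr3 p D1 = tr3 p D - 3 * s * (c - s * a * b) - s * s * s * a * a * a"
    by (simp add: algebra_simps power2_eq_square)
  have a0: "0 \<le> a" by (simp add: a_def dotp_self_nonneg)
  have c0: "0 \<le> c" by (simp add: c_def dotp_self_nonneg)
  have b0: "0 \<le> b" using D by (simp add: b_def psdf_def)
  have bac: "b\<^sup>2 \<le> a * c" unfolding a_def b_def c_def by (rule dotp_Cauchy_Schwarz)
  have sab: "s * a * a \<le> b" using rank1_psdf ud unfolding psdf_def
    by (metis diff_ge_0_iff_ge power2_eq_square mult.assoc)
  have "s * a * b \<le> c"
  proof (cases "a = 0")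
    case False
    then have "a > 0" using a0 by simp
    have "a * (s * a * b) = (s * a * a) * b" by simp
    also have "\<dots> \<le> b * b" using sab b0 by (intro mult_right_mono)
    also have "\<dots> \<le> a * c" using bac by (simp add: power2_eq_square)
    finally show ?thesis using \<open>a > 0\<close> by (simp add: mult_le_cancel_left_pos)
  qed (use c0 in simp)
  then have "0 \<le> 3 * s * (c - s * a * b)" using rank1_s by simp
  moreover have "0 \<le> s * s * s * a * a * a" using rank1_s a0 by simp
  ultimately show ?thesis unfolding eq by linarith
qed

text \<open>The relation \<open>2 v \<bullet> w \<le> w \<bullet> D w + N v\<close> for all \<open>v\<close>, \<open>w\<close> expresses by Legendre duality that
  the quadratic form \<open>N\<close> is at least that of the inverse of \<open>D\<close>. In this form no inverse is needed,
  and the new relation is the old one at a shifted \<open>w\<close>.\<close>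

lemma rank1_dominates:
  assumes inv: "\<And>v w. 2 * dotp p v w \<le> dotp p w (mv p D w) + N v"
  shows "2 * dotp p v w \<le> dotp p w (mv p D1 w) + (N v + (dotp p v x)\<^sup>2)"
proof -
  define b where "b = dotp p u w"
  define t where "t = s * b"
  define e where "e = dotp p v x"
  have xw: "dotp p x (mv p D w) = b" "dotp p w u = b"
    using dotp_mv_sym[OF rank1_sym_D, of x w] by (simp_all add: u_def b_def dotp_commute)
  have "2 * dotp p v (\<lambda>i. w i - t * x i) \<le>
      dotp p (\<lambda>i. w i - t * x i) (mv p D (\<lambda>i. w i - t * x i)) + N v" by (rule inv)
  then have "2 * dotp p v w - 2 * t * e \<le> dotp p w (mv p D w) - 2 * t * b + t\<^sup>2 * q1 + N v"
    unfolding mv_linear dotp_linear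
    using xw by (simp add: u_def[symmetric] q1_def[symmetric] e_def power2_eq_square algebra_simps)
  moreover have "2 * t * e \<le> t\<^sup>2 + e\<^sup>2" using sum_squares_bound[of t e] by simp
  moreover have "t\<^sup>2 * (1 + q1) = t * b" 
    proof -
    have "t\<^sup>2 * (1 + q1) = (s * (1 + q1)) * (t * b)" by (simp add: t_def power2_eq_square)
    then show ?thesis using rank1_s(2) by simp
  qed
  moreover have "t * b = s * b\<^sup>2" by (simp add: t_def power2_eq_square)
  ultimately show ?thesis unfolding rank1_quad b_def[symmetric] e_def[symmetric]
    by (simp add: algebra_simps)
qed

end

text \<open>A polynomial upper bound for the inverse of \<open>D^(-1) - \<delta>\<close>, to first order in \<open>\<delta>\<close> when
  \<open>d\<close> is slightly larger than \<open>\<delta>\<close>.\<close>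

definition shift_up :: "nat \<Rightarrow> (nat \<Rightarrow> nat \<Rightarrow> real) \<Rightarrow> real \<Rightarrow> nat \<Rightarrow> nat \<Rightarrow> real" where
  "shift_up p D d = (\<lambda>i j. D i j + d * mv p D (D i) j)"

context
  fixes p :: nat and D D2 :: "nat \<Rightarrow> nat \<Rightarrow> real" and d \<nu> :: real
  assumes D: "psdf p D" and \<nu>0: "0 \<le> \<nu>" and d0: "0 \<le> d"
    and \<nu>: "\<And>x. dotp p x (mv p D x) \<le> \<nu> * dotp p x x"
  defines "D2 \<equiv> shift_up p D d"
begin

lemma shift_sym_D: "symf p D" using D by (simp add: psdf_def)

lemma shift_mv: assumes "i < p" shows "mv p D2 y i = mv p D y i + d * mv p D (mv p D y) i"
proof -
  have "mv p D2 y i = dotp p (\<lambda>j. D i j + d * mv p D (D i) j) y"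
    unfolding D2_def shift_up_def by (subst mv_def) (rule refl)
  also have "\<dots> = mv p D y i + d * dotp p (mv p D (D i)) y"
    unfolding dotp_linear by (simp only: mv_def)
  also have "dotp p (mv p D (D i)) y = dotp p (D i) (mv p D y)"
    using dotp_mv_sym[OF shift_sym_D, of "D i" y] by simp
  finally show ?thesis by (simp add: mv_def)
qed

lemma shift_quad: "dotp p y (mv p D2 y) = dotp p y (mv p D y) + d * dotp p (mv p D y) (mv p D y)"
proof -
  have "dotp p y (mv p D2 y) = dotp p y (\<lambda>i. mv p D y i + d * mv p D (mv p D y) i)"
    by (intro dotp_cong refl shift_mv)
  also have "\<dots> = dotp p y (mv p D y) + d * dotp p y (mv p D (mv p D y))" by (simp add: dotp_linear)
  also have "dotp p y (mv p D (mv p D y)) = dotp p (mv p D y) (mv p D y)"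
    by (rule dotp_mv_sym[OF shift_sym_D])
  finally show ?thesis .
qed

lemma shift_psdf: "psdf p D2"
  unfolding psdf_def
proof (intro conjI allI)
  show "symf p D2"
    using shift_sym_D by (auto simp: symf_def D2_def shift_up_def mv_def dotp_commute)
  show "0 \<le> dotp p y (mv p D2 y)" for y
    unfolding shift_quad using D d0 by (simp add: psdf_def dotp_self_nonneg)
qed

lemma shift_fro2: "fro2 p D2 \<le> fro2 p D + (2 * d + d\<^sup>2 * \<nu>) * tr3 p D"
proof -
  have "dotp p (D2 i) (D2 i) \<le> dotp p (D i) (D i) + (2 * d + d\<^sup>2 * \<nu>) * dotp p (D i) (mv p D (D i))" for i
  proof -
    have "dotp p (D2 i) (D2 i) = dotp p (D i) (D i) + 2 * d * dotp p (D i) (mv p D (D i))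
       + d\<^sup>2 * dotp p (mv p D (D i)) (mv p D (D i))"
      unfolding D2_def shift_up_def dotp_linear dotp_commute[of p "mv p D (D i)" "D i"]
      by (simp add: algebra_simps power2_eq_square)
    also have "\<dots> \<le> dotp p (D i) (D i) + 2 * d * dotp p (D i) (mv p D (D i))
       + d\<^sup>2 * (\<nu> * dotp p (D i) (mv p D (D i)))"
      by (intro add_left_mono mult_left_mono psdf_norm_mv_le[OF D \<nu>]) auto
    finally show ?thesis by (simp add: algebra_simps)
  qed
  then show ?thesis unfolding fro2_def tr3_def sum_distrib_left sum.distrib[symmetric]
    by (intro sum_mono)
qed

text \<open>Again the old relation is used at a shifted \<open>w\<close>; the step length \<open>1 / \<nu>\<close> makes the quadratic
  error term half of the linear gain.\<close>

lemma shift_dominates: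
  assumes inv: "\<And>v w. 2 * dotp p v w \<le> dotp p w (mv p D w) + N v"
    and d: "d * (1 - \<delta> * \<nu>) = \<delta>" and small: "0 \<le> \<delta>" "\<delta> * \<nu> < 1" and \<nu>p: "0 < \<nu>"
  shows "2 * dotp p v w \<le> dotp p w (mv p D2 w) + (N v - \<delta> * dotp p v v)"
proof -
  define g where "g = mv p D w"
  define h where "h = (\<lambda>i. v i - g i)"
  define c where "c = 1 / \<nu>"
  have c: "0 < c" "c * \<nu> = 1" using \<nu>p by (simp_all add: c_def)
  have wh: "dotp p w (mv p D h) = dotp p g h" "dotp p h g = dotp p g h"
    using dotp_mv_sym[OF shift_sym_D, of w h] by (simp_all add: g_def dotp_commute)
  have "2 * dotp p v (\<lambda>i. w i + c * h i) \<le>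
      dotp p (\<lambda>i. w i + c * h i) (mv p D (\<lambda>i. w i + c * h i)) + N v" by (rule inv)
  then have "2 * dotp p v w + 2 * c * dotp p v h \<le> dotp p w g + 2 * c * dotp p g h
      + c\<^sup>2 * dotp p h (mv p D h) + N v"
    unfolding mv_linear dotp_linear
    using wh by (simp add: g_def[symmetric] power2_eq_square algebra_simps)
  moreover have "c\<^sup>2 * dotp p h (mv p D h) \<le> c\<^sup>2 * (\<nu> * dotp p h h)"
    by (intro mult_left_mono \<nu>) auto
  moreover have "c\<^sup>2 * (\<nu> * dotp p h h) = c * dotp p h h"
proof -
    have "c\<^sup>2 * (\<nu> * dotp p h h) = (c * \<nu>) * (c * dotp p h h)" by (simp add: power2_eq_square)
    then show ?thesis using c by simp
  qed
  moreover have "2 * c * dotp p v h - 2 * c * dotp p g h = 2 * c * dotp p h h"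
    unfolding h_def dotp_linear by (simp add: algebra_simps)
  ultimately have 1: "2 * dotp p v w \<le> dotp p w g + N v - c * dotp p h h" by linarith
  have hh: "dotp p h h = dotp p v v - 2 * dotp p v g + dotp p g g"
    unfolding h_def dotp_linear by (simp add: dotp_commute)
  \<comment> \<open>What is left of the cross term \<open>v \<bullet> g\<close> is split by Young's inequality; the weight \<open>1 - \<delta> \<nu>\<close> is
     the one for which the coefficient of \<open>v \<bullet> v\<close> becomes exactly \<open>- \<delta>\<close>.\<close>
  define \<eta> where "\<eta> = 1 - \<delta> * \<nu>"
  have \<eta>: "0 < \<eta>" "c * (1 - \<eta>) = \<delta>" "d * \<eta> = \<delta>" using small c d
    by (simp_all add: \<eta>_def mult.left_commute)
  have "0 \<le> dotp p (\<lambda>i. \<eta> * v i - g i) (\<lambda>i. \<eta> * v i - g i)" by (rule dotp_self_nonneg)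
  also have "\<dots> = \<eta> * (\<eta> * dotp p v v - 2 * dotp p v g) + dotp p g g"
    unfolding dotp_linear by (simp add: dotp_commute algebra_simps)
  finally have y: "2 * (\<eta> * dotp p v g) \<le> \<eta>\<^sup>2 * dotp p v v + dotp p g g"
    by (simp add: algebra_simps power2_eq_square)
  have "\<eta> * (\<delta> * dotp p v v - d * dotp p g g - c * dotp p h h) = \<delta> * (\<eta> * dotp p v v) - \<delta> * dotp p g g
     - c * (\<eta> * dotp p v v + \<eta> * dotp p g g - 2 * (\<eta> * dotp p v g))"
    unfolding hh using \<eta>(3) by (simp add: algebra_simps)
  also have "\<dots> \<le> \<delta> * (\<eta> * dotp p v v) - \<delta> * dotp p g g
     - c * (\<eta> * dotp p v v + \<eta> * dotp p g g - (\<eta>\<^sup>2 * dotp p v v + dotp p g g))"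
    using y c by (intro diff_left_mono mult_left_mono) auto
  also have "\<dots> = (\<delta> - c * (1 - \<eta>)) * (\<eta> * dotp p v v) + (c * (1 - \<eta>) - \<delta>) * dotp p g g"
    by (simp add: algebra_simps power2_eq_square)
  also have "\<dots> = 0" using \<eta> by simp
  finally have "\<delta> * dotp p v v - d * dotp p g g - c * dotp p h h \<le> 0"
    using \<eta>(1) by (simp add: mult_le_0_iff)
  then show ?thesis unfolding shift_quad g_def[symmetric] using 1 by linarith
qed

end


section \<open>Moments of sums with uncorrelated increments\<close>

text \<open>Not optimised: large enough for the cases of a small and of a large perturbation in
  \<open>powr_taylor_pos\<close>.\<close>

definition taylor_const :: "real \<Rightarrow> real" where
  "taylor_const q = 3 powr q + q * 2 powr q + q * (q - 1) * 2 powr q"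

definition moment_const :: "real \<Rightarrow> real" where
  "moment_const q = (4 * taylor_const q) powr (q / 2)"

lemma taylor_const_ge: assumes "2 \<le> q" 
  shows "1 \<le> taylor_const q" "3 powr q + q * 2 powr q \<le> taylor_const q"
    "q * (q - 1) * 2 powr q \<le> taylor_const q"
proof -
  have "1 \<le> 3 powr q" using assms by (intro ge_one_powr_ge_zero) auto
  moreover have "0 \<le> q * 2 powr q" "0 \<le> q * (q - 1) * 2 powr q" using assms by auto
  ultimately show "1 \<le> taylor_const q" "3 powr q + q * 2 powr q \<le> taylor_const q"
    "q * (q - 1) * 2 powr q \<le> taylor_const q" by (auto simp: taylor_const_def)
qed

lemma moment_const_pos: "2 \<le> q \<Longrightarrow> 0 < moment_const q"
  using taylor_const_ge[of q] by (simp add: moment_const_def)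

lemma powr_one_plus_le:
  fixes q u :: real
  assumes q: "2 \<le> q" and u: "\<bar>u\<bar> \<le> 1 / 2"
  shows "(1 + u) powr q \<le> 1 + q * u + q * (q - 1) * 2 powr q * u\<^sup>2"
proof (cases "u = 0")
  case False
  define D where "D = (\<lambda>m::nat. \<lambda>t::real. if m = 0 then t powr q else if m = 1 then q * t powr (q - 1)
      else q * (q - 1) * t powr (q - 2))"
  have "\<exists>t. (if 1 + u < 1 then 1 + u < t \<and> t < 1 else 1 < t \<and> t < 1 + u) \<and>
      (1 + u) powr q = (\<Sum>m<2. D m 1 / fact m * (1 + u - 1) ^ m) + D 2 t / fact 2 * (1 + u - 1) ^ 2"
  proof (rule Taylor[where a = "1/2" and b = "3/2"])
    show "\<forall>m t. m < 2 \<and> 1 / 2 \<le> t \<and> t \<le> 3 / 2 \<longrightarrow> DERIV (D m) t :> D (Suc m) t"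
    proof (intro allI impI)
      fix m :: nat and t :: real
      assume *: "m < 2 \<and> 1 / 2 \<le> t \<and> t \<le> 3 / 2"
      then have "m = 0 \<or> m = 1" by auto
      then show "DERIV (D m) t :> D (Suc m) t"
        using * by (auto simp: D_def intro!: derivative_eq_intros)
    qed
  qed (use u False in \<open>auto simp: D_def abs_le_iff\<close>)
  then obtain t where t0: "if 1 + u < 1 then 1 + u < t \<and> t < 1 else 1 < t \<and> t < 1 + u"
    and eq0: "(1 + u) powr q = (\<Sum>m<2. D m 1 / fact m * (1 + u - 1) ^ m) + D 2 t / fact 2 * (1 + u - 1) ^ 2"
    by blast
  have t: "\<bar>t - 1\<bar> \<le> 1/2" using t0 u by (auto simp: abs_le_iff split: if_splits)
  have eq: "(1 + u) powr q = 1 + q * u + q * (q - 1) * t powr (q - 2) / 2 * u\<^sup>2"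
    using eq0 by (simp add: D_def numeral_2_eq_2)
  have "t powr (q - 2) \<le> 2 powr (q - 2)" using t q by (intro powr_mono2) linarith+
  also have "\<dots> \<le> 2 powr q" by simp
  also have "\<dots> \<le> 2 powr q * 2" by simp
  finally have "q * (q - 1) * t powr (q - 2) / 2 * u\<^sup>2 \<le> q * (q - 1) * 2 powr q * u\<^sup>2"
    using q by (intro mult_right_mono) (auto simp: intro!: mult_left_mono order_trans[of "_/2"])
  then show ?thesis using eq by simp
qed simp

text \<open>A perturbation \<open>y\<close> of at least half the size of \<open>x\<close> is absorbed into \<open>\<bar>y\<bar> powr q\<close>. A
  smaller one keeps \<open>x + y\<close> away from \<open>0\<close>, where Taylor's formula applies.\<close>

lemma powr_taylor_pos:
  fixes x y q :: real
  assumes q: "2 \<le> q" and x: "0 \<le> x"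
  shows "\<bar>x + y\<bar> powr q \<le> x powr q + q * x powr (q - 1) * y
      + taylor_const q * (x powr (q - 2) * y\<^sup>2 + \<bar>y\<bar> powr q)"
proof (cases "x \<le> 2 * \<bar>y\<bar>")
  case True
  have "\<bar>x + y\<bar> powr q \<le> (3 * \<bar>y\<bar>) powr q" using True q x by (intro powr_mono2) auto
  also have "\<dots> = 3 powr q * \<bar>y\<bar> powr q" by (simp add: powr_mult)
  finally have 1: "\<bar>x + y\<bar> powr q \<le> 3 powr q * \<bar>y\<bar> powr q" .
  have 2: "- (q * x powr (q - 1) * y) \<le> q * 2 powr q * \<bar>y\<bar> powr q"
  proof (cases "y = 0")
    case False
    have "- (q * x powr (q - 1) * y) \<le> q * (x powr (q - 1) * \<bar>y\<bar>)"
      using q mult_left_mono[of "-y" "\<bar>y\<bar>" "q * x powr (q - 1)"] by (simp add: mult_ac)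
    also have "x powr (q - 1) \<le> (2 * \<bar>y\<bar>) powr (q - 1)"
      using True q x by (intro powr_mono2) auto
    also have "\<dots> = 2 powr (q - 1) * \<bar>y\<bar> powr (q - 1)" by (simp add: powr_mult)
    also have "2 powr (q - 1) * \<bar>y\<bar> powr (q - 1) \<le> 2 powr q * \<bar>y\<bar> powr (q - 1)"
      by (intro mult_right_mono) auto
    also have "q * (2 powr q * \<bar>y\<bar> powr (q - 1) * \<bar>y\<bar>) = q * 2 powr q * \<bar>y\<bar> powr q"
      using False by (simp add: powr_diff)
    finally show ?thesis using q by (simp add: mult_left_mono mult_right_mono)
  qed simp
  have "(3 powr q + q * 2 powr q) * \<bar>y\<bar> powr q \<le> taylor_const q * \<bar>y\<bar> powr q"
    using taylor_const_ge[OF q] by (intro mult_right_mono) auto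
  also have "\<dots> \<le> taylor_const q * (x powr (q - 2) * y\<^sup>2 + \<bar>y\<bar> powr q)"
    using taylor_const_ge[OF q] by (intro mult_left_mono) auto
  finally have 3: "3 powr q * \<bar>y\<bar> powr q + q * 2 powr q * \<bar>y\<bar> powr q \<le>
    taylor_const q * (x powr (q - 2) * y\<^sup>2 + \<bar>y\<bar> powr q)" by (simp add: distrib_right)
  have "0 \<le> x powr q" by simp
  then show ?thesis using 1 2 3 by linarith
next
  case False
  then have xp: "x > 0" by (simp add: not_le)
  define u where "u = y / x"
  have u: "\<bar>u\<bar> \<le> 1/2" using False xp by (simp add: u_def abs_divide field_simps)
  have y: "y = x * u" using xp by (simp add: u_def)
  have xy: "x + y = x * (1 + u)" using y by (simp add: algebra_simps)
  have "\<bar>x + y\<bar> = x * (1 + u)" unfolding xy using xp u by (simp add: abs_le_iff abs_mult)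
  then have "\<bar>x + y\<bar> powr q = x powr q * (1 + u) powr q"
    using xp u by (simp add: powr_mult abs_le_iff)
  also have "\<dots> \<le> x powr q * (1 + q * u + q * (q - 1) * 2 powr q * u\<^sup>2)"
    by (intro mult_left_mono powr_one_plus_le q u) auto
  also have "\<dots> = x powr q + q * x powr (q - 1) * y + (q * (q - 1) * 2 powr q) * (x powr (q - 2) * y\<^sup>2)"
    using xp by (simp add: y powr_diff power2_eq_square algebra_simps)
  also have "\<dots> \<le> x powr q + q * x powr (q - 1) * y + taylor_const q * (x powr (q - 2) * y\<^sup>2 + \<bar>y\<bar> powr q)"
    using taylor_const_ge[OF q] by (intro add_left_mono mult_mono) auto
  finally show ?thesis .
qed

lemma powr_taylor:
  fixes x y q :: real
  assumes q: "2 \<le> q"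
  shows "\<bar>x + y\<bar> powr q \<le> \<bar>x\<bar> powr q + q * (sgn x * \<bar>x\<bar> powr (q - 1) * y)
      + taylor_const q * (\<bar>x\<bar> powr (q - 2) * y\<^sup>2 + \<bar>y\<bar> powr q)"
proof (cases "0 \<le> x")
  case True
  then show ?thesis using powr_taylor_pos[OF q True, of y] by (cases "x = 0") (auto simp: mult_ac)
next
  case False
  then show ?thesis using powr_taylor_pos[OF q, of "- x" "- y"] abs_minus_cancel[of "x + y"]
    by (simp add: mult_ac abs_minus_commute)
qed

lemma powr_Young:
  fixes x y q \<epsilon> :: real
  assumes q: "2 \<le> q" and x: "0 \<le> x" and y: "0 \<le> y" and \<epsilon>: "0 < \<epsilon>"
  shows "x powr (q - 2) * y\<^sup>2 \<le> \<epsilon> * x powr q + (1 / \<epsilon>) powr (q / 2 - 1) * y powr q"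
proof (cases "x = 0 \<or> y = 0")
  case True then show ?thesis using \<epsilon> y by (auto)
next
  case False
  then have xp: "x > 0" and yp: "y > 0" using x y by auto
  show ?thesis
  proof (cases "y\<^sup>2 \<le> \<epsilon> * x\<^sup>2")
    case True
    have "x powr (q - 2) * y\<^sup>2 \<le> x powr (q - 2) * (\<epsilon> * x\<^sup>2)" using True by (intro mult_left_mono) auto
    also have "\<dots> = \<epsilon> * x powr q" using xp by (simp add: powr_diff powr_numeral)
    finally show ?thesis by (simp add: add_increasing2)
  next
    case False
    then have "x\<^sup>2 \<le> y\<^sup>2 / \<epsilon>" using \<epsilon> by (simp add: field_simps)
    then have "(x\<^sup>2) powr (q / 2 - 1) \<le> (y\<^sup>2 / \<epsilon>) powr (q / 2 - 1)"
      using q xp by (intro powr_mono2) auto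
    moreover have "(x\<^sup>2) powr (q / 2 - 1) = x powr (q - 2)"
      using xp by (simp add: powr_powr powr_numeral[symmetric] algebra_simps del: powr_numeral)
    moreover have "(y\<^sup>2 / \<epsilon>) powr (q / 2 - 1) = y powr (q - 2) * (1 / \<epsilon>) powr (q / 2 - 1)"
      using yp \<epsilon> powr_mult[of "y\<^sup>2" "1/\<epsilon>" "q / 2 - 1"]
      by (simp add: powr_powr powr_numeral[symmetric] algebra_simps del: powr_numeral)
    ultimately have "x powr (q - 2) * y\<^sup>2 \<le> y powr (q - 2) * (1 / \<epsilon>) powr (q / 2 - 1) * y\<^sup>2"
      by (intro mult_right_mono) auto
    also have "\<dots> = (1 / \<epsilon>) powr (q / 2 - 1) * y powr q" using yp by (simp add: powr_diff powr_numeral)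
    finally show ?thesis using \<epsilon> by (simp add: add_increasing)
  qed
qed

lemma powr_add_ge:
  fixes a c r :: real
  assumes r: "1 \<le> r" and a: "0 < a" and c: "0 < c"
  shows "a powr r + r * a powr (r - 1) * c \<le> (a + c) powr r"
    and "a powr r + c powr r \<le> (a + c) powr r"
proof -
  have "\<exists>t. a < t \<and> t < a + c \<and> (a + c) powr r - a powr r = (a + c - a) * (r * t powr (r - 1))"
    using a c by (intro MVT2) (auto intro!: derivative_eq_intros)
  then obtain t where t: "a < t" "(a + c) powr r - a powr r = c * (r * t powr (r - 1))" by auto
  have "c * (r * a powr (r - 1)) \<le> c * (r * t powr (r - 1))"
    using a c r t(1) by (intro mult_left_mono powr_mono2) auto
  then show "a powr r + r * a powr (r - 1) * c \<le> (a + c) powr r" using t(2) by (simp add: mult_ac)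
  have "a powr r + c powr r = a * a powr (r - 1) + c * c powr (r - 1)"
    using a c by (simp add: powr_diff)
  also have "\<dots> \<le> a * (a + c) powr (r - 1) + c * (a + c) powr (r - 1)"
    using a c r by (intro add_mono mult_left_mono powr_mono2) auto
  also have "\<dots> = (a + c) * (a + c) powr (r - 1)" by (simp add: distrib_right)
  also have "\<dots> = (a + c) powr r" using a c by (simp add: powr_diff)
  finally show "a powr r + c powr r \<le> (a + c) powr r" .
qed

lemma powr_mult_le_add:
  fixes x y q :: real assumes "1 \<le> q" "0 \<le> x" "0 \<le> y"
  shows "x powr (q - 1) * y \<le> x powr q + y powr q"
proof (cases "x \<le> y")
  case True
  have "x powr (q - 1) * y \<le> y powr (q - 1) * y" using True assms by (intro mult_right_mono powr_mono2) auto
  also have "\<dots> = y powr q" using assms by (cases "y = 0") (auto simp: powr_diff)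
  finally show ?thesis by (simp add: add_increasing)
next
  case False
  have "x powr (q - 1) * y \<le> x powr (q - 1) * x" using False by (intro mult_left_mono) auto
  also have "\<dots> = x powr q" using assms by (cases "x = 0") (auto simp: powr_diff)
  finally show ?thesis by (simp add: add_increasing2)
qed

lemma powr_add_le:
  fixes x y q :: real assumes "0 \<le> q"
  shows "\<bar>x + y\<bar> powr q \<le> 2 powr q * (\<bar>x\<bar> powr q + \<bar>y\<bar> powr q)"
proof -
  have "\<bar>x + y\<bar> powr q \<le> (2 * max \<bar>x\<bar> \<bar>y\<bar>) powr q" using assms by (intro powr_mono2) auto
  also have "\<dots> = 2 powr q * (max \<bar>x\<bar> \<bar>y\<bar>) powr q" by (simp add: powr_mult)
  also have "\<dots> \<le> 2 powr q * (\<bar>x\<bar> powr q + \<bar>y\<bar> powr q)"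
    by (intro mult_left_mono) (auto simp: max_def)
  finally show ?thesis .
qed

context prob_space begin

text \<open>A sum with uncorrelated increments has a moment of order \<open>q\<close> comparable to the power \<open>q / 2\<close> of its
  variance proxy. In the second order expansion of \<open>\<bar>s + d\<bar> powr q\<close> the first order term
  vanishes by \<open>orth\<close>; Young's inequality bounds the mixed term by a fraction of the growth of
  \<open>a powr (q / 2)\<close>. The constant reproduces itself because that growth dominates both the
  linear and the pure power of \<open>c\<close> (\<open>powr_add_ge\<close>).\<close>

lemma moment_recursion_step:
  fixes s d :: "'a \<Rightarrow> real"
  assumes q: "2 \<le> q" and a: "0 < a" and c: "0 < c" and K: "0 \<le> K"
    and [measurable]: "random_variable borel s" "random_variable borel d"
    and di: "integrable M (\<lambda>\<omega>. \<bar>d \<omega>\<bar> powr q)" and dK: "expectation (\<lambda>\<omega>. \<bar>d \<omega>\<bar> powr q) \<le> K * c powr (q / 2)"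
    and orth: "expectation (\<lambda>\<omega>. sgn (s \<omega>) * \<bar>s \<omega>\<bar> powr (q - 1) * d \<omega>) = 0"
    and si: "integrable M (\<lambda>\<omega>. \<bar>s \<omega>\<bar> powr q)"
    and sK: "expectation (\<lambda>\<omega>. \<bar>s \<omega>\<bar> powr q) \<le> K * moment_const q * a powr (q / 2)"
  shows "integrable M (\<lambda>\<omega>. \<bar>s \<omega> + d \<omega>\<bar> powr q) \<and>
    expectation (\<lambda>\<omega>. \<bar>s \<omega> + d \<omega>\<bar> powr q) \<le> K * moment_const q * (a + c) powr (q / 2)"
proof -
  define C where "C = taylor_const q"
  define L where "L = K * moment_const q"
  define r where "r = q / 2"
  define E4 where "E4 = (4 * C) powr (r - 1)"
  have C: "1 \<le> C" using taylor_const_ge[OF q] by (simp add: C_def)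
  have r: "1 \<le> r" using q by (simp add: r_def)
  have L_eq: "L = K * (4 * C) * E4"
    using C by (simp add: L_def moment_const_def E4_def C_def r_def powr_diff)
  have E4: "1 \<le> E4" unfolding E4_def using C r by (intro ge_one_powr_ge_zero) auto
  have L0: "0 \<le> L" using K C E4 by (simp add: L_eq)
  have int: "integrable M (\<lambda>\<omega>. \<bar>s \<omega> + d \<omega>\<bar> powr q)"
  proof (rule Bochner_Integration.integrable_bound[OF _ _ AE_I2])
    show "integrable M (\<lambda>\<omega>. 2 powr q * (\<bar>s \<omega>\<bar> powr q + \<bar>d \<omega>\<bar> powr q))" using si di by simp
    show "norm (\<bar>s \<omega> + d \<omega>\<bar> powr q) \<le> norm (2 powr q * (\<bar>s \<omega>\<bar> powr q + \<bar>d \<omega>\<bar> powr q))" for \<omega>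
      using powr_add_le[of q "s \<omega>" "d \<omega>"] q by (simp)
  qed measurable
  have int1: "integrable M (\<lambda>\<omega>. sgn (s \<omega>) * \<bar>s \<omega>\<bar> powr (q - 1) * d \<omega>)"
  proof (rule Bochner_Integration.integrable_bound[OF _ _ AE_I2])
    show "integrable M (\<lambda>\<omega>. \<bar>s \<omega>\<bar> powr q + \<bar>d \<omega>\<bar> powr q)" using si di by simp
    show "norm (sgn (s \<omega>) * \<bar>s \<omega>\<bar> powr (q - 1) * d \<omega>) \<le> norm (\<bar>s \<omega>\<bar> powr q + \<bar>d \<omega>\<bar> powr q)" for \<omega>
      using powr_mult_le_add[of q "\<bar>s \<omega>\<bar>" "\<bar>d \<omega>\<bar>"] q by (auto simp: abs_mult sgn_real_def)
  qed measurable
  \<comment> \<open>Young's inequality for \<open>s\<close> and the increment rescaled by \<open>sqrt (a / c)\<close>, the ratio of the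
     typical sizes of the two.\<close>
  have y: "\<bar>s \<omega>\<bar> powr (q - 2) * (d \<omega>)\<^sup>2 \<le> c / a * (1 / (4 * C)) * \<bar>s \<omega>\<bar> powr q
      + c / a * E4 * (a / c) powr r * \<bar>d \<omega>\<bar> powr q" for \<omega>
  proof -
    define k where "k = sqrt (a / c)"
    have k: "k > 0" "k\<^sup>2 = a / c" using a c by (simp_all add: k_def)
    have kq: "k powr q = (a / c) powr r"
      using a c by (simp add: k_def powr_half_sqrt[symmetric] powr_powr r_def)
    have "\<bar>s \<omega>\<bar> powr (q - 2) * (\<bar>d \<omega>\<bar> * k)\<^sup>2 \<le>
        1 / (4 * C) * \<bar>s \<omega>\<bar> powr q + (1 / (1 / (4 * C))) powr (q / 2 - 1) * (\<bar>d \<omega>\<bar> * k) powr q"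
      by (rule powr_Young) (use q C k in auto)
    then have "\<bar>s \<omega>\<bar> powr (q - 2) * (d \<omega>)\<^sup>2 * (a / c) \<le>
        1 / (4 * C) * \<bar>s \<omega>\<bar> powr q + E4 * ((a / c) powr r * \<bar>d \<omega>\<bar> powr q)"
      using k kq by (simp add: power_mult_distrib powr_mult E4_def r_def mult_ac)
    then have "c / a * (\<bar>s \<omega>\<bar> powr (q - 2) * (d \<omega>)\<^sup>2 * (a / c)) \<le>
        c / a * (1 / (4 * C) * \<bar>s \<omega>\<bar> powr q + E4 * ((a / c) powr r * \<bar>d \<omega>\<bar> powr q))"
      using a c by (intro mult_left_mono) auto
    then show ?thesis using a c by (simp add: algebra_simps)
  qed
  have "expectation (\<lambda>\<omega>. \<bar>s \<omega> + d \<omega>\<bar> powr q) \<le>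
      expectation (\<lambda>\<omega>. \<bar>s \<omega>\<bar> powr q + q * (sgn (s \<omega>) * \<bar>s \<omega>\<bar> powr (q - 1) * d \<omega>)
       + C * (c / a * (1 / (4 * C)) * \<bar>s \<omega>\<bar> powr q
          + c / a * E4 * (a / c) powr r * \<bar>d \<omega>\<bar> powr q + \<bar>d \<omega>\<bar> powr q))"
  proof (rule integral_mono)
    show "integrable M (\<lambda>\<omega>. \<bar>s \<omega>\<bar> powr q + q * (sgn (s \<omega>) * \<bar>s \<omega>\<bar> powr (q - 1) * d \<omega>)
       + C * (c / a * (1 / (4 * C)) * \<bar>s \<omega>\<bar> powr q
          + c / a * E4 * (a / c) powr r * \<bar>d \<omega>\<bar> powr q + \<bar>d \<omega>\<bar> powr q))"
      using si di int1 by (intro Bochner_Integration.integrable_add integrable_mult_right)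
    fix \<omega>
    have "C * (\<bar>s \<omega>\<bar> powr (q - 2) * (d \<omega>)\<^sup>2 + \<bar>d \<omega>\<bar> powr q) \<le>
       C * (c / a * (1 / (4 * C)) * \<bar>s \<omega>\<bar> powr q
          + c / a * E4 * (a / c) powr r * \<bar>d \<omega>\<bar> powr q + \<bar>d \<omega>\<bar> powr q)"
      using C by (intro mult_left_mono add_right_mono y) auto
    then show "\<bar>s \<omega> + d \<omega>\<bar> powr q \<le> \<bar>s \<omega>\<bar> powr q + q * (sgn (s \<omega>) * \<bar>s \<omega>\<bar> powr (q - 1) * d \<omega>)
       + C * (c / a * (1 / (4 * C)) * \<bar>s \<omega>\<bar> powr q
          + c / a * E4 * (a / c) powr r * \<bar>d \<omega>\<bar> powr q + \<bar>d \<omega>\<bar> powr q)"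
      using powr_taylor[OF q, of "s \<omega>" "d \<omega>"] unfolding C_def[symmetric] by linarith
  qed (rule int)
  also have "\<dots> = expectation (\<lambda>\<omega>. \<bar>s \<omega>\<bar> powr q)
       + C * (c / a * (1 / (4 * C)) * expectation (\<lambda>\<omega>. \<bar>s \<omega>\<bar> powr q)
          + c / a * E4 * (a / c) powr r * expectation (\<lambda>\<omega>. \<bar>d \<omega>\<bar> powr q) + expectation (\<lambda>\<omega>. \<bar>d \<omega>\<bar> powr q))"
    using si di int1 orth by simp
  also have "\<dots> \<le> L * a powr r
       + C * (c / a * (1 / (4 * C)) * (L * a powr r)
          + c / a * E4 * (a / c) powr r * (K * c powr r) + K * c powr r)"
    using sK dK a c C E4 unfolding L_def[symmetric] r_def[symmetric]
    by (intro add_mono mult_left_mono) auto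
  also have "\<dots> = L * a powr r + 1/4 * (L * (a powr r / a * c)) + 1/4 * (L * (a powr r / a * c)) + C * K * c powr r"
    using a c C by (simp add: L_eq powr_divide field_simps)
  also have "C * K * c powr r \<le> 1/2 * (L * c powr r)"
  proof -
    have "2 * C * K * 1 \<le> 4 * C * K * E4" using C K E4 by (intro mult_mono) auto
    then have "C * K \<le> 1/2 * L" by (simp add: L_eq)
    then have "C * K * c powr r \<le> (1/2 * L) * c powr r" by (rule mult_right_mono) simp
    then show ?thesis by simp
  qed
  also have "L * a powr r + 1/4 * (L * (a powr r / a * c)) + 1/4 * (L * (a powr r / a * c)) + 1/2 * (L * c powr r)
     = 1/2 * L * ((a powr r + a powr (r - 1) * c) + (a powr r + c powr r))"
    using a by (simp add: powr_diff field_simps)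
  also have "\<dots> \<le> 1/2 * L * ((a + c) powr r + (a + c) powr r)"
  proof (intro mult_left_mono add_mono powr_add_ge(2)[OF r a c])
    have "1 * (a powr (r - 1) * c) \<le> r * (a powr (r - 1) * c)"
      using r a c by (intro mult_right_mono) auto
    then show "a powr r + a powr (r - 1) * c \<le> (a + c) powr r"
      using powr_add_ge(1)[OF r a c] by simp
  qed (use L0 in auto)
  also have "\<dots> = L * (a + c) powr r" by simp
  finally show ?thesis using int by (simp add: L_def r_def)
qed

text \<open>The start \<open>V\<close> may be as small as desired; it is positive because the step divides by the
  accumulated proxy.\<close>

lemma moment_recursion:
  fixes S d :: "nat \<Rightarrow> 'a \<Rightarrow> real" and c :: "nat \<Rightarrow> real"
  assumes q: "2 \<le> q" and V: "0 < V" and K: "0 \<le> K"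
    and S0: "\<And>\<omega>. S 0 \<omega> = 0" and S_Suc: "\<And>k \<omega>. k < N \<Longrightarrow> S (Suc k) \<omega> = S k \<omega> + d k \<omega>"
    and meas: "\<And>k. k < N \<Longrightarrow> random_variable borel (S k)" "\<And>k. k < N \<Longrightarrow> random_variable borel (d k)"
    and c: "\<And>k. k < N \<Longrightarrow> 0 < c k"
    and di: "\<And>k. k < N \<Longrightarrow> integrable M (\<lambda>\<omega>. \<bar>d k \<omega>\<bar> powr q)"
    and dK: "\<And>k. k < N \<Longrightarrow> expectation (\<lambda>\<omega>. \<bar>d k \<omega>\<bar> powr q) \<le> K * c k powr (q / 2)"
    and orth: "\<And>k. k < N \<Longrightarrow> integrable M (\<lambda>\<omega>. \<bar>S k \<omega>\<bar> powr q) \<Longrightarrow>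
        expectation (\<lambda>\<omega>. sgn (S k \<omega>) * \<bar>S k \<omega>\<bar> powr (q - 1) * d k \<omega>) = 0"
  shows "integrable M (\<lambda>\<omega>. \<bar>S N \<omega>\<bar> powr q) \<and>
    expectation (\<lambda>\<omega>. \<bar>S N \<omega>\<bar> powr q) \<le> K * moment_const q * (V + (\<Sum>k<N. c k)) powr (q / 2)"
proof -
  have "k \<le> N \<Longrightarrow> integrable M (\<lambda>\<omega>. \<bar>S k \<omega>\<bar> powr q) \<and>
    expectation (\<lambda>\<omega>. \<bar>S k \<omega>\<bar> powr q) \<le> K * moment_const q * (V + (\<Sum>k<k. c k)) powr (q / 2)" for k
  proof (induction k)
    case 0
    then show ?case using S0 K moment_const_pos[OF q] q by simp
  next
    case (Suc k)
    then have k: "k < N" by simp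
    have "0 < V + (\<Sum>k<k. c k)" using V c k by (intro add_pos_nonneg sum_nonneg) (auto intro: less_imp_le)
    from moment_recursion_step[OF q this c[OF k] K meas(1)[OF k] meas(2)[OF k] di[OF k] dK[OF k] orth[OF k]]
    show ?case using Suc S_Suc[OF k] by (simp add: add.assoc)
  qed
  then show ?thesis by simp
qed

end


section \<open>Linear and quadratic forms in independent variables\<close>

lemma abs_powr_eq_square_powr: "\<bar>a::real\<bar> powr q = (a\<^sup>2) powr (q / 2)"
proof -
  have "a\<^sup>2 = \<bar>a\<bar> powr 2" by simp
  then show ?thesis by (simp only: powr_powr) simp
qed

context prob_space begin

text \<open>Freezing one of two independent variables, as a form of Fubini's theorem that replaces conditional
  expectations.\<close>

lemma nn_integral_indep_var:
  assumes ind: "indep_var N1 Y N2 W" and f[measurable]: "f \<in> borel_measurable (N1 \<Otimes>\<^sub>M N2)"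
  shows "(\<integral>\<^sup>+\<omega>. f (Y \<omega>, W \<omega>) \<partial>M) = (\<integral>\<^sup>+\<omega>. \<integral>\<^sup>+\<omega>'. f (Y \<omega>, W \<omega>') \<partial>M \<partial>M)"
proof -
  have [measurable]: "Y \<in> measurable M N1" "W \<in> measurable M N2"
    using indep_var_rv1[OF ind] indep_var_rv2[OF ind] by auto
  interpret W: prob_space "distr M N2 W" by (rule prob_space_distr) simp
  have "(\<integral>\<^sup>+\<omega>. f (Y \<omega>, W \<omega>) \<partial>M) = (\<integral>\<^sup>+z. f z \<partial>distr M (N1 \<Otimes>\<^sub>M N2) (\<lambda>\<omega>. (Y \<omega>, W \<omega>)))"
    by (subst nn_integral_distr) simp_all
  also have "distr M (N1 \<Otimes>\<^sub>M N2) (\<lambda>\<omega>. (Y \<omega>, W \<omega>)) = distr M N1 Y \<Otimes>\<^sub>M distr M N2 W"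
    using ind by (simp add: indep_var_distribution_eq)
  also have "(\<integral>\<^sup>+z. f z \<partial>(distr M N1 Y \<Otimes>\<^sub>M distr M N2 W)) =
      (\<integral>\<^sup>+y. \<integral>\<^sup>+w. f (y, w) \<partial>distr M N2 W \<partial>distr M N1 Y)"
    by (subst W.nn_integral_fst[symmetric]) simp_all
  also have "\<dots> = (\<integral>\<^sup>+y. \<integral>\<^sup>+\<omega>'. f (y, W \<omega>') \<partial>M \<partial>distr M N1 Y)"
    by (intro nn_integral_cong) (simp add: nn_integral_distr)
  also have "\<dots> = (\<integral>\<^sup>+\<omega>. \<integral>\<^sup>+\<omega>'. f (Y \<omega>, W \<omega>') \<partial>M \<partial>M)"
    by (subst nn_integral_distr) simp_all
  finally show ?thesis .
qed

lemma indep_var_past: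
  fixes x :: "nat \<Rightarrow> 'a \<Rightarrow> real"
  assumes "indep_vars (\<lambda>_. borel) x {..<p}" "i < p"
    and [measurable]: "g \<in> borel_measurable (Pi\<^sub>M {..<i} (\<lambda>_. borel))" "h \<in> borel_measurable borel"
  shows "indep_var borel (\<lambda>\<omega>. g (\<lambda>j\<in>{..<i}. x j \<omega>)) borel (\<lambda>\<omega>. h (x i \<omega>))"
proof -
  have "indep_var (Pi\<^sub>M {..<i} (\<lambda>_. borel)) (\<lambda>\<omega>. \<lambda>j\<in>{..<i}. x j \<omega>) (Pi\<^sub>M {i} (\<lambda>_. borel)) (\<lambda>\<omega>. \<lambda>j\<in>{i}. x j \<omega>)"
    using assms by (intro indep_var_restrict[where I = "{..<p}"]) auto
  then have "indep_var borel (g \<circ> (\<lambda>\<omega>. \<lambda>j\<in>{..<i}. x j \<omega>)) borel ((\<lambda>f. h (f i)) \<circ> (\<lambda>\<omega>. \<lambda>j\<in>{i}. x j \<omega>))"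
    by (rule indep_var_compose) measurable
  then show ?thesis by (simp add: comp_def)
qed

lemma integrable_powr_mono:
  fixes f :: "'a \<Rightarrow> real"
  assumes [measurable]: "random_variable borel f" and "integrable M (\<lambda>\<omega>. \<bar>f \<omega>\<bar> powr r)" "0 \<le> q" "q \<le> r"
  shows "integrable M (\<lambda>\<omega>. \<bar>f \<omega>\<bar> powr q)"
    and "expectation (\<lambda>\<omega>. \<bar>f \<omega>\<bar> powr q) \<le> 1 + expectation (\<lambda>\<omega>. \<bar>f \<omega>\<bar> powr r)"
proof -
  have le: "\<bar>f \<omega>\<bar> powr q \<le> 1 + \<bar>f \<omega>\<bar> powr r" for \<omega>
  proof (cases "\<bar>f \<omega>\<bar> \<le> 1")
    case True
    then have "\<bar>f \<omega>\<bar> powr q \<le> 1 powr q" using assms by (intro powr_mono2) auto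
    then show ?thesis by (simp add: add_increasing2)
  next
    case False
    then have "\<bar>f \<omega>\<bar> powr q \<le> \<bar>f \<omega>\<bar> powr r" using assms by (intro powr_mono) auto
    then show ?thesis by simp
  qed
  show 1: "integrable M (\<lambda>\<omega>. \<bar>f \<omega>\<bar> powr q)"
    by (rule Bochner_Integration.integrable_bound[of _ "\<lambda>\<omega>. 1 + \<bar>f \<omega>\<bar> powr r", OF _ _ AE_I2])
      (use assms le in auto)
  have "expectation (\<lambda>\<omega>. \<bar>f \<omega>\<bar> powr q) \<le> expectation (\<lambda>\<omega>. 1 + \<bar>f \<omega>\<bar> powr r)"
    using assms by (intro integral_mono 1 le) auto
  then show "expectation (\<lambda>\<omega>. \<bar>f \<omega>\<bar> powr q) \<le> 1 + expectation (\<lambda>\<omega>. \<bar>f \<omega>\<bar> powr r)"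
    using assms by (simp add: prob_space)
qed

lemma integrable_from_powr:
  fixes f :: "'a \<Rightarrow> real"
  assumes [measurable]: "random_variable borel f" and "integrable M (\<lambda>\<omega>. \<bar>f \<omega>\<bar> powr r)" "1 \<le> r"
  shows "integrable M f"
proof -
  have "integrable M (\<lambda>\<omega>. \<bar>f \<omega>\<bar> powr 1)" by (rule integrable_powr_mono(1)[of f r]) (use assms in auto)
  then have "integrable M (\<lambda>\<omega>. \<bar>f \<omega>\<bar>)" by simp
  then show ?thesis using integrable_abs_iff[OF assms(1)] by simp
qed

lemma linear_form_moment:
  fixes x :: "nat \<Rightarrow> 'a \<Rightarrow> real" and a :: "nat \<Rightarrow> real"
  assumes q: "2 \<le> q" and ind: "indep_vars (\<lambda>_. borel) x {..<p}"
    and mean: "\<And>i. i < p \<Longrightarrow> expectation (x i) = 0"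
    and mi: "\<And>i. i < p \<Longrightarrow> integrable M (\<lambda>\<omega>. \<bar>x i \<omega>\<bar> powr q)"
    and mK: "\<And>i. i < p \<Longrightarrow> expectation (\<lambda>\<omega>. \<bar>x i \<omega>\<bar> powr q) \<le> K"
    and V: "0 < V" "(\<Sum>i<p. (a i)\<^sup>2) \<le> V" and K: "0 \<le> K"
  shows "integrable M (\<lambda>\<omega>. \<bar>\<Sum>i<p. a i * x i \<omega>\<bar> powr q) \<and>
    expectation (\<lambda>\<omega>. \<bar>\<Sum>i<p. a i * x i \<omega>\<bar> powr q) \<le> K * moment_const q * (3 * V) powr (q / 2)"
proof -
  define c where "c = (\<lambda>i. (a i)\<^sup>2 + V / (p + 1))"
  have xm[measurable]: "i < p \<Longrightarrow> random_variable borel (x i)" for i using ind by (auto simp: indep_vars_def)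
  have c: "0 < c i" for i using V by (simp add: c_def add_nonneg_pos)
  have rec: "integrable M (\<lambda>\<omega>. \<bar>\<Sum>i<p. a i * x i \<omega>\<bar> powr q) \<and>
    expectation (\<lambda>\<omega>. \<bar>\<Sum>i<p. a i * x i \<omega>\<bar> powr q) \<le> K * moment_const q * (V + (\<Sum>i<p. c i)) powr (q / 2)"
  proof (rule moment_recursion[OF q V(1) K, where d = "\<lambda>i \<omega>. a i * x i \<omega>"])
    fix k assume k: "k < p"
    show "random_variable borel (\<lambda>\<omega>. \<Sum>i<k. a i * x i \<omega>)" "random_variable borel (\<lambda>\<omega>. a k * x k \<omega>)"
      using k by auto
    have e: "\<bar>a k * x k \<omega>\<bar> powr q = \<bar>a k\<bar> powr q * \<bar>x k \<omega>\<bar> powr q" for \<omega> by (simp add: abs_mult powr_mult)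
    show "integrable M (\<lambda>\<omega>. \<bar>a k * x k \<omega>\<bar> powr q)" unfolding e using mi[OF k] by simp
    have "\<bar>a k\<bar> powr q = ((a k)\<^sup>2) powr (q / 2)"
      by (rule abs_powr_eq_square_powr)
    also have "\<dots> \<le> c k powr (q / 2)" using q V by (intro powr_mono2) (auto simp: c_def)
    finally have "\<bar>a k\<bar> powr q * expectation (\<lambda>\<omega>. \<bar>x k \<omega>\<bar> powr q) \<le> c k powr (q / 2) * K"
      using mK[OF k] by (intro mult_mono) (auto intro: integral_nonneg_AE)
    then show "expectation (\<lambda>\<omega>. \<bar>a k * x k \<omega>\<bar> powr q) \<le> K * c k powr (q / 2)"
      unfolding e by (simp add: mult.commute)
    assume int: "integrable M (\<lambda>\<omega>. \<bar>\<Sum>i<k. a i * x i \<omega>\<bar> powr q)"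
    define s where "s = (\<lambda>\<omega>. \<Sum>i<k. a i * x i \<omega>)"
    have [measurable]: "random_variable borel s" unfolding s_def using k by auto
    have "indep_var borel (\<lambda>\<omega>. (\<lambda>f. sgn (\<Sum>i<k. a i * f i) * \<bar>\<Sum>i<k. a i * f i\<bar> powr (q - 1)) (\<lambda>j\<in>{..<k}. x j \<omega>))
       borel (\<lambda>\<omega>. (\<lambda>t. a k * t) (x k \<omega>))"
      by (rule indep_var_past[OF ind k]) measurable
    then have iv: "indep_var borel (\<lambda>\<omega>. sgn (s \<omega>) * \<bar>s \<omega>\<bar> powr (q - 1)) borel (\<lambda>\<omega>. a k * x k \<omega>)"
      by (simp add: s_def)
    have xi: "integrable M (x k)" by (rule integrable_from_powr[OF xm[OF k] mi[OF k]]) (use q in simp)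
    have "integrable M (\<lambda>\<omega>. \<bar>s \<omega>\<bar> powr (q - 1))"
      by (rule integrable_powr_mono(1)[where r = q]) (use int q \<open>random_variable borel s\<close> in \<open>auto simp: s_def\<close>)
    then have gi: "integrable M (\<lambda>\<omega>. sgn (s \<omega>) * \<bar>s \<omega>\<bar> powr (q - 1))"
      by (rule Bochner_Integration.integrable_bound[OF _ _ AE_I2]) (auto simp: abs_mult sgn_real_def)
    show "expectation (\<lambda>\<omega>. sgn (\<Sum>i<k. a i * x i \<omega>) * \<bar>\<Sum>i<k. a i * x i \<omega>\<bar> powr (q - 1) * (a k * x k \<omega>)) = 0"
      using indep_var_lebesgue_integral[OF iv gi] xi mean[OF k] by (simp add: s_def)
  qed (use c in auto)
  have "V + (\<Sum>i<p. c i) = V + (\<Sum>i<p. (a i)\<^sup>2) + V * (p / (p + 1))"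
    by (simp add: c_def sum.distrib)
  also have "V * (p / (p + 1)) \<le> V * 1" using V by (intro mult_left_mono) auto
  finally have "V + (\<Sum>i<p. c i) \<le> 3 * V" using V by simp
  moreover have "0 \<le> V + (\<Sum>i<p. c i)" using V c by (intro add_nonneg_nonneg sum_nonneg) (auto intro: less_imp_le)
  ultimately have "(V + (\<Sum>i<p. c i)) powr (q / 2) \<le> (3 * V) powr (q / 2)" using q by (intro powr_mono2) auto
  then have "K * moment_const q * (V + (\<Sum>i<p. c i)) powr (q / 2) \<le> K * moment_const q * (3 * V) powr (q / 2)"
    using K moment_const_pos[OF q] by (intro mult_left_mono) auto
  then show ?thesis using rec by linarith
qed

end

text \<open>Summing along the lower triangle exhibits the quadratic form as a sum whose \<open>i\<close>-th increment
  involves only \<open>f i\<close> and earlier coordinates.\<close>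

lemma quadratic_form_lower_triangle:
  assumes "symf p A"
  shows "dotp p f (mv p A f) = (\<Sum>i<p. A i i * (f i)\<^sup>2 + 2 * f i * (\<Sum>j<i. A i j * f j))"
  using assms
proof (induction p)
  case 0
  then show ?case by (simp add: dotp_def)
next
  case (Suc p)
  have "dotp (Suc p) f (mv (Suc p) A f) = dotp p f (mv p A f) + (\<Sum>i<p. f i * (A i p * f p))
      + f p * (\<Sum>j<p. A p j * f j) + f p * (A p p * f p)"
    by (simp add: dotp_def mv_def sum.distrib algebra_simps)
  also have "(\<Sum>i<p. f i * (A i p * f p)) = (\<Sum>i<p. f p * (A p i * f i))"
    using Suc.prems by (intro sum.cong) (auto simp: symf_def)
  also have "\<dots> = f p * (\<Sum>j<p. A p j * f j)" by (simp add: sum_distrib_left)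
  finally show ?case using Suc by (simp add: symf_def power2_eq_square algebra_simps)
qed

definition quad_incr_const :: "real \<Rightarrow> real \<Rightarrow> real" where
  "quad_incr_const q K = 4 powr q * ((K + 1) + (K + 1) * ((K + 1) * moment_const q * 3 powr (q / 2)))"

definition quad_const :: "real \<Rightarrow> real \<Rightarrow> real" where
  "quad_const q K = quad_incr_const q K * moment_const q * 3 powr (q / 2)"

lemma quad_incr_const_pos: "2 \<le> q \<Longrightarrow> 0 \<le> K \<Longrightarrow> 0 < quad_incr_const q K"
  unfolding quad_incr_const_def using moment_const_pos[of q]
  by (intro mult_pos_pos add_pos_nonneg[of "K + 1"]) auto

lemma quad_const_pos: "2 \<le> q \<Longrightarrow> 0 \<le> K \<Longrightarrow> 0 < quad_const q K"
  unfolding quad_const_def using moment_const_pos[of q] quad_incr_const_pos[of q K] by simp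

context prob_space begin

text \<open>A version of the inequality of Whittle. The centred form is a sum of increments
  \<open>A i i ((x\<^sub>i)\<^sup>2 - 1) + 2 x\<^sub>i Y\<^sub>i\<close> with \<open>Y\<^sub>i\<close> linear in the earlier variables, each orthogonal to every
  function of the past. The moments of \<open>Y\<^sub>i\<close> come from \<open>linear_form_moment\<close>, and the moment
  recursion applies with the squared row norms as proxies.\<close>

lemma quadratic_form_moment:
  fixes x :: "nat \<Rightarrow> 'a \<Rightarrow> real" and A :: "nat \<Rightarrow> nat \<Rightarrow> real"
  assumes q: "2 \<le> q" and ind: "indep_vars (\<lambda>_. borel) x {..<p}"
    and mean: "\<And>i. i < p \<Longrightarrow> expectation (x i) = 0"
    and var: "\<And>i. i < p \<Longrightarrow> expectation (\<lambda>\<omega>. (x i \<omega>)\<^sup>2) = 1"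
    and mi: "\<And>i. i < p \<Longrightarrow> integrable M (\<lambda>\<omega>. \<bar>x i \<omega>\<bar> powr (2 * q))"
    and mK: "\<And>i. i < p \<Longrightarrow> expectation (\<lambda>\<omega>. \<bar>x i \<omega>\<bar> powr (2 * q)) \<le> K"
    and A: "symf p A" and V: "0 < V" "fro2 p A \<le> V" and K: "0 \<le> K"
  shows "integrable M (\<lambda>\<omega>. \<bar>dotp p (\<lambda>i. x i \<omega>) (mv p A (\<lambda>i. x i \<omega>)) - trf p A\<bar> powr q) \<and>
    expectation (\<lambda>\<omega>. \<bar>dotp p (\<lambda>i. x i \<omega>) (mv p A (\<lambda>i. x i \<omega>)) - trf p A\<bar> powr q) \<le>
      quad_const q K * V powr (q / 2)"
proof -
  define mc where "mc = moment_const q"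
  have mc: "0 < mc" using moment_const_pos[OF q] by (simp add: mc_def)
  define v where "v = (\<lambda>i. (\<Sum>j<p. (A i j)\<^sup>2) + V / (p + 1))"
  have v: "0 < v i" for i using V by (simp add: v_def add_nonneg_pos sum_nonneg)
  have xm[measurable]: "i < p \<Longrightarrow> random_variable borel (x i)" for i using ind by (auto simp: indep_vars_def)
  have xq: "integrable M (\<lambda>\<omega>. \<bar>x i \<omega>\<bar> powr q)" "expectation (\<lambda>\<omega>. \<bar>x i \<omega>\<bar> powr q) \<le> K + 1" if "i < p" for i
    using integrable_powr_mono[of "x i" "2 * q" q] that mi[OF that] mK[OF that] q by auto
  have x1: "integrable M (x i)" if "i < p" for i
    by (rule integrable_from_powr[OF xm[OF that] xq(1)[OF that]]) (use q in simp)
  have x2: "integrable M (\<lambda>\<omega>. (x i \<omega>)\<^sup>2)" if "i < p" for i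
  proof -
    have "integrable M (\<lambda>\<omega>. \<bar>x i \<omega>\<bar> powr 2)"
      by (rule integrable_powr_mono(1)[OF xm[OF that] xq(1)[OF that]]) (use q in auto)
    then show ?thesis by simp
  qed
  have x2q: "integrable M (\<lambda>\<omega>. \<bar>(x i \<omega>)\<^sup>2 - 1\<bar> powr q) \<and>
      expectation (\<lambda>\<omega>. \<bar>(x i \<omega>)\<^sup>2 - 1\<bar> powr q) \<le> 2 powr q * (K + 1)" if i: "i < p" for i
  proof -
    have le: "\<bar>(x i \<omega>)\<^sup>2 - 1\<bar> powr q \<le> 2 powr q * (\<bar>x i \<omega>\<bar> powr (2 * q) + 1)" for \<omega>
    proof -
      have "\<bar>(x i \<omega>)\<^sup>2\<bar> powr q = \<bar>x i \<omega>\<bar> powr (2 * q)"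
        using abs_powr_eq_square_powr[of "x i \<omega>" "2 * q"] by simp
      then show ?thesis using powr_add_le[of q "(x i \<omega>)\<^sup>2" "-1"] q by simp
    qed
    have int: "integrable M (\<lambda>\<omega>. 2 powr q * (\<bar>x i \<omega>\<bar> powr (2 * q) + 1))" using mi[OF i] by simp
    have 1: "integrable M (\<lambda>\<omega>. \<bar>(x i \<omega>)\<^sup>2 - 1\<bar> powr q)"
      by (rule Bochner_Integration.integrable_bound[OF int _ AE_I2]) (use le i in auto)
    have "expectation (\<lambda>\<omega>. \<bar>(x i \<omega>)\<^sup>2 - 1\<bar> powr q) \<le> expectation (\<lambda>\<omega>. 2 powr q * (\<bar>x i \<omega>\<bar> powr (2 * q) + 1))"
      by (intro integral_mono 1 int le)
    also have "\<dots> = 2 powr q * (expectation (\<lambda>\<omega>. \<bar>x i \<omega>\<bar> powr (2 * q)) + 1)"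
      using mi[OF i] by (simp add: prob_space)
    also have "\<dots> \<le> 2 powr q * (K + 1)" using mK[OF i] by (intro mult_left_mono) auto
    finally show ?thesis using 1 by simp
  qed
  define Yf where "Yf = (\<lambda>i (f :: nat \<Rightarrow> real). \<Sum>j<i. A i j * f j)"
  define df where "df = (\<lambda>i (f :: nat \<Rightarrow> real). A i i * ((f i)\<^sup>2 - 1) + 2 * f i * Yf i f)"
  define Sf where "Sf = (\<lambda>i (f :: nat \<Rightarrow> real). \<Sum>k<i. df k f)"
  have Yf_restrict: "Yf i (restrict f {..<k}) = Yf i f" if "i \<le> k" for i k f
    using that by (auto simp: Yf_def intro!: sum.cong)
  have Sf_restrict: "Sf i (restrict f {..<i}) = Sf i f" for i f
    by (auto simp: Sf_def df_def Yf_restrict intro!: sum.cong)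
  have Ym[measurable]: "Yf i \<in> borel_measurable (Pi\<^sub>M {..<k} (\<lambda>_. borel))" if "i \<le> k" for i k
    unfolding Yf_def using that by (intro borel_measurable_sum borel_measurable_times) auto
  have Sm[measurable]: "Sf i \<in> borel_measurable (Pi\<^sub>M {..<i} (\<lambda>_. borel))" for i
    unfolding Sf_def df_def 
    by (intro borel_measurable_sum borel_measurable_add borel_measurable_times borel_measurable_diff borel_measurable_power Ym) auto
  define X where "X = (\<lambda>\<omega> i. x i \<omega>)"
  have XYm[measurable]: "random_variable borel (\<lambda>\<omega>. Yf i (X \<omega>))" if "i < p" for i
    unfolding Yf_def X_def using that by auto
  have Xdm[measurable]: "random_variable borel (\<lambda>\<omega>. df i (X \<omega>))" if "i < p" for i
    unfolding df_def using that XYm[OF that] xm[OF that] by (auto simp: X_def)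
  have XSm[measurable]: "random_variable borel (\<lambda>\<omega>. Sf i (X \<omega>))" if "i < p" for i
    unfolding Sf_def using that Xdm by auto
  have Yq: "integrable M (\<lambda>\<omega>. \<bar>Yf i (X \<omega>)\<bar> powr q) \<and>
      expectation (\<lambda>\<omega>. \<bar>Yf i (X \<omega>)\<bar> powr q) \<le> (K + 1) * mc * (3 powr (q / 2) * v i powr (q / 2))"
    if i: "i < p" for i
  proof -
    have "integrable M (\<lambda>\<omega>. \<bar>\<Sum>j<i. A i j * x j \<omega>\<bar> powr q) \<and>
      expectation (\<lambda>\<omega>. \<bar>\<Sum>j<i. A i j * x j \<omega>\<bar> powr q) \<le> (K + 1) * moment_const q * (3 * v i) powr (q / 2)"
    proof (rule linear_form_moment[OF q])
      show "indep_vars (\<lambda>_. borel) x {..<i}" using i by (intro indep_vars_subset[OF ind]) auto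
      have "(\<Sum>j<i. (A i j)\<^sup>2) \<le> (\<Sum>j<p. (A i j)\<^sup>2)" using i by (intro sum_mono2) auto
      then show "(\<Sum>j<i. (A i j)\<^sup>2) \<le> v i" using V by (simp add: v_def add_increasing2)
    qed (use i mean xq v K in auto)
    then show ?thesis by (simp add: Yf_def X_def powr_mult mc_def)
  qed
  have dq: "integrable M (\<lambda>\<omega>. \<bar>df i (X \<omega>)\<bar> powr q) \<and>
      expectation (\<lambda>\<omega>. \<bar>df i (X \<omega>)\<bar> powr q) \<le> quad_incr_const q K * v i powr (q / 2)"
    if i: "i < p" for i
  proof -
    have "indep_var borel (\<lambda>\<omega>. (\<lambda>f. \<bar>Yf i f\<bar> powr q) (\<lambda>j\<in>{..<i}. x j \<omega>)) borel (\<lambda>\<omega>. (\<lambda>t. \<bar>t\<bar> powr q) (x i \<omega>))"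
      by (rule indep_var_past[OF ind i]) measurable
    then have iv: "indep_var borel (\<lambda>\<omega>. \<bar>Yf i (X \<omega>)\<bar> powr q) borel (\<lambda>\<omega>. \<bar>x i \<omega>\<bar> powr q)"
      by (simp add: Yf_restrict X_def)
    define u where "u = (\<lambda>\<omega>. 2 powr q * (\<bar>A i i\<bar> powr q * \<bar>(x i \<omega>)\<^sup>2 - 1\<bar> powr q
        + 2 powr q * (\<bar>Yf i (X \<omega>)\<bar> powr q * \<bar>x i \<omega>\<bar> powr q)))"
    have le: "\<bar>df i (X \<omega>)\<bar> powr q \<le> u \<omega>" for \<omega>
    proof -
      have "\<bar>df i (X \<omega>)\<bar> powr q \<le> 2 powr q * (\<bar>A i i * ((x i \<omega>)\<^sup>2 - 1)\<bar> powr q + \<bar>2 * x i \<omega> * Yf i (X \<omega>)\<bar> powr q)"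
        unfolding df_def X_def using powr_add_le q by simp
      then show ?thesis by (simp add: u_def abs_mult powr_mult mult_ac)
    qed
    have prod: "integrable M (\<lambda>\<omega>. \<bar>Yf i (X \<omega>)\<bar> powr q * \<bar>x i \<omega>\<bar> powr q)"
      "expectation (\<lambda>\<omega>. \<bar>Yf i (X \<omega>)\<bar> powr q * \<bar>x i \<omega>\<bar> powr q) =
        expectation (\<lambda>\<omega>. \<bar>Yf i (X \<omega>)\<bar> powr q) * expectation (\<lambda>\<omega>. \<bar>x i \<omega>\<bar> powr q)"
      using indep_var_integrable[OF iv] indep_var_lebesgue_integral[OF iv] Yq[OF i] xq[OF i] by auto
    have ui: "integrable M u" unfolding u_def using prod(1) x2q[OF i] by simp
    have di: "integrable M (\<lambda>\<omega>. \<bar>df i (X \<omega>)\<bar> powr q)"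
      by (rule Bochner_Integration.integrable_bound[OF ui _ AE_I2]) (use le i in \<open>auto intro: order_trans[OF le abs_ge_self]\<close>)
    have Aq: "\<bar>A i i\<bar> powr q \<le> v i powr (q / 2)"
    proof -
      have "\<bar>A i i\<bar> powr q = ((A i i)\<^sup>2) powr (q / 2)"
        by (rule abs_powr_eq_square_powr)
      also have "(A i i)\<^sup>2 \<le> (\<Sum>j<p. (A i j)\<^sup>2)" using i by (intro member_le_sum) auto
      then have "((A i i)\<^sup>2) powr (q / 2) \<le> v i powr (q / 2)"
        using q V by (intro powr_mono2) (auto simp: v_def add_increasing2)
      finally show ?thesis .
    qed
    have "expectation (\<lambda>\<omega>. \<bar>df i (X \<omega>)\<bar> powr q) \<le> expectation u"
      by (intro integral_mono di ui le)
    also have "\<dots> = 2 powr q * (\<bar>A i i\<bar> powr q * expectation (\<lambda>\<omega>. \<bar>(x i \<omega>)\<^sup>2 - 1\<bar> powr q)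
        + 2 powr q * (expectation (\<lambda>\<omega>. \<bar>Yf i (X \<omega>)\<bar> powr q) * expectation (\<lambda>\<omega>. \<bar>x i \<omega>\<bar> powr q)))"
      unfolding u_def using prod x2q[OF i] by simp
    also have "\<dots> \<le> 2 powr q * (v i powr (q / 2) * (2 powr q * (K + 1))
        + 2 powr q * ((K + 1) * mc * (3 powr (q / 2) * v i powr (q / 2)) * (K + 1)))"
      using x2q[OF i] Aq Yq[OF i] xq[OF i] K mc by (intro mult_left_mono add_mono mult_mono) (auto intro!: integral_nonneg_AE)
    also have "\<dots> = quad_incr_const q K * v i powr (q / 2)"
    proof -
      have "(4::real) powr q = 2 powr q * 2 powr q" using powr_mult[of 2 2 q] by simp
      then show ?thesis by (simp add: quad_incr_const_def mc_def algebra_simps)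
    qed
    finally show ?thesis using di by simp
  qed
  have rec: "integrable M (\<lambda>\<omega>. \<bar>Sf p (X \<omega>)\<bar> powr q) \<and>
    expectation (\<lambda>\<omega>. \<bar>Sf p (X \<omega>)\<bar> powr q) \<le> quad_incr_const q K * moment_const q * (V + (\<Sum>i<p. v i)) powr (q / 2)"
  proof (rule moment_recursion[OF q V(1), where d = "\<lambda>i \<omega>. df i (X \<omega>)"])
    fix k assume k: "k < p" and int: "integrable M (\<lambda>\<omega>. \<bar>Sf k (X \<omega>)\<bar> powr q)"
    define g where "g = (\<lambda>s::real. sgn s * \<bar>s\<bar> powr (q - 1))"
    have [measurable]: "g \<in> borel_measurable borel" unfolding g_def by measurable
    have ag: "\<bar>g s\<bar> \<le> \<bar>s\<bar> powr (q - 1)" for s by (auto simp: g_def abs_mult sgn_real_def)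
    have "integrable M (\<lambda>\<omega>. \<bar>Sf k (X \<omega>)\<bar> powr (q - 1))"
      by (rule integrable_powr_mono(1)[where r = q]) (use int q k in auto)
    then have gi: "integrable M (\<lambda>\<omega>. g (Sf k (X \<omega>)))"
      by (rule Bochner_Integration.integrable_bound[OF _ _ AE_I2]) (use ag k in auto)
    have gYi: "integrable M (\<lambda>\<omega>. g (Sf k (X \<omega>)) * Yf k (X \<omega>))"
    proof (rule Bochner_Integration.integrable_bound[OF _ _ AE_I2])
      show "integrable M (\<lambda>\<omega>. \<bar>Sf k (X \<omega>)\<bar> powr q + \<bar>Yf k (X \<omega>)\<bar> powr q)" using int Yq[OF k] by simp
      show "norm (g (Sf k (X \<omega>)) * Yf k (X \<omega>)) \<le> norm (\<bar>Sf k (X \<omega>)\<bar> powr q + \<bar>Yf k (X \<omega>)\<bar> powr q)" for \<omega>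
        using powr_mult_le_add[of q "\<bar>Sf k (X \<omega>)\<bar>" "\<bar>Yf k (X \<omega>)\<bar>"] q
          mult_right_mono[OF ag[of "Sf k (X \<omega>)"], of "\<bar>Yf k (X \<omega>)\<bar>"] by (simp add: abs_mult)
    qed (use k in auto)
    have "indep_var borel (\<lambda>\<omega>. (\<lambda>f. g (Sf k f)) (\<lambda>j\<in>{..<k}. x j \<omega>)) borel (\<lambda>\<omega>. (\<lambda>t. t\<^sup>2 - 1) (x k \<omega>))"
      by (rule indep_var_past[OF ind k]) measurable
    then have iv1: "indep_var borel (\<lambda>\<omega>. g (Sf k (X \<omega>))) borel (\<lambda>\<omega>. (x k \<omega>)\<^sup>2 - 1)"
      by (simp add: Sf_restrict X_def)
    have "indep_var borel (\<lambda>\<omega>. (\<lambda>f. g (Sf k f) * Yf k f) (\<lambda>j\<in>{..<k}. x j \<omega>)) borel (\<lambda>\<omega>. (\<lambda>t. t) (x k \<omega>))"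
      by (rule indep_var_past[OF ind k]) measurable
    then have iv2: "indep_var borel (\<lambda>\<omega>. g (Sf k (X \<omega>)) * Yf k (X \<omega>)) borel (x k)"
      by (simp add: Sf_restrict Yf_restrict X_def)
    have i1: "integrable M (\<lambda>\<omega>. (x k \<omega>)\<^sup>2 - 1)" using x2[OF k] by simp
    have e1: "expectation (\<lambda>\<omega>. g (Sf k (X \<omega>)) * ((x k \<omega>)\<^sup>2 - 1)) = 0"
      using indep_var_lebesgue_integral[OF iv1 gi i1] x2[OF k] var[OF k] by (simp add: prob_space)
    have e2: "expectation (\<lambda>\<omega>. g (Sf k (X \<omega>)) * Yf k (X \<omega>) * x k \<omega>) = 0"
      using indep_var_lebesgue_integral[OF iv2 gYi x1[OF k]] mean[OF k] by simp
    have "expectation (\<lambda>\<omega>. g (Sf k (X \<omega>)) * df k (X \<omega>)) =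
        expectation (\<lambda>\<omega>. A k k * (g (Sf k (X \<omega>)) * ((x k \<omega>)\<^sup>2 - 1)) + 2 * (g (Sf k (X \<omega>)) * Yf k (X \<omega>) * x k \<omega>))"
      by (intro Bochner_Integration.integral_cong) (auto simp: df_def X_def algebra_simps)
    also have "\<dots> = 0"
      using e1 e2 indep_var_integrable[OF iv1 gi i1] indep_var_integrable[OF iv2 gYi x1[OF k]]
      by (subst Bochner_Integration.integral_add) auto
    finally show "expectation (\<lambda>\<omega>. sgn (Sf k (X \<omega>)) * \<bar>Sf k (X \<omega>)\<bar> powr (q - 1) * df k (X \<omega>)) = 0"
      by (simp add: g_def)
  qed (use v dq quad_incr_const_pos[OF q K] in \<open>auto simp: Sf_def intro: Xdm\<close>)
  have eq: "dotp p (\<lambda>i. x i \<omega>) (mv p A (\<lambda>i. x i \<omega>)) - trf p A = Sf p (X \<omega>)" for \<omega>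
    unfolding quadratic_form_lower_triangle[OF A] Sf_def df_def Yf_def X_def trf_def
    by (simp add: sum.distrib sum_subtractf algebra_simps)
  have "V + (\<Sum>i<p. v i) = V + fro2 p A + V * (p / (p + 1))"
    by (simp add: v_def sum.distrib fro2_def dotp_def power2_eq_square)
  also have "V * (p / (p + 1)) \<le> V * 1" using V by (intro mult_left_mono) auto
  finally have "V + (\<Sum>i<p. v i) \<le> 3 * V" using V by simp
  moreover have "0 \<le> V + (\<Sum>i<p. v i)" using V v by (intro add_nonneg_nonneg sum_nonneg) (auto intro: less_imp_le)
  ultimately have "(V + (\<Sum>i<p. v i)) powr (q / 2) \<le> (3 * V) powr (q / 2)" using q by (intro powr_mono2) auto
  then have "quad_incr_const q K * moment_const q * (V + (\<Sum>i<p. v i)) powr (q / 2) \<le>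
      quad_incr_const q K * moment_const q * (3 * V) powr (q / 2)"
    using quad_incr_const_pos[OF q K] moment_const_pos[OF q] by (intro mult_left_mono) auto
  also have "\<dots> = quad_const q K * V powr (q / 2)" by (simp add: quad_const_def powr_mult)
  finally show ?thesis unfolding eq using rec by linarith
qed

end


section \<open>One step of the barrier\<close>

text \<open>Adding the row \<open>x\<close> lowers \<open>tr D\<^sup>2\<close> by at least \<open>q3 / (1 + q1)\<close>, where \<open>q1 = x \<bullet> D x\<close> and
  \<open>q3 = x \<bullet> D\<^sup>3 x\<close>, and raising the level by \<open>\<delta>\<close> increases it by about \<open>2 \<delta> tr D\<^sup>3\<close>. The increment
  balances the two. Truncation at \<open>B\<close> keeps it bounded, and the square of \<open>1 + B \<nu>\<close> pays for
  the terms of higher order.\<close>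

definition barrier_incr :: "nat \<Rightarrow> real \<Rightarrow> real \<Rightarrow> (nat \<Rightarrow> nat \<Rightarrow> real) \<Rightarrow> (nat \<Rightarrow> real) \<Rightarrow> real" where
  "barrier_incr p B \<nu> D x =
     min (dotp p (mv p D x) (mv p D (mv p D x)) / tr3 p D) B /
       (2 * (1 + dotp p x (mv p D x)) * (1 + B * \<nu>)\<^sup>2)"

definition barrier_step :: "nat \<Rightarrow> real \<Rightarrow> real \<Rightarrow> (nat \<Rightarrow> nat \<Rightarrow> real) \<Rightarrow> (nat \<Rightarrow> real) \<Rightarrow> nat \<Rightarrow> nat \<Rightarrow> real" where
  "barrier_step p B \<nu> D x = shift_up p (rank1_down p D x)
     (barrier_incr p B \<nu> D x / (1 - barrier_incr p B \<nu> D x * \<nu>))"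

text \<open>The two moves combined: \<open>rank1_fro2\<close> provides room \<open>s * q3\<close> below the bound \<open>\<nu>\<^sup>2\<close>, and the
  increment is chosen such that \<open>shift_fro2\<close> uses up no more than this room.\<close>

lemma barrier_step_props:
  fixes p :: nat and D :: "nat \<Rightarrow> nat \<Rightarrow> real" and x v w :: "nat \<Rightarrow> real" and B \<nu> :: real
  assumes D: "psdf p D" and fro: "fro2 p D \<le> \<nu>\<^sup>2" and \<nu>: "0 < \<nu>" and B: "0 < B" "B * \<nu> \<le> 1"
  defines "\<delta> \<equiv> barrier_incr p B \<nu> D x"
  defines "D' \<equiv> barrier_step p B \<nu> D x"
  shows "0 \<le> \<delta>" "\<delta> \<le> B" "psdf p D'" "fro2 p D' \<le> \<nu>\<^sup>2"
    and "(\<And>v w. 2 * dotp p v w \<le> dotp p w (mv p D w) + N v) \<Longrightarrow>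
      2 * dotp p v w \<le> dotp p w (mv p D' w) + (N v + (dotp p v x)\<^sup>2 - \<delta> * dotp p v v)"
proof -
  define u where "u = mv p D x"
  define q1 where "q1 = dotp p x u"
  define q3 where "q3 = dotp p u (mv p D u)"
  define s where "s = 1 / (1 + q1)"
  define R where "R = min (q3 / tr3 p D) B"
  define D1 where "D1 = rank1_down p D x"
  define d where "d = \<delta> / (1 - \<delta> * \<nu>)"
  define \<beta> where "\<beta> = 1 + B * \<nu>"
  have q1: "0 \<le> q1" and q3: "0 \<le> q3" using D by (simp_all add: q1_def q3_def u_def psdf_def)
  have tr3: "0 \<le> tr3 p D" unfolding tr3_def using D by (intro sum_nonneg) (auto simp: psdf_def)
  have s: "0 < s" "s \<le> 1" using q1 by (auto simp: s_def)
  have R: "0 \<le> R" "R \<le> B" using q3 tr3 B by (auto simp: R_def)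
  have R_tr3: "R * tr3 p D \<le> q3"
  proof (cases "tr3 p D = 0")
    case False
    then have "R * tr3 p D \<le> (q3 / tr3 p D) * tr3 p D" using tr3 by (intro mult_right_mono) (auto simp: R_def)
    then show ?thesis using False by simp
  qed (use q3 in simp)
  have Bn: "0 < B * \<nu>" using B \<nu> by simp
  have \<beta>: "1 < \<beta>" "\<beta> \<le> 2" using Bn B by (auto simp: \<beta>_def)
  have \<delta>: "\<delta> = R * s / (2 * \<beta>\<^sup>2)"
    by (simp add: \<delta>_def barrier_incr_def R_def s_def q1_def q3_def u_def \<beta>_def)
  show \<delta>0: "0 \<le> \<delta>" using R s \<beta> by (simp add: \<delta>)
  have \<beta>2: "1 \<le> \<beta>\<^sup>2" using \<beta> by simp
  have Rs: "0 \<le> R * s" "R * s \<le> R" using R s by (auto simp: mult_left_le)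
  have "\<delta> \<le> R * s / 2" unfolding \<delta> using Rs \<beta>2 by (intro divide_left_mono) auto
  also have "\<dots> \<le> B / 2" using R Rs by simp
  finally have \<delta>B: "\<delta> \<le> B / 2" .
  then show "\<delta> \<le> B" using B by simp
  have \<delta>\<nu>: "0 \<le> \<delta> * \<nu>" "\<delta> * \<nu> \<le> B * \<nu> / 2" using \<delta>0 \<delta>B \<nu> mult_right_mono[OF \<delta>B, of \<nu>] by auto
  have half: "\<delta> * \<nu> \<le> 1 / 2" using \<delta>\<nu> B by simp
  have d0: "0 \<le> d" using \<delta>0 half by (simp add: d_def)
  have d1: "d * (1 - \<delta> * \<nu>) = \<delta>" using half by (simp add: d_def)
  have "1 / (1 - \<delta> * \<nu>) \<le> \<beta>"
  proof -
    have "1 + 2 * (\<delta> * \<nu>) \<le> \<beta>" using \<delta>\<nu> by (simp add: \<beta>_def)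
    moreover have "1 \<le> (1 + 2 * (\<delta> * \<nu>)) * (1 - \<delta> * \<nu>)"
    proof -
      have "0 \<le> (\<delta> * \<nu>) * (1 - 2 * (\<delta> * \<nu>))" using \<delta>\<nu>(1) half by (intro mult_nonneg_nonneg[of "\<delta> * \<nu>"]) auto
      then show ?thesis by (simp add: algebra_simps)
    qed
    ultimately have "1 \<le> \<beta> * (1 - \<delta> * \<nu>)"
      using mult_right_mono[of "1 + 2 * (\<delta> * \<nu>)" \<beta> "1 - \<delta> * \<nu>"] half by linarith
    then show ?thesis using half by (simp add: divide_le_eq)
  qed
  then have "\<delta> * (1 / (1 - \<delta> * \<nu>)) \<le> \<delta> * \<beta>" using \<delta>0 by (intro mult_left_mono)
  then have "d \<le> \<delta> * \<beta>" by (simp add: d_def)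
  also have "\<delta> * \<beta> = R * s / (2 * \<beta>)" using \<beta> by (simp add: \<delta> power2_eq_square)
  finally have d: "d \<le> R * s / (2 * \<beta>)" .
  have D1: "psdf p D1" unfolding D1_def by (rule rank1_psdf[OF D])
  have fro1: "fro2 p D1 \<le> fro2 p D - s * q3"
    using rank1_fro2[OF D, of x] by (simp add: D1_def s_def q1_def q3_def u_def)
  have tr31: "tr3 p D1 \<le> tr3 p D" unfolding D1_def by (rule rank1_tr3[OF D])
  have "fro2 p D1 \<le> \<nu>\<^sup>2" using fro1 fro s q3 mult_nonneg_nonneg[of s q3] by linarith
  then have bd: "dotp p y (mv p D1 y) \<le> \<nu> * dotp p y y" for y
    using \<nu> by - (rule quadratic_form_le_fro2, auto)
  have D': "D' = shift_up p D1 d" by (simp add: D'_def barrier_step_def D1_def d_def \<delta>_def)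
  show "psdf p D'" unfolding D' using shift_psdf[OF D1 _ d0 bd] \<nu> by simp
  show "fro2 p D' \<le> \<nu>\<^sup>2"
  proof -
    have "fro2 p D' \<le> fro2 p D1 + (2 * d + d\<^sup>2 * \<nu>) * tr3 p D1"
      unfolding D' by (rule shift_fro2[OF D1 _ d0 bd]) (use \<nu> in simp)
    also have "(2 * d + d\<^sup>2 * \<nu>) * tr3 p D1 \<le> (2 * d + d\<^sup>2 * \<nu>) * tr3 p D"
      using tr31 d0 \<nu> by (intro mult_left_mono) auto
    also have "2 * d + d\<^sup>2 * \<nu> \<le> R * s"
    proof -
      have "d \<le> B / 2"
      proof -
        have "R * s / (2 * \<beta>) \<le> R * s / 2" using Rs \<beta> by (intro divide_left_mono) auto
        then show ?thesis using d Rs R by simp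
      qed
      then have "d * \<nu> \<le> B / 2 * \<nu>" using \<nu> by (intro mult_right_mono) auto
      then have "d * (2 + d * \<nu>) \<le> d * (2 * \<beta>)" using d0 Bn by (intro mult_left_mono) (auto simp: \<beta>_def)
      also have "\<dots> \<le> R * s / (2 * \<beta>) * (2 * \<beta>)" using d \<beta> by (intro mult_right_mono) auto
      also have "\<dots> = R * s" using \<beta> by simp
      finally show ?thesis by (simp add: power2_eq_square algebra_simps)
    qed
    then have "(2 * d + d\<^sup>2 * \<nu>) * tr3 p D \<le> (R * s) * tr3 p D" using tr3 by (intro mult_right_mono)
    also have "(R * s) * tr3 p D \<le> s * q3" using R_tr3 s by (simp add: mult_left_mono mult.assoc mult.left_commute[of R])
    finally show ?thesis using fro1 fro by linarith
  qed
  assume inv: "\<And>v w. 2 * dotp p v w \<le> dotp p w (mv p D w) + N v"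
  have inv1: "2 * dotp p v w \<le> dotp p w (mv p D1 w) + (N v + (dotp p v x)\<^sup>2)" for v w
    unfolding D1_def by (rule rank1_dominates[OF D inv])
  show "2 * dotp p v w \<le> dotp p w (mv p D' w) + (N v + (dotp p v x)\<^sup>2 - \<delta> * dotp p v v)"
    unfolding D' by (rule shift_dominates[OF D1 _ d0 bd inv1 d1 \<delta>0]) (use half \<nu> in auto)
qed

primrec barrier_mat :: "nat \<Rightarrow> real \<Rightarrow> real \<Rightarrow> (nat \<Rightarrow> nat \<Rightarrow> real) \<Rightarrow> (nat \<Rightarrow> nat \<Rightarrow> real) \<Rightarrow> nat \<Rightarrow> nat \<Rightarrow> nat \<Rightarrow> real" where
  "barrier_mat p B \<nu> D0 x 0 = D0"
| "barrier_mat p B \<nu> D0 x (Suc t) = barrier_step p B \<nu> (barrier_mat p B \<nu> D0 x t) (x t)"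

primrec barrier_level :: "nat \<Rightarrow> real \<Rightarrow> real \<Rightarrow> (nat \<Rightarrow> nat \<Rightarrow> real) \<Rightarrow> real \<Rightarrow> (nat \<Rightarrow> nat \<Rightarrow> real) \<Rightarrow> nat \<Rightarrow> real" where
  "barrier_level p B \<nu> D0 l0 x 0 = l0"
| "barrier_level p B \<nu> D0 l0 x (Suc t) =
     barrier_level p B \<nu> D0 l0 x t + barrier_incr p B \<nu> (barrier_mat p B \<nu> D0 x t) (x t)"

text \<open>The last clause at \<open>w = 0\<close> says that the Gram matrix of the first \<open>t\<close> rows is at least the level.\<close>

lemma barrier_invariant:
  assumes D0: "psdf p D0" "fro2 p D0 \<le> \<nu>\<^sup>2" and \<nu>: "0 < \<nu>" and B: "0 < B" "B * \<nu> \<le> 1"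
    and start: "\<And>v w. 2 * dotp p v w \<le> dotp p w (mv p D0 w) - l0 * dotp p v v"
  shows "psdf p (barrier_mat p B \<nu> D0 x t) \<and> fro2 p (barrier_mat p B \<nu> D0 x t) \<le> \<nu>\<^sup>2 \<and>
    (\<forall>v w. 2 * dotp p v w \<le> dotp p w (mv p (barrier_mat p B \<nu> D0 x t) w) +
      ((\<Sum>s<t. (dotp p v (x s))\<^sup>2) - barrier_level p B \<nu> D0 l0 x t * dotp p v v))"
proof (induction t)
  case 0
  then show ?case using D0 start by simp
next
  case (Suc t)
  let ?D = "barrier_mat p B \<nu> D0 x t" and ?l = "barrier_level p B \<nu> D0 l0 x t"
  from Suc have D: "psdf p ?D" and f: "fro2 p ?D \<le> \<nu>\<^sup>2"
    and inv: "\<And>v w. 2 * dotp p v w \<le> dotp p w (mv p ?D w) + ((\<Sum>s<t. (dotp p v (x s))\<^sup>2) - ?l * dotp p v v)"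
    by auto
  note st = barrier_step_props[OF D f \<nu> B, where x = "x t"]
  have "2 * dotp p v w \<le> dotp p w (mv p (barrier_step p B \<nu> ?D (x t)) w) +
      ((\<Sum>s<t. (dotp p v (x s))\<^sup>2) - ?l * dotp p v v + (dotp p v (x t))\<^sup>2
        - barrier_incr p B \<nu> ?D (x t) * dotp p v v)" for v w
    by (rule st(5)[OF inv])
  then show ?case using st(3,4) by (simp add: algebra_simps)
qed

text \<open>A zero matrix cannot dominate: the left-hand side would be bounded in \<open>w\<close>.\<close>

lemma dominating_fro2_pos:
  assumes inv: "\<And>v w. 2 * dotp p v w \<le> dotp p w (mv p D w) + N v" and p: "0 < p"
  shows "0 < fro2 p D"
proof (rule ccontr)
  assume "\<not> 0 < fro2 p D"
  then have "fro2 p D = 0" using fro2_nonneg[of p D] by simp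
  then have "dotp p w (mv p D w) \<le> 0 * dotp p w w" for w
    by - (rule quadratic_form_le_fro2, auto)
  then have nonpos: "dotp p w (mv p D w) \<le> 0" for w by simp
  have le: "2 * dotp p v w \<le> N v" for v w using inv[of v w] nonpos[of w] by linarith
  let ?v = "\<lambda>i::nat. 1::real"
  have "2 * dotp p ?v (\<lambda>i. (\<bar>N ?v\<bar> + 1) * ?v i) \<le> N ?v" by (rule le)
  then have "2 * ((\<bar>N ?v\<bar> + 1) * real p) \<le> N ?v" by (simp add: dotp_def mult.commute)
  moreover have "(\<bar>N ?v\<bar> + 1) * 1 \<le> (\<bar>N ?v\<bar> + 1) * real p" using p by (intro mult_left_mono) auto
  moreover have "N ?v < 2 * (\<bar>N ?v\<bar> + 1)" by simp
  ultimately show False by (metis linorder_not_le mult.right_neutral mult_le_cancel_left_pos order_trans zero_less_numeral)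
qed

section \<open>The mean gain of one step\<close>

context prob_space begin

lemma quadratic_form_expectation:
  fixes x :: "nat \<Rightarrow> 'a \<Rightarrow> real" and A :: "nat \<Rightarrow> nat \<Rightarrow> real"
  assumes ind: "indep_vars (\<lambda>_. borel) x {..<p}"
    and int: "\<And>i. i < p \<Longrightarrow> integrable M (x i)" "\<And>i. i < p \<Longrightarrow> integrable M (\<lambda>\<omega>. (x i \<omega>)\<^sup>2)"
    and mean: "\<And>i. i < p \<Longrightarrow> expectation (x i) = 0"
    and var: "\<And>i. i < p \<Longrightarrow> expectation (\<lambda>\<omega>. (x i \<omega>)\<^sup>2) = 1"
  shows "integrable M (\<lambda>\<omega>. dotp p (\<lambda>i. x i \<omega>) (mv p A (\<lambda>i. x i \<omega>))) \<and>
    expectation (\<lambda>\<omega>. dotp p (\<lambda>i. x i \<omega>) (mv p A (\<lambda>i. x i \<omega>))) = trf p A"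
proof -
  have e: "integrable M (\<lambda>\<omega>. x i \<omega> * x j \<omega>) \<and>
      expectation (\<lambda>\<omega>. x i \<omega> * x j \<omega>) = (if i = j then 1 else 0)" if ij: "i < p" "j < p" for i j
  proof (cases "i = j")
    case True
    then show ?thesis using int(2)[OF ij(1)] var[OF ij(1)] by (simp add: power2_eq_square)
  next
    case False
    have iv: "indep_vars (\<lambda>_. borel) x {i, j}" using ij by (intro indep_vars_subset[OF ind]) auto
    show ?thesis
      using indep_vars_lebesgue_integral[OF _ iv] indep_vars_integrable[OF _ iv] int(1) mean ij False by auto
  qed
  have eq: "dotp p (\<lambda>i. x i \<omega>) (mv p A (\<lambda>i. x i \<omega>)) = (\<Sum>i<p. \<Sum>j<p. A i j * (x i \<omega> * x j \<omega>))" for \<omega>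
    by (simp add: dotp_def mv_def sum_distrib_left algebra_simps)
  have "expectation (\<lambda>\<omega>. \<Sum>i<p. \<Sum>j<p. A i j * (x i \<omega> * x j \<omega>)) =
      (\<Sum>i<p. expectation (\<lambda>\<omega>. \<Sum>j<p. A i j * (x i \<omega> * x j \<omega>)))"
    by (rule Bochner_Integration.integral_sum) (use e in \<open>auto intro!: Bochner_Integration.integrable_sum\<close>)
  also have "\<dots> = (\<Sum>i<p. \<Sum>j<p. expectation (\<lambda>\<omega>. A i j * (x i \<omega> * x j \<omega>)))"
    by (intro sum.cong refl Bochner_Integration.integral_sum) (use e in auto)
  also have "\<dots> = (\<Sum>i<p. \<Sum>j<p. A i j * (if i = j then 1 else 0))"
    using e by (intro sum.cong refl) simp
  also have "\<dots> = trf p A" by (simp add: trf_def sum.delta if_distrib cong: if_cong)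
  finally show ?thesis unfolding eq using e by (auto intro!: Bochner_Integration.integrable_sum)
qed

end

text \<open>The third power of a symmetric matrix, written with its rows.\<close>

definition cube :: "nat \<Rightarrow> (nat \<Rightarrow> nat \<Rightarrow> real) \<Rightarrow> nat \<Rightarrow> nat \<Rightarrow> real" where
  "cube p D = (\<lambda>i j. dotp p (D i) (mv p D (D j)))"

lemma mv_eq_sum_rows:
  assumes "symf p D" shows "k < p \<Longrightarrow> mv p D x k = (\<Sum>i<p. x i * D i k)"
  using assms by (auto simp: mv_def dotp_def symf_def mult.commute intro!: sum.cong)

lemma dotp_sum_left: "dotp p (\<lambda>k. \<Sum>i\<in>I. c i * f i k) y = (\<Sum>i\<in>I. c i * dotp p (f i) y)"
  by (simp add: dotp_def sum_distrib_right sum_distrib_left mult.assoc sum.swap[of _ I])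

lemma cube_props:
  assumes D: "psdf p D"
  shows "symf p (cube p D)" "trf p (cube p D) = tr3 p D"
    "dotp p x (mv p (cube p D) x) = dotp p (mv p D x) (mv p D (mv p D x))"
    "fro2 p (cube p D) \<le> (tr3 p D)\<^sup>2"
proof -
  have s: "symf p D" using D by (simp add: psdf_def)
  show "symf p (cube p D)"
    using dotp_mv_sym[OF s] by (auto simp: symf_def cube_def) (metis dotp_commute)
  show "trf p (cube p D) = tr3 p D" by (simp add: trf_def cube_def tr3_def)
  have row: "mv p (cube p D) x i = dotp p (D i) (mv p D (mv p D x))" for i
  proof -
    have "mv p (cube p D) x i = (\<Sum>j<p. x j * dotp p (D j) (mv p D (D i)))"
    proof -
      have "dotp p (D i) (mv p D (D j)) = dotp p (D j) (mv p D (D i))" for j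
        using dotp_mv_sym[OF s] dotp_commute by metis
      then have "cube p D i j = dotp p (D j) (mv p D (D i))" for j by (simp add: cube_def)
      then show ?thesis unfolding mv_def[of p "cube p D"] dotp_def[of p "cube p D i"] by (simp add: mult.commute)
    qed
    also have "\<dots> = dotp p (\<lambda>k. \<Sum>j<p. x j * D j k) (mv p D (D i))" by (simp add: dotp_sum_left)
    also have "\<dots> = dotp p (mv p D x) (mv p D (D i))"
      by (intro dotp_cong refl) (simp add: mv_eq_sum_rows[OF s])
    also have "\<dots> = dotp p (D i) (mv p D (mv p D x))"
      using dotp_mv_sym[OF s] dotp_commute by metis
    finally show ?thesis .
  qed
  have "dotp p x (mv p (cube p D) x) = (\<Sum>i<p. x i * dotp p (D i) (mv p D (mv p D x)))"
    by (simp add: dotp_def[of p x] row)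
  also have "\<dots> = dotp p (\<lambda>k. \<Sum>i<p. x i * D i k) (mv p D (mv p D x))" by (simp add: dotp_sum_left)
  also have "\<dots> = dotp p (mv p D x) (mv p D (mv p D x))"
    by (intro dotp_cong refl) (simp add: mv_eq_sum_rows[OF s])
  finally show "dotp p x (mv p (cube p D) x) = dotp p (mv p D x) (mv p D (mv p D x))" .
  have "fro2 p (cube p D) = (\<Sum>i<p. \<Sum>j<p. (cube p D i j)\<^sup>2)"
    by (simp add: fro2_def dotp_def power2_eq_square)
  also have "\<dots> \<le> (\<Sum>i<p. \<Sum>j<p. dotp p (D i) (mv p D (D i)) * dotp p (D j) (mv p D (D j)))"
    unfolding cube_def by (intro sum_mono psdf_Cauchy_Schwarz[OF D])
  also have "\<dots> = (tr3 p D)\<^sup>2" by (simp add: tr3_def power2_eq_square sum_product)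
  finally show "fro2 p (cube p D) \<le> (tr3 p D)\<^sup>2" .
qed

text \<open>The guaranteed mean increment: \<open>1 / (2 (1 + \<phi>))\<close> with corrections for the truncation at \<open>B\<close>,
  for the fluctuation of \<open>q1\<close> (of order \<open>\<nu>\<close>), and for the terms of higher order.\<close>

definition drift :: "real \<Rightarrow> real \<Rightarrow> real \<Rightarrow> real \<Rightarrow> real" where
  "drift C B \<nu> \<phi> = ((1 - (1 + C) / (4 * B)) / (1 + \<phi>) - B * ((C + 1) * \<nu>)) / (2 * (1 + B * \<nu>)\<^sup>2)"

lemma exp_minus_le: "0 \<le> y \<Longrightarrow> exp (- y) \<le> 1 - y + y\<^sup>2" for y :: real
proof -
  assume y: "0 \<le> y"
  have "exp (- y) = 1 / exp y" by (simp add: exp_minus inverse_eq_divide)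
  also have "\<dots> \<le> 1 / (1 + y)" using y exp_ge_add_one_self[of y] by (intro divide_left_mono) auto
  also have "\<dots> \<le> 1 - y + y\<^sup>2"
  proof -
    have "(1 - y + y\<^sup>2) * (1 + y) = 1 + y ^ 3" by (simp add: power2_eq_square power3_eq_cube algebra_simps)
    then show ?thesis using y by (simp add: divide_le_eq)
  qed
  finally show ?thesis .
qed

context prob_space begin

text \<open>The ratio \<open>r = q3 / tr D\<^sup>3\<close> has mean \<open>1\<close> and bounded variance, so truncation at \<open>B\<close> costs only
  \<open>(1 + C) / (4 B)\<close> of the mean. The form \<open>q1\<close> deviates from \<open>tr D \<le> \<phi>\<close> by an amount of order
  \<open>\<nu>\<close>. A nonnegative bounded variable with a lower bound on its mean has a small exponential moment.\<close>

lemma barrier_incr_expectation: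
  fixes x :: "nat \<Rightarrow> 'a \<Rightarrow> real" and D :: "nat \<Rightarrow> nat \<Rightarrow> real"
  assumes ind: "indep_vars (\<lambda>_. borel) x {..<p}"
    and mean: "\<And>i. i < p \<Longrightarrow> expectation (x i) = 0"
    and var: "\<And>i. i < p \<Longrightarrow> expectation (\<lambda>\<omega>. (x i \<omega>)\<^sup>2) = 1"
    and mi: "\<And>i. i < p \<Longrightarrow> integrable M (\<lambda>\<omega>. \<bar>x i \<omega>\<bar> powr 4)"
    and mK: "\<And>i. i < p \<Longrightarrow> expectation (\<lambda>\<omega>. \<bar>x i \<omega>\<bar> powr 4) \<le> K" and K: "0 \<le> K"
    and D: "psdf p D" and fro: "fro2 p D \<le> \<nu>\<^sup>2" "0 < fro2 p D" and \<nu>: "0 < \<nu>" and B: "0 < B" "B * \<nu> \<le> 1"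
    and \<phi>: "trf p D \<le> \<phi>" and lam: "0 \<le> lam"
  shows "expectation (\<lambda>\<omega>. exp (- lam * barrier_incr p B \<nu> D (\<lambda>j. x j \<omega>))) \<le>
      exp (- lam * drift (quad_const 2 K) B \<nu> \<phi> + lam\<^sup>2 * B\<^sup>2)"
proof -
  define C where "C = quad_const 2 K"
  have C: "0 < C" unfolding C_def by (rule quad_const_pos) (use K in auto)
  define X where "X = (\<lambda>\<omega> j. x j \<omega>)"
  define \<tau> where "\<tau> = tr3 p D"
  define T where "T = trf p D"
  define q1 where "q1 = (\<lambda>\<omega>. dotp p (X \<omega>) (mv p D (X \<omega>)))"
  define r where "r = (\<lambda>\<omega>. dotp p (X \<omega>) (mv p (cube p D) (X \<omega>)) / \<tau>)"
  define \<delta> where "\<delta> = (\<lambda>\<omega>. barrier_incr p B \<nu> D (X \<omega>))"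
  define \<beta> where "\<beta> = 2 * (1 + B * \<nu>)\<^sup>2"
  have "0 < 1 + B * \<nu>" using B \<nu> by (simp add: add_pos_pos)
  then have \<beta>: "0 < \<beta>" by (simp add: \<beta>_def)
  have s: "symf p D" using D by (simp add: psdf_def)
  have \<tau>: "0 < \<tau>" unfolding \<tau>_def by (rule psdf_tr3_pos[OF D fro(2)])
  have T: "0 \<le> T" unfolding T_def trf_def using psdf_diag_nonneg[OF D] by (auto intro: sum_nonneg)
  have \<phi>0: "0 \<le> \<phi>" using T \<phi> by (simp add: T_def)
  have xm[measurable]: "i < p \<Longrightarrow> random_variable borel (x i)" for i using ind by (auto simp: indep_vars_def)
  have [measurable]: "random_variable borel q1" "random_variable borel r"
    unfolding q1_def r_def dotp_def mv_def X_def by measurable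
  have \<delta>_eq: "\<delta> \<omega> = min (r \<omega>) B / (1 + q1 \<omega>) / \<beta>" for \<omega>
    by (simp add: \<delta>_def barrier_incr_def r_def q1_def \<tau>_def cube_props(3)[OF D] \<beta>_def)
  have [measurable]: "random_variable borel \<delta>" unfolding \<delta>_eq[abs_def] by measurable
  have \<delta>0: "0 \<le> \<delta> \<omega>" and \<delta>B: "\<delta> \<omega> \<le> B" for \<omega>
    using barrier_step_props(1,2)[OF D fro(1) \<nu> B] by (auto simp: \<delta>_def)
  have x1: "integrable M (x i)" if "i < p" for i
    by (rule integrable_from_powr[OF xm[OF that] mi[OF that]]) simp
  have x2: "integrable M (\<lambda>\<omega>. (x i \<omega>)\<^sup>2)" if "i < p" for i
  proof -
    have "integrable M (\<lambda>\<omega>. \<bar>x i \<omega>\<bar> powr 2)"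
      by (rule integrable_powr_mono(1)[OF xm[OF that] mi[OF that]]) auto
    then show ?thesis by simp
  qed
  have Eq: "integrable M (\<lambda>\<omega>. (q1 \<omega> - T)\<^sup>2) \<and> expectation (\<lambda>\<omega>. (q1 \<omega> - T)\<^sup>2) \<le> C * \<nu>\<^sup>2"
    using quadratic_form_moment[of 2 x p K D "\<nu>\<^sup>2"] ind mean var mi mK s fro \<nu> K
    by (simp add: C_def q1_def X_def T_def)
  have Er: "integrable M (\<lambda>\<omega>. (r \<omega> - 1)\<^sup>2) \<and> expectation (\<lambda>\<omega>. (r \<omega> - 1)\<^sup>2) \<le> C"
  proof -
    have eq: "(r \<omega> - 1)\<^sup>2 = (dotp p (X \<omega>) (mv p (cube p D) (X \<omega>)) - trf p (cube p D))\<^sup>2 / \<tau>\<^sup>2" for \<omega>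
      using \<tau> cube_props(2)[OF D] by (simp add: r_def \<tau>_def power2_eq_square field_simps)
    show ?thesis unfolding eq
      using quadratic_form_moment[of 2 x p K "cube p D" "\<tau>\<^sup>2"] ind mean var mi mK cube_props[OF D] \<tau> K
      by (simp add: C_def X_def \<tau>_def divide_le_eq)
  qed
  have r1: "integrable M r" "expectation r = 1"
    using quadratic_form_expectation[OF ind x1 x2 mean var, of "cube p D"] \<tau> cube_props(2)[OF D]
    by (auto simp: r_def X_def \<tau>_def)
  have r2: "integrable M (\<lambda>\<omega>. (r \<omega>)\<^sup>2)" "expectation (\<lambda>\<omega>. (r \<omega>)\<^sup>2) \<le> 1 + C"
  proof -
    have eq: "(r \<omega>)\<^sup>2 = (r \<omega> - 1)\<^sup>2 + 2 * r \<omega> - 1" for \<omega> by (simp add: power2_eq_square algebra_simps)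
    show "integrable M (\<lambda>\<omega>. (r \<omega>)\<^sup>2)" unfolding eq using Er r1 by simp
    have "expectation (\<lambda>\<omega>. (r \<omega>)\<^sup>2) = expectation (\<lambda>\<omega>. (r \<omega> - 1)\<^sup>2) + 2 * expectation r - 1"
      unfolding eq using Er r1 by (simp add: prob_space)
    then show "expectation (\<lambda>\<omega>. (r \<omega>)\<^sup>2) \<le> 1 + C" using Er r1 by simp
  qed
  \<comment> \<open>The deviation of \<open>q1\<close> enters linearly, but only its square has a known mean, of order
     \<open>\<nu>\<^sup>2\<close>; hence the bound by \<open>(q1 - T)\<^sup>2 / \<nu> + \<nu>\<close>.\<close>
  define low where "low = (\<lambda>\<omega>. (r \<omega> - (r \<omega>)\<^sup>2 / (4 * B)) / (1 + \<phi>) - B * ((q1 \<omega> - T)\<^sup>2 / \<nu> + \<nu>))"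
  have low: "low \<omega> / \<beta> \<le> \<delta> \<omega>" for \<omega>
  proof -
    have q1: "0 \<le> q1 \<omega>" using D by (simp add: q1_def psdf_def)
    have "0 \<le> dotp p (X \<omega>) (mv p (cube p D) (X \<omega>))"
      using D cube_props(3)[OF D] by (simp add: psdf_def)
    then have r0: "0 \<le> r \<omega>" using \<tau> by (simp add: r_def)
    let ?R = "min (r \<omega>) B"
    have R: "0 \<le> ?R" "?R \<le> B" using r0 B by auto
    have "\<bar>q1 \<omega> - T\<bar> \<le> (q1 \<omega> - T)\<^sup>2 / \<nu> + \<nu>"
    proof -
      define e where "e = \<bar>q1 \<omega> - T\<bar>"
      have e2: "(q1 \<omega> - T)\<^sup>2 = e\<^sup>2" by (simp add: e_def)
      have "0 \<le> (e - \<nu>)\<^sup>2 + e * \<nu>" using \<nu> by (simp add: e_def)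
      then have "e * \<nu> \<le> e\<^sup>2 + \<nu>\<^sup>2" by (simp add: power2_eq_square algebra_simps)
      then have "e \<le> (e\<^sup>2 + \<nu>\<^sup>2) / \<nu>" using \<nu> by (simp add: le_divide_eq)
      also have "\<dots> = e\<^sup>2 / \<nu> + \<nu>" using \<nu> by (simp add: add_divide_distrib power2_eq_square)
      finally show ?thesis unfolding e2 by (simp add: e_def)
    qed
    then have dev: "?R * \<bar>q1 \<omega> - T\<bar> \<le> B * ((q1 \<omega> - T)\<^sup>2 / \<nu> + \<nu>)" using R by (intro mult_mono) auto
    have "1 / (1 + \<phi>) - \<bar>q1 \<omega> - T\<bar> \<le> 1 / (1 + T) - \<bar>q1 \<omega> - T\<bar>"
      using T \<phi> by (intro diff_right_mono divide_left_mono) (auto simp: T_def)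
    also have "\<dots> \<le> 1 / (1 + q1 \<omega>)"
    proof -
      have "1 / (1 + T) - 1 / (1 + q1 \<omega>) = (q1 \<omega> - T) / ((1 + T) * (1 + q1 \<omega>))"
        using T q1 by (simp add: diff_divide_eq_iff divide_diff_eq_iff field_simps)
      also have "\<dots> \<le> \<bar>q1 \<omega> - T\<bar> / ((1 + T) * (1 + q1 \<omega>))" using T q1 by (intro divide_right_mono) auto
      also have "\<dots> \<le> \<bar>q1 \<omega> - T\<bar> / 1"
      proof (intro divide_left_mono)
        have "1 * 1 \<le> (1 + T) * (1 + q1 \<omega>)" using T q1 by (intro mult_mono) auto
        then show "1 \<le> (1 + T) * (1 + q1 \<omega>)" by simp
      qed (use T q1 in auto)
      finally show ?thesis by simp
    qed
    finally have "?R * (1 / (1 + \<phi>) - \<bar>q1 \<omega> - T\<bar>) \<le> ?R * (1 / (1 + q1 \<omega>))" using R by (intro mult_left_mono)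
    then have 1: "?R / (1 + \<phi>) - ?R * \<bar>q1 \<omega> - T\<bar> \<le> ?R / (1 + q1 \<omega>)" by (simp add: right_diff_distrib)
    have "r \<omega> - (r \<omega>)\<^sup>2 / (4 * B) \<le> ?R"
    proof -
      have "0 \<le> (r \<omega> - 2 * B)\<^sup>2" by simp
      then have "4 * B * r \<omega> \<le> 4 * B * B + (r \<omega>)\<^sup>2" by (simp add: power2_eq_square algebra_simps)
      then have "r \<omega> \<le> B + (r \<omega>)\<^sup>2 / (4 * B)" using B by (simp add: field_simps)
      moreover have "0 \<le> (r \<omega>)\<^sup>2 / (4 * B)" using B by simp
      ultimately show ?thesis by linarith
    qed
    then have "(r \<omega> - (r \<omega>)\<^sup>2 / (4 * B)) / (1 + \<phi>) \<le> ?R / (1 + \<phi>)" using \<phi>0 by (intro divide_right_mono) auto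
    then have "low \<omega> \<le> ?R / (1 + q1 \<omega>)" unfolding low_def using 1 dev by linarith
    then show ?thesis unfolding \<delta>_eq using \<beta> by (intro divide_right_mono) auto
  qed
  have low_int: "integrable M low" unfolding low_def using r1 r2 Eq by simp
  have "expectation low = (expectation r - expectation (\<lambda>\<omega>. (r \<omega>)\<^sup>2) / (4 * B)) / (1 + \<phi>)
      - B * (expectation (\<lambda>\<omega>. (q1 \<omega> - T)\<^sup>2) / \<nu> + \<nu>)"
    unfolding low_def using r1 r2 Eq by (simp add: prob_space)
  also have "\<dots> \<ge> (1 - (1 + C) / (4 * B)) / (1 + \<phi>) - B * (C * \<nu>\<^sup>2 / \<nu> + \<nu>)"
    using r1 r2 Eq \<nu> B \<phi>0
    by (intro diff_mono divide_right_mono mult_left_mono add_mono) (auto intro!: divide_right_mono)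
  also have "(1 - (1 + C) / (4 * B)) / (1 + \<phi>) - B * (C * \<nu>\<^sup>2 / \<nu> + \<nu>) = drift C B \<nu> \<phi> * \<beta>"
  proof -
    have "C * \<nu>\<^sup>2 / \<nu> + \<nu> = (C + 1) * \<nu>" using \<nu> by (simp add: power2_eq_square algebra_simps)
    moreover have "drift C B \<nu> \<phi> = ((1 - (1 + C) / (4 * B)) / (1 + \<phi>) - B * ((C + 1) * \<nu>)) / \<beta>"
      unfolding drift_def \<beta>_def ..
    ultimately show ?thesis using \<beta> by simp
  qed
  finally have "drift C B \<nu> \<phi> * \<beta> / \<beta> \<le> expectation low / \<beta>" using \<beta> by (intro divide_right_mono) auto
  then have c1: "drift C B \<nu> \<phi> \<le> expectation (\<lambda>\<omega>. low \<omega> / \<beta>)" using \<beta> by simp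
  have \<delta>i: "integrable M \<delta>"
    by (rule integrable_const_bound[where B = B]) (use \<delta>0 \<delta>B in auto)
  have "expectation (\<lambda>\<omega>. low \<omega> / \<beta>) \<le> expectation \<delta>" using low low_int \<delta>i by (intro integral_mono) auto
  with c1 have c: "drift C B \<nu> \<phi> \<le> expectation \<delta>" by simp
  have ei: "integrable M (\<lambda>\<omega>. exp (- (lam * \<delta> \<omega>)))"
    by (rule integrable_const_bound[where B = 1]) (use \<delta>0 lam in auto)
  have "expectation (\<lambda>\<omega>. exp (- (lam * \<delta> \<omega>))) \<le> expectation (\<lambda>\<omega>. 1 - lam * \<delta> \<omega> + lam\<^sup>2 * B\<^sup>2)"
  proof (intro integral_mono ei)
    fix \<omega>
    have "exp (- (lam * \<delta> \<omega>)) \<le> 1 - lam * \<delta> \<omega> + (lam * \<delta> \<omega>)\<^sup>2" using lam \<delta>0 by (intro exp_minus_le) auto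
    also have "(lam * \<delta> \<omega>)\<^sup>2 \<le> (lam * B)\<^sup>2" using lam \<delta>0 \<delta>B by (intro power_mono mult_left_mono mult_nonneg_nonneg) auto
    finally show "exp (- (lam * \<delta> \<omega>)) \<le> 1 - lam * \<delta> \<omega> + lam\<^sup>2 * B\<^sup>2" by (simp add: power_mult_distrib)
  qed (use \<delta>i in auto)
  also have "\<dots> = 1 + (- lam * expectation \<delta> + lam\<^sup>2 * B\<^sup>2)" using \<delta>i by (simp add: prob_space)
  also have "\<dots> \<le> 1 + (- lam * drift C B \<nu> \<phi> + lam\<^sup>2 * B\<^sup>2)" using c lam by (simp add: mult_left_mono)
  also have "\<dots> \<le> exp (- lam * drift C B \<nu> \<phi> + lam\<^sup>2 * B\<^sup>2)" by (rule exp_ge_add_one_self)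
  finally show ?thesis by (simp add: \<delta>_def C_def X_def)
qed

end


section \<open>The smallest eigenvalue of a Gram matrix\<close>

lemma barrier_cong:
  assumes "\<And>s j. s < t \<Longrightarrow> j < p \<Longrightarrow> x s j = y s j"
  shows "barrier_mat p B \<nu> D0 x t = barrier_mat p B \<nu> D0 y t \<and>
    barrier_level p B \<nu> D0 l0 x t = barrier_level p B \<nu> D0 l0 y t"
  using assms
proof (induction t)
  case (Suc t)
  have mv: "mv p D (x t) = mv p D (y t)" for D
    unfolding mv_def using Suc.prems by (intro ext dotp_cong) auto
  have dp: "dotp p (x t) v = dotp p (y t) v" for v
    using Suc.prems by (intro dotp_cong) auto
  show ?case using Suc.IH Suc.prems
    by (simp add: barrier_step_def barrier_incr_def rank1_down_def mv dp)
qed simp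

lemma borel_measurable_dotp:
  assumes "\<And>i. i < p \<Longrightarrow> (\<lambda>\<omega>. x \<omega> i) \<in> borel_measurable N" "\<And>i. i < p \<Longrightarrow> (\<lambda>\<omega>. y \<omega> i) \<in> borel_measurable N"
  shows "(\<lambda>\<omega>. dotp p (x \<omega>) (y \<omega>)) \<in> borel_measurable N"
  unfolding dotp_def using assms by (intro borel_measurable_sum borel_measurable_times) auto

lemma borel_measurable_mv:
  assumes "\<And>i j. (\<lambda>\<omega>. A \<omega> i j) \<in> borel_measurable N" "\<And>i. i < p \<Longrightarrow> (\<lambda>\<omega>. y \<omega> i) \<in> borel_measurable N"
  shows "(\<lambda>\<omega>. mv p (A \<omega>) (y \<omega>) i) \<in> borel_measurable N"
  unfolding mv_def using assms by (intro borel_measurable_dotp) auto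

lemma borel_measurable_barrier_incr:
  assumes A: "\<And>i j. (\<lambda>\<omega>. A \<omega> i j) \<in> borel_measurable N" and x: "\<And>i. i < p \<Longrightarrow> (\<lambda>\<omega>. x \<omega> i) \<in> borel_measurable N"
  shows "(\<lambda>\<omega>. barrier_incr p B \<nu> (A \<omega>) (x \<omega>)) \<in> borel_measurable N"
proof -
  have [measurable]: "(\<lambda>\<omega>. dotp p (mv p (A \<omega>) (x \<omega>)) (mv p (A \<omega>) (mv p (A \<omega>) (x \<omega>)))) \<in> borel_measurable N"
    "(\<lambda>\<omega>. dotp p (x \<omega>) (mv p (A \<omega>) (x \<omega>))) \<in> borel_measurable N"
    by (intro borel_measurable_dotp borel_measurable_mv A x | assumption)+
  have [measurable]: "(\<lambda>\<omega>. tr3 p (A \<omega>)) \<in> borel_measurable N"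
    unfolding tr3_def by (intro borel_measurable_sum borel_measurable_dotp borel_measurable_mv A)
  show ?thesis unfolding barrier_incr_def by measurable
qed

lemma borel_measurable_barrier_step:
  assumes A: "\<And>i j. (\<lambda>\<omega>. A \<omega> i j) \<in> borel_measurable N" and x: "\<And>i. i < p \<Longrightarrow> (\<lambda>\<omega>. x \<omega> i) \<in> borel_measurable N"
  shows "(\<lambda>\<omega>. barrier_step p B \<nu> (A \<omega>) (x \<omega>) i j) \<in> borel_measurable N"
proof -
  have mvm: "(\<lambda>\<omega>. mv p (A \<omega>) (x \<omega>) i) \<in> borel_measurable N" for i
    by (intro borel_measurable_mv A x)
  have qm: "(\<lambda>\<omega>. dotp p (x \<omega>) (mv p (A \<omega>) (x \<omega>))) \<in> borel_measurable N"
    by (intro borel_measurable_dotp mvm x)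
  have D1: "(\<lambda>\<omega>. rank1_down p (A \<omega>) (x \<omega>) i j) \<in> borel_measurable N" for i j
    unfolding rank1_down_def using A mvm qm by measurable
  have D2: "(\<lambda>\<omega>. mv p (rank1_down p (A \<omega>) (x \<omega>)) (rank1_down p (A \<omega>) (x \<omega>) i) j) \<in> borel_measurable N" for i j
    by (intro borel_measurable_mv D1)
  have "(\<lambda>\<omega>. barrier_incr p B \<nu> (A \<omega>) (x \<omega>)) \<in> borel_measurable N"
    by (intro borel_measurable_barrier_incr A x)
  then show ?thesis unfolding barrier_step_def shift_up_def using D1 D2 by measurable
qed

lemma borel_measurable_barrier:
  assumes "\<And>s j. s < t \<Longrightarrow> j < p \<Longrightarrow> (\<lambda>\<omega>. x \<omega> s j) \<in> borel_measurable N"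
  shows "(\<lambda>\<omega>. barrier_mat p B \<nu> D0 (x \<omega>) t i j) \<in> borel_measurable N"
    and "(\<lambda>\<omega>. barrier_level p B \<nu> D0 l0 (x \<omega>) t) \<in> borel_measurable N"
proof -
  have m: "t' \<le> t \<Longrightarrow> (\<lambda>\<omega>. barrier_mat p B \<nu> D0 (x \<omega>) t' i j) \<in> borel_measurable N" for t' i j
  proof (induction t' arbitrary: i j)
    case (Suc t')
    then show ?case unfolding barrier_mat.simps
      using assms by (intro borel_measurable_barrier_step) auto
  qed simp
  then show "(\<lambda>\<omega>. barrier_mat p B \<nu> D0 (x \<omega>) t i j) \<in> borel_measurable N" by simp
  have "t' \<le> t \<Longrightarrow> (\<lambda>\<omega>. barrier_level p B \<nu> D0 l0 (x \<omega>) t') \<in> borel_measurable N" for t'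
  proof (induction t')
    case (Suc t')
    have "(\<lambda>\<omega>. barrier_incr p B \<nu> (barrier_mat p B \<nu> D0 (x \<omega>) t') (x \<omega> t')) \<in> borel_measurable N"
      using m Suc.prems assms by (intro borel_measurable_barrier_incr) auto
    then show ?case using Suc by simp
  qed simp
  then show "(\<lambda>\<omega>. barrier_level p B \<nu> D0 l0 (x \<omega>) t) \<in> borel_measurable N" by simp
qed

context prob_space begin

lemma indep_vars_reindex:
  assumes ind: "indep_vars (\<lambda>_. N) X (f ` J)" and inj: "inj_on f J"
  shows "indep_vars (\<lambda>_. N) (\<lambda>j. X (f j)) J"
proof -
  have "indep_vars (\<lambda>j. Pi\<^sub>M {f j} (\<lambda>_. N)) (\<lambda>j \<omega>. restrict (\<lambda>i. X i \<omega>) {f j}) J"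
    by (rule indep_vars_restrict[OF ind]) (use inj in \<open>auto simp: disjoint_family_on_def inj_on_def\<close>)
  then have "indep_vars (\<lambda>_. N) (\<lambda>j \<omega>. (\<lambda>g. g (f j)) (restrict (\<lambda>i. X i \<omega>) {f j})) J"
    by (rule indep_vars_compose2) measurable
  then show ?thesis by simp
qed

text \<open>The matrix after \<open>t\<close> rows is a function of these rows, hence independent of the next one; it is
  always admissible for \<open>barrier_incr_expectation\<close>, so each row contributes a deterministic factor.\<close>

lemma barrier_level_exp_moment:
  fixes z :: "nat \<times> nat \<Rightarrow> 'a \<Rightarrow> real"
  assumes ind: "indep_vars (\<lambda>_. borel) z ({..<m} \<times> {..<p})"
    and mean: "\<And>i. i \<in> {..<m} \<times> {..<p} \<Longrightarrow> expectation (z i) = 0"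
    and var: "\<And>i. i \<in> {..<m} \<times> {..<p} \<Longrightarrow> expectation (\<lambda>\<omega>. (z i \<omega>)\<^sup>2) = 1"
    and mi: "\<And>i. i \<in> {..<m} \<times> {..<p} \<Longrightarrow> integrable M (\<lambda>\<omega>. \<bar>z i \<omega>\<bar> powr 4)"
    and mK: "\<And>i. i \<in> {..<m} \<times> {..<p} \<Longrightarrow> expectation (\<lambda>\<omega>. \<bar>z i \<omega>\<bar> powr 4) \<le> K" and K: "0 \<le> K"
    and D0: "psdf p D0" "fro2 p D0 \<le> \<nu>\<^sup>2" and \<nu>: "0 < \<nu>" and B: "0 < B" "B * \<nu> \<le> 1" and p: "0 < p"
    and start: "\<And>v w. 2 * dotp p v w \<le> dotp p w (mv p D0 w) - l0 * dotp p v v"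
    and \<phi>: "sqrt p * \<nu> \<le> \<phi>" and lam: "0 \<le> lam" and t: "t \<le> m"
  shows "(\<integral>\<^sup>+\<omega>. ennreal (exp (- lam * barrier_level p B \<nu> D0 l0 (\<lambda>s j. z (s, j) \<omega>) t)) \<partial>M) \<le>
     ennreal (exp (- lam * l0 + t * (- lam * drift (quad_const 2 K) B \<nu> \<phi> + lam\<^sup>2 * B\<^sup>2)))"
  using t
proof (induction t)
  case 0
  then show ?case by (simp add: emeasure_space_1)
next
  case (Suc t)
  define \<rho> where "\<rho> = - lam * drift (quad_const 2 K) B \<nu> \<phi> + lam\<^sup>2 * B\<^sup>2"
  define A where "A = {..<t} \<times> {..<p}"
  define R where "R = {t} \<times> {..<p}"
  define lev where "lev = (\<lambda>f :: nat \<times> nat \<Rightarrow> real. barrier_level p B \<nu> D0 l0 (\<lambda>s j. f (s, j)) t)"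
  define mat where "mat = (\<lambda>f :: nat \<times> nat \<Rightarrow> real. barrier_mat p B \<nu> D0 (\<lambda>s j. f (s, j)) t)"
  define g where "g = (\<lambda>(y :: nat \<times> nat \<Rightarrow> real, w :: nat \<times> nat \<Rightarrow> real).
     ennreal (exp (- lam * (lev y + barrier_incr p B \<nu> (mat y) (\<lambda>j. w (t, j))))))"
  define Z where "Z = (\<lambda>\<omega> i. z i \<omega>)"
  have zm: "i \<in> {..<m} \<times> {..<p} \<Longrightarrow> random_variable borel (z i)" for i using ind by (auto simp: indep_vars_def)
  have iv: "indep_var (Pi\<^sub>M A (\<lambda>_. borel)) (\<lambda>\<omega>. restrict (Z \<omega>) A) (Pi\<^sub>M R (\<lambda>_. borel)) (\<lambda>\<omega>. restrict (Z \<omega>) R)"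
    unfolding Z_def using Suc.prems by (intro indep_var_restrict[OF ind]) (auto simp: A_def R_def)
  have lev_restrict: "lev (restrict f A) = lev f" and mat_restrict: "mat (restrict f A) = mat f" for f
    unfolding lev_def mat_def using barrier_cong[of t p "\<lambda>s j. restrict f A (s, j)" "\<lambda>s j. f (s, j)"]
    by (auto simp: A_def)
  have incr_restrict: "barrier_incr p B \<nu> D (\<lambda>j. restrict f R (t, j)) = barrier_incr p B \<nu> D (\<lambda>j. f (t, j))" for D f
  proof -
    have "mv p D (\<lambda>j. restrict f R (t, j)) = mv p D (\<lambda>j. f (t, j))" for D
      unfolding mv_def by (intro ext dotp_cong) (auto simp: R_def)
    moreover have "dotp p (\<lambda>j. restrict f R (t, j)) v = dotp p (\<lambda>j. f (t, j)) v" for v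
      by (intro dotp_cong) (auto simp: R_def)
    ultimately show ?thesis by (simp add: barrier_incr_def)
  qed
  have gm: "g \<in> borel_measurable (Pi\<^sub>M A (\<lambda>_. borel) \<Otimes>\<^sub>M Pi\<^sub>M R (\<lambda>_. borel))"
  proof -
    have "(\<lambda>yw. lev (fst yw)) \<in> borel_measurable (Pi\<^sub>M A (\<lambda>_. borel) \<Otimes>\<^sub>M Pi\<^sub>M R (\<lambda>_. borel))"
      unfolding lev_def by (intro borel_measurable_barrier measurable_compose[OF measurable_fst] measurable_component_singleton) (auto simp: A_def)
    moreover have "(\<lambda>yw. barrier_incr p B \<nu> (mat (fst yw)) (\<lambda>j. snd yw (t, j))) \<in> borel_measurable (Pi\<^sub>M A (\<lambda>_. borel) \<Otimes>\<^sub>M Pi\<^sub>M R (\<lambda>_. borel))"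
      unfolding mat_def by (intro borel_measurable_barrier_incr borel_measurable_barrier measurable_compose[OF measurable_fst]
        measurable_compose[OF measurable_snd] measurable_component_singleton) (auto simp: A_def R_def)
    ultimately show ?thesis unfolding g_def case_prod_beta' by measurable
  qed
  have "(\<integral>\<^sup>+\<omega>. ennreal (exp (- lam * barrier_level p B \<nu> D0 l0 (\<lambda>s j. z (s, j) \<omega>) (Suc t))) \<partial>M) =
     (\<integral>\<^sup>+\<omega>. g (restrict (Z \<omega>) A, restrict (Z \<omega>) R) \<partial>M)"
    unfolding g_def prod.case lev_restrict mat_restrict incr_restrict by (simp add: lev_def mat_def Z_def)
  also have "\<dots> = (\<integral>\<^sup>+\<omega>. \<integral>\<^sup>+\<omega>'. g (restrict (Z \<omega>) A, restrict (Z \<omega>') R) \<partial>M \<partial>M)"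
    by (rule nn_integral_indep_var[OF iv gm])
  also have "\<dots> \<le> (\<integral>\<^sup>+\<omega>. ennreal (exp (- lam * lev (Z \<omega>))) * ennreal (exp \<rho>) \<partial>M)"
  proof (rule nn_integral_mono)
    fix \<omega>
    define D where "D = mat (Z \<omega>)"
    have inv: "psdf p D" "fro2 p D \<le> \<nu>\<^sup>2"
      and dom: "\<And>v w. 2 * dotp p v w \<le> dotp p w (mv p D w) +
       ((\<Sum>s<t. (dotp p v (\<lambda>j. Z \<omega> (s, j)))\<^sup>2) - lev (Z \<omega>) * dotp p v v)"
      using barrier_invariant[OF D0 \<nu> B start, of "\<lambda>s j. Z \<omega> (s, j)" t] by (auto simp: D_def mat_def lev_def)
    have fp: "0 < fro2 p D" by (rule dominating_fro2_pos[OF dom p])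
    have tr: "trf p D \<le> \<phi>"
    proof -
      have "(trf p D)\<^sup>2 \<le> p * fro2 p D" by (rule trf_sq_le)
      also have "\<dots> \<le> p * \<nu>\<^sup>2" using inv(2) by (intro mult_left_mono) auto
      also have "\<dots> = (sqrt p * \<nu>)\<^sup>2" by (simp add: power_mult_distrib)
      finally have "trf p D \<le> sqrt p * \<nu>" using \<nu> by - (rule power2_le_imp_le, auto)
      then show ?thesis using \<phi> by simp
    qed
    have "indep_vars (\<lambda>_. borel) (\<lambda>j. z (t, j)) {..<p}"
    proof (rule indep_vars_reindex)
      show "indep_vars (\<lambda>_. borel) z (Pair t ` {..<p})"
        using Suc.prems by (intro indep_vars_subset[OF ind]) auto
    qed (simp add: inj_on_def)
    then have ex: "expectation (\<lambda>\<omega>. exp (- lam * barrier_incr p B \<nu> D (\<lambda>j. z (t, j) \<omega>))) \<le> exp \<rho>"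
      unfolding \<rho>_def
      by (rule barrier_incr_expectation) (use mean var mi mK K inv fp \<nu> B tr lam Suc.prems in auto)
    have incr0: "0 \<le> barrier_incr p B \<nu> D x" for x using barrier_step_props(1)[OF inv \<nu> B] .
    have im: "random_variable borel (\<lambda>\<omega>. barrier_incr p B \<nu> D (\<lambda>j. z (t, j) \<omega>))"
      by (intro borel_measurable_barrier_incr zm) (use Suc.prems in auto)
    have ei: "integrable M (\<lambda>\<omega>. exp (- lam * barrier_incr p B \<nu> D (\<lambda>j. z (t, j) \<omega>)))"
      by (rule integrable_const_bound[where B = 1]) (use im incr0 lam in auto)
    have "(\<integral>\<^sup>+\<omega>'. g (restrict (Z \<omega>) A, restrict (Z \<omega>') R) \<partial>M) =
        (\<integral>\<^sup>+\<omega>'. ennreal (exp (- lam * lev (Z \<omega>))) * ennreal (exp (- lam * barrier_incr p B \<nu> D (\<lambda>j. z (t, j) \<omega>'))) \<partial>M)"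
      unfolding g_def prod.case lev_restrict mat_restrict incr_restrict
      by (intro nn_integral_cong) (simp add: D_def Z_def ennreal_mult'[symmetric] exp_add[symmetric] algebra_simps)
    also have "\<dots> = ennreal (exp (- lam * lev (Z \<omega>))) * (\<integral>\<^sup>+\<omega>'. ennreal (exp (- lam * barrier_incr p B \<nu> D (\<lambda>j. z (t, j) \<omega>'))) \<partial>M)"
      using im by (intro nn_integral_cmult) measurable
    also have "\<dots> = ennreal (exp (- lam * lev (Z \<omega>))) * ennreal (expectation (\<lambda>\<omega>. exp (- lam * barrier_incr p B \<nu> D (\<lambda>j. z (t, j) \<omega>))))"
      by (subst nn_integral_eq_integral[OF ei]) auto
    also have "\<dots> \<le> ennreal (exp (- lam * lev (Z \<omega>))) * ennreal (exp \<rho>)"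
      using ex by (intro mult_left_mono ennreal_leI) auto
    finally show "(\<integral>\<^sup>+\<omega>'. g (restrict (Z \<omega>) A, restrict (Z \<omega>') R) \<partial>M) \<le> ennreal (exp (- lam * lev (Z \<omega>))) * ennreal (exp \<rho>)" .
  qed
  also have "\<dots> = (\<integral>\<^sup>+\<omega>. ennreal (exp (- lam * lev (Z \<omega>))) \<partial>M) * ennreal (exp \<rho>)"
  proof (rule nn_integral_multc)
    have "random_variable borel (\<lambda>\<omega>. lev (Z \<omega>))"
      unfolding lev_def Z_def by (intro borel_measurable_barrier zm) (use Suc.prems in auto)
    then show "(\<lambda>\<omega>. ennreal (exp (- lam * lev (Z \<omega>)))) \<in> borel_measurable M" by measurable
  qed
  also have "\<dots> \<le> ennreal (exp (- lam * l0 + t * \<rho>)) * ennreal (exp \<rho>)"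
    using Suc unfolding lev_def Z_def \<rho>_def by (intro mult_right_mono) auto
  also have "\<dots> = ennreal (exp (- lam * l0 + Suc t * \<rho>))"
    by (simp add: ennreal_mult'[symmetric] exp_add[symmetric] algebra_simps)
  finally show ?case by (simp add: \<rho>_def)
qed

end

definition scaled_id :: "real \<Rightarrow> nat \<Rightarrow> nat \<Rightarrow> real" where
  "scaled_id a = (\<lambda>i j. if i = j then a else 0)"

lemma scaled_id_mv: "i < p \<Longrightarrow> mv p (scaled_id a) x i = a * x i"
  by (simp add: mv_def dotp_def scaled_id_def if_distrib if_distribR sum.delta cong: if_cong)

lemma scaled_id_props:
  assumes "0 \<le> a"
  shows "psdf p (scaled_id a)" "fro2 p (scaled_id a) = p * a\<^sup>2"
    "dotp p x (mv p (scaled_id a) y) = a * dotp p x y"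
proof -
  show q: "dotp p x (mv p (scaled_id a) y) = a * dotp p x y" for x y
    unfolding dotp_linear(6)[symmetric] by (intro dotp_cong refl scaled_id_mv)
  show "psdf p (scaled_id a)"
    unfolding psdf_def q using assms by (auto simp: symf_def scaled_id_def dotp_self_nonneg)
  show "fro2 p (scaled_id a) = p * a\<^sup>2"
    by (simp add: fro2_def dotp_def scaled_id_def if_distrib if_distribR sum.delta power2_eq_square cong: if_cong)
qed

text \<open>The level after \<open>m\<close> rows, started at \<open>- \<alpha> m\<close> with the exact inverse \<open>1 / (\<alpha> m)\<close> of
  \<open>0 - (- \<alpha> m)\<close>, whose Frobenius norm \<open>sqrt p / (\<alpha> m)\<close> serves as \<open>\<nu>\<close>.\<close>

definition eigen_level :: "real \<Rightarrow> real \<Rightarrow> nat \<Rightarrow> nat \<Rightarrow> (nat \<Rightarrow> nat \<Rightarrow> real) \<Rightarrow> real" where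
  "eigen_level \<alpha> B m p x =
     barrier_level p B (sqrt p / (\<alpha> * m)) (scaled_id (1 / (\<alpha> * m))) (- (\<alpha> * m)) x m"

lemma scaled_id_start:
  assumes "0 < a"
  shows "2 * dotp p v w \<le> dotp p w (mv p (scaled_id (1 / a)) w) - (- a) * dotp p v v"
proof -
  have "0 \<le> dotp p (\<lambda>i. a * v i - w i) (\<lambda>i. a * v i - w i)" by (rule dotp_self_nonneg)
  also have "\<dots> = a * (a * dotp p v v - 2 * dotp p v w + dotp p w w / a)"
    unfolding dotp_linear using assms by (simp add: dotp_commute[of p w v] algebra_simps)
  finally have "0 \<le> a * dotp p v v - 2 * dotp p v w + dotp p w w / a"
    using assms by (simp add: zero_le_mult_iff)
  then show ?thesis using assms by (simp add: scaled_id_props(3))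
qed

text \<open>With \<open>\<alpha> = \<eta> / 2\<close> and \<open>\<phi> = p / (\<alpha> m)\<close> the mean increment \<open>1 / (2 (1 + \<phi>))\<close> is at least
  \<open>\<alpha> / (1 - \<eta>)\<close>, which exceeds \<open>\<alpha>\<close> by a margin proportional to \<open>\<eta>\<close>. Part of the margin pays for the
  corrections in the drift, the rest leaves a level of order \<open>m\<close>, and Chernoff's bound gives an
  exponentially small exceptional probability. The level is returned as an explicit measurable
  function of the rows, since leaving a row out must not destroy independence.\<close>

lemma smallest_eigenvalue_bound:
  fixes \<eta> K :: real
  assumes \<eta>: "0 < \<eta>" "\<eta> < 1 / 2" and K: "0 \<le> K"
  obtains \<kappa> c \<alpha> B :: real and m0 :: nat where "0 < \<kappa>" "0 < c"
    and "\<And>m p x v. m0 \<le> m \<Longrightarrow> 0 < p \<Longrightarrow> real p \<le> (1 / 2 - \<eta>) * real m \<Longrightarrow>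
      \<kappa> * real m \<le> eigen_level \<alpha> B m p x \<Longrightarrow> \<kappa> * real m * dotp p v v \<le> (\<Sum>s<m. (dotp p v (x s))\<^sup>2)"
    and "\<And>m p (M :: 'a measure) z. m0 \<le> m \<Longrightarrow> 0 < p \<Longrightarrow> real p \<le> (1 / 2 - \<eta>) * real m \<Longrightarrow>
      prob_space M \<Longrightarrow> prob_space.indep_vars M (\<lambda>_. borel) z ({..<m} \<times> {..<p}) \<Longrightarrow>
      \<forall>i\<in>{..<m} \<times> {..<p}. integral\<^sup>L M (z i) = 0 \<and> integral\<^sup>L M (\<lambda>\<omega>. (z i \<omega>)\<^sup>2) = 1 \<and>
        integrable M (\<lambda>\<omega>. \<bar>z i \<omega>\<bar> powr 4) \<and> integral\<^sup>L M (\<lambda>\<omega>. \<bar>z i \<omega>\<bar> powr 4) \<le> K \<Longrightarrow>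
      measure M {\<omega> \<in> space M. eigen_level \<alpha> B m p (\<lambda>s j. z (s, j) \<omega>) < \<kappa> * real m} \<le> exp (- c * real m)"
proof -
  define \<alpha> where "\<alpha> = \<eta> / 2"
  define C where "C = quad_const 2 K"
  have C: "0 < C" unfolding C_def by (rule quad_const_pos) (use K in auto)
  define B where "B = 2 * (1 + C) / \<eta>"
  have B: "0 < B" using C \<eta> by (simp add: B_def)
  have CB: "(1 + C) / (4 * B) = \<eta> / 8" using C \<eta> by (simp add: B_def field_simps)
  define \<kappa> where "\<kappa> = \<alpha> * \<eta> / 8"
  define lam where "lam = \<alpha> * \<eta> / (16 * B\<^sup>2)"
  define c where "c = (\<alpha> * \<eta>)\<^sup>2 / (256 * B\<^sup>2)"
  have pos: "0 < \<alpha>" "0 < \<kappa>" "0 < lam" "0 < c" using \<eta> B by (auto simp: \<alpha>_def \<kappa>_def lam_def c_def)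
  \<comment> \<open>A lower bound for the drift in which \<open>\<phi>\<close> has its largest value. It exceeds \<open>\<alpha> (1 + \<eta> / 4)\<close> at
     \<open>\<nu> = 0\<close>, hence for small \<open>\<nu>\<close>, that is, for large \<open>m\<close>.\<close>
  define h where "h = (\<lambda>\<nu>::real. ((1 - \<eta> / 8) * (2 * \<alpha> / (1 - \<eta>)) - B * ((C + 1) * \<nu>)) / (2 * (1 + B * \<nu>)\<^sup>2))"
  have "\<alpha> * (1 + \<eta> / 4) < h 0"
  proof -
    have "(1 + \<eta> / 4) * (1 - \<eta>) < 1 - \<eta> / 8" using \<eta> by (simp add: algebra_simps add_pos_pos)
    then have "1 + \<eta> / 4 < (1 - \<eta> / 8) / (1 - \<eta>)" using \<eta> by (simp add: less_divide_eq)
    then have "\<alpha> * (1 + \<eta> / 4) < \<alpha> * ((1 - \<eta> / 8) / (1 - \<eta>))" using pos by (intro mult_strict_left_mono)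
    also have "\<dots> = h 0" using \<eta> by (simp add: h_def divide_simps)
    finally show ?thesis .
  qed
  moreover have "(h \<longlongrightarrow> h 0) (at_right 0)" unfolding h_def by (intro tendsto_intros) auto
  ultimately have ev: "eventually (\<lambda>\<nu>. \<alpha> * (1 + \<eta> / 4) < h \<nu> \<and> B * \<nu> \<le> 1) (at_right 0)"
  proof -
    have "((\<lambda>\<nu>. B * \<nu>) \<longlongrightarrow> B * 0) (at_right 0)" by (intro tendsto_intros)
    then have "eventually (\<lambda>\<nu>. B * \<nu> < 1) (at_right 0)" by (rule order_tendstoD) simp
    then show ?thesis using order_tendstoD(1)[OF \<open>(h \<longlongrightarrow> h 0) (at_right 0)\<close> \<open>\<alpha> * (1 + \<eta> / 4) < h 0\<close>]
      by eventually_elim auto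
  qed
  then obtain \<nu>0 where \<nu>0: "0 < \<nu>0" "\<And>\<nu>. 0 < \<nu> \<Longrightarrow> \<nu> < \<nu>0 \<Longrightarrow> \<alpha> * (1 + \<eta> / 4) < h \<nu> \<and> B * \<nu> \<le> 1"
    unfolding eventually_at_right_field by auto
  obtain m0 :: nat where m0: "1 / (\<alpha> * \<nu>0)\<^sup>2 < m0" using reals_Archimedean2 by blast
  show thesis
  proof (rule that[OF pos(2,4)])
    fix m p :: nat
    assume m: "m \<ge> m0" and p: "0 < p" "p \<le> (1 / 2 - \<eta>) * m"
    have mp: "0 < m"
    proof (rule ccontr)
      assume "\<not> 0 < m" then show False using p by simp
    qed
    define \<nu> where "\<nu> = sqrt p / (\<alpha> * m)"
    define D0 where "D0 = scaled_id (1 / (\<alpha> * m))"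
    define l0 where "l0 = - (\<alpha> * m)"
    define \<phi> where "\<phi> = p / (\<alpha> * m)"
    have \<nu>: "0 < \<nu>" using p mp pos by (simp add: \<nu>_def)
    have p_le: "real p \<le> m"
    proof -
      have "(1 / 2 - \<eta>) * m \<le> 1 * real m" using \<eta> by (intro mult_right_mono) auto
      then show ?thesis using p by simp
    qed
    have "\<nu> < \<nu>0"
    proof -
      have "1 / (\<alpha> * \<nu>0)\<^sup>2 < m" using m0 m by simp
      then have "1 < m * (\<alpha> * \<nu>0)\<^sup>2" using pos \<nu>0 by (simp add: divide_less_eq)
      then have "real m * 1 < m * (m * (\<alpha> * \<nu>0)\<^sup>2)" using mp by (intro mult_strict_left_mono) auto
      also have "\<dots> = (\<alpha> * m * \<nu>0)\<^sup>2" by (simp add: power2_eq_square)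
      finally have "real p < (\<alpha> * m * \<nu>0)\<^sup>2" using p_le by simp
      then have "sqrt p < sqrt ((\<alpha> * m * \<nu>0)\<^sup>2)" by (rule real_sqrt_less_mono)
      then have "sqrt p < \<alpha> * m * \<nu>0" using pos \<nu>0 by simp
      then show ?thesis using pos mp by (simp add: \<nu>_def divide_less_eq mult_ac)
    qed
    with \<nu>0(2)[OF \<nu>] have h: "\<alpha> * (1 + \<eta> / 4) < h \<nu>" and B\<nu>: "B * \<nu> \<le> 1" by auto
    have \<phi>_eq: "sqrt p * \<nu> = \<phi>" by (simp add: \<nu>_def \<phi>_def)
    have \<phi>: "0 \<le> \<phi>" using pos by (simp add: \<phi>_def)
    have drift: "\<alpha> * (1 + \<eta> / 4) \<le> drift C B \<nu> \<phi>"
    proof -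
      have "\<phi> \<le> (1 / 2 - \<eta>) / \<alpha>" using p pos mp by (simp add: \<phi>_def field_simps)
      then have "1 + \<phi> \<le> (1 - \<eta>) / (2 * \<alpha>)" using pos by (simp add: \<alpha>_def field_simps)
      then have "1 / ((1 - \<eta>) / (2 * \<alpha>)) \<le> 1 / (1 + \<phi>)" using \<phi> \<eta> pos by (intro divide_left_mono) auto
      then have "(1 - \<eta> / 8) * (2 * \<alpha> / (1 - \<eta>)) \<le> (1 - \<eta> / 8) * (1 / (1 + \<phi>))"
        using \<eta> by (intro mult_left_mono) auto
      then have "h \<nu> \<le> drift C B \<nu> \<phi>" unfolding h_def drift_def CB
        by (intro divide_right_mono diff_right_mono) auto
      then show ?thesis using h by simp
    qed
    have D0: "psdf p D0" "fro2 p D0 \<le> \<nu>\<^sup>2"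
      using scaled_id_props[of "1 / (\<alpha> * m)" p] pos by (simp_all add: D0_def \<nu>_def power_divide)
    have start: "2 * dotp p v w \<le> dotp p w (mv p D0 w) - l0 * dotp p v v" for v w
      unfolding D0_def l0_def by (rule scaled_id_start) (use pos mp in simp)
    have lev_eq: "eigen_level \<alpha> B m p x = barrier_level p B \<nu> D0 l0 x m" for x
      by (simp add: eigen_level_def \<nu>_def D0_def l0_def)
    show "\<kappa> * m * dotp p v v \<le> (\<Sum>s<m. (dotp p v (x s))\<^sup>2)" if "\<kappa> * m \<le> eigen_level \<alpha> B m p x" for x v
    proof -
      have "2 * dotp p v (\<lambda>_. 0) \<le> dotp p (\<lambda>_. 0) (mv p (barrier_mat p B \<nu> D0 x m) (\<lambda>_. 0)) +
         ((\<Sum>s<m. (dotp p v (x s))\<^sup>2) - barrier_level p B \<nu> D0 l0 x m * dotp p v v)"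
        using barrier_invariant[OF D0 \<nu> B B\<nu> start, of x m] by blast
      then have "eigen_level \<alpha> B m p x * dotp p v v \<le> (\<Sum>s<m. (dotp p v (x s))\<^sup>2)"
        by (simp add: lev_eq dotp_def)
      moreover have "\<kappa> * m * dotp p v v \<le> eigen_level \<alpha> B m p x * dotp p v v"
        using that by (intro mult_right_mono dotp_self_nonneg)
      ultimately show ?thesis by simp
    qed
    show "measure M {\<omega> \<in> space M. eigen_level \<alpha> B m p (\<lambda>s j. z (s, j) \<omega>) < \<kappa> * m} \<le> exp (- c * m)"
      if M: "prob_space M" and ind: "prob_space.indep_vars M (\<lambda>_. borel) z ({..<m} \<times> {..<p})"
        and mom: "\<forall>i\<in>{..<m} \<times> {..<p}. integral\<^sup>L M (z i) = 0 \<and> integral\<^sup>L M (\<lambda>\<omega>. (z i \<omega>)\<^sup>2) = 1 \<and>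
        integrable M (\<lambda>\<omega>. \<bar>z i \<omega>\<bar> powr 4) \<and> integral\<^sup>L M (\<lambda>\<omega>. \<bar>z i \<omega>\<bar> powr 4) \<le> K"
      for M :: "'a measure" and z
    proof -
      interpret prob_space M by fact
      define l where "l = (\<lambda>\<omega>. eigen_level \<alpha> B m p (\<lambda>s j. z (s, j) \<omega>))"
      have zm: "i \<in> {..<m} \<times> {..<p} \<Longrightarrow> random_variable borel (z i)" for i using ind by (auto simp: indep_vars_def)
      have lm[measurable]: "random_variable borel l"
        unfolding l_def lev_eq by (intro borel_measurable_barrier zm) auto
      have em: "(\<integral>\<^sup>+\<omega>. ennreal (exp (- lam * l \<omega>)) \<partial>M) \<le>
         ennreal (exp (- lam * l0 + m * (- lam * drift C B \<nu> \<phi> + lam\<^sup>2 * B\<^sup>2)))"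
        unfolding l_def lev_eq C_def
        by (rule barrier_level_exp_moment[OF ind]) (use mom K D0 \<nu> B B\<nu> p start \<phi>_eq pos in auto)
      have "emeasure M {\<omega> \<in> space M. l \<omega> < \<kappa> * m} = (\<integral>\<^sup>+\<omega>. indicator {\<omega> \<in> space M. l \<omega> < \<kappa> * m} \<omega> \<partial>M)"
        by simp
      also have "\<dots> \<le> (\<integral>\<^sup>+\<omega>. ennreal (exp (lam * (\<kappa> * m))) * ennreal (exp (- lam * l \<omega>)) \<partial>M)"
      proof (intro nn_integral_mono)
        fix \<omega>
        show "indicator {\<omega> \<in> space M. l \<omega> < \<kappa> * m} \<omega> \<le> ennreal (exp (lam * (\<kappa> * m))) * ennreal (exp (- lam * l \<omega>))"
        proof (cases "l \<omega> < \<kappa> * m")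
          case True
          have "0 \<le> lam * (\<kappa> * m - l \<omega>)" using True pos by simp
          then have "1 \<le> ennreal (exp (lam * (\<kappa> * m - l \<omega>)))" by simp
          then show ?thesis
            by (simp add: ennreal_mult'[symmetric] exp_add[symmetric] right_diff_distrib indicator_def)
        qed simp
      qed
      also have "\<dots> = ennreal (exp (lam * (\<kappa> * m))) * (\<integral>\<^sup>+\<omega>. ennreal (exp (- lam * l \<omega>)) \<partial>M)"
        by (rule nn_integral_cmult) measurable
      also have "\<dots> \<le> ennreal (exp (lam * (\<kappa> * m))) *
          ennreal (exp (- lam * l0 + m * (- lam * drift C B \<nu> \<phi> + lam\<^sup>2 * B\<^sup>2)))"
        by (intro mult_left_mono em) auto
      also have "\<dots> = ennreal (exp (lam * (\<kappa> * m) + (- lam * l0 + m * (- lam * drift C B \<nu> \<phi> + lam\<^sup>2 * B\<^sup>2))))"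
        by (simp add: ennreal_mult'[symmetric] exp_add)
      also have "\<dots> \<le> ennreal (exp (- c * m))"
      proof (intro ennreal_leI, subst exp_le_cancel_iff)
        have "lam * (\<alpha> * (1 + \<eta> / 4)) \<le> lam * drift C B \<nu> \<phi>" using drift pos by (intro mult_left_mono) auto
        then have "lam * (\<kappa> + \<alpha>) - lam * drift C B \<nu> \<phi> + lam\<^sup>2 * B\<^sup>2 \<le>
            lam * (\<kappa> + \<alpha>) - lam * (\<alpha> * (1 + \<eta> / 4)) + lam\<^sup>2 * B\<^sup>2" by simp
        also have "\<dots> = - c"
          using B by (simp add: \<kappa>_def c_def lam_def power2_eq_square field_simps)
        finally have "m * (lam * (\<kappa> + \<alpha>) - lam * drift C B \<nu> \<phi> + lam\<^sup>2 * B\<^sup>2) \<le> m * (- c)"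
          by (intro mult_left_mono) auto
        then show "lam * (\<kappa> * m) + (- lam * l0 + m * (- lam * drift C B \<nu> \<phi> + lam\<^sup>2 * B\<^sup>2)) \<le> - c * m"
          by (simp add: l0_def algebra_simps)
      qed
      finally show ?thesis unfolding l_def emeasure_eq_measure by (simp add: ennreal_le_iff)
    qed
  qed
qed


section \<open>Square roots of positive semidefinite matrices\<close>

lemma L2_set_dotp: "(L2_set x {..<p})\<^sup>2 = dotp p x x"
  by (simp add: L2_set_def dotp_def power2_eq_square sum_nonneg)

lemma dotp_le_L2_set: "dotp p x y \<le> L2_set x {..<p} * L2_set y {..<p}"
proof -
  have "(dotp p x y)\<^sup>2 \<le> (L2_set x {..<p} * L2_set y {..<p})\<^sup>2"
    unfolding power_mult_distrib L2_set_dotp by (rule dotp_Cauchy_Schwarz)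
  then show ?thesis by (rule power2_le_imp_le) simp
qed

lemma L2_set_cmult: "L2_set (\<lambda>i. c * x i) I = \<bar>c\<bar> * L2_set x I" for c :: real
  by (simp add: L2_set_def power_mult_distrib sum_distrib_left[symmetric] real_sqrt_mult)

lemma dotp_unit: "i < p \<Longrightarrow> dotp p (\<lambda>j. if i = j then 1 else 0) x = x i"
  by (simp add: dotp_def if_distrib if_distribR sum.delta' cong: if_cong)

text \<open>Visser's iteration for \<open>1 - sqrt (1 - B)\<close>, whose fixed points satisfy \<open>(1 - Y)\<^sup>2 = 1 - B\<close>. The
  product of the symmetric matrix with itself is written with its rows.\<close>

primrec visser :: "nat \<Rightarrow> (nat \<Rightarrow> nat \<Rightarrow> real) \<Rightarrow> nat \<Rightarrow> nat \<Rightarrow> nat \<Rightarrow> real" where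
  "visser p B 0 = (\<lambda>i j. 0)"
| "visser p B (Suc k) = (\<lambda>i j. (B i j + dotp p (visser p B k i) (visser p B k j)) / 2)"

text \<open>The scalar iteration at \<open>B = 1\<close>, which majorises the norms of the iterates and of their
  differences.\<close>

primrec visser_bound :: "nat \<Rightarrow> real" where
  "visser_bound 0 = 0"
| "visser_bound (Suc k) = (1 + (visser_bound k)\<^sup>2) / 2"

lemma visser_bound_props: "0 \<le> visser_bound k" "visser_bound k \<le> 1" "visser_bound k \<le> visser_bound (Suc k)"
proof -
  have 1: "0 \<le> visser_bound k \<and> visser_bound k \<le> 1" for k
    by (induction k) (auto simp: power_le_one)
  then show "0 \<le> visser_bound k" "visser_bound k \<le> 1" by auto
  have "0 \<le> (1 - visser_bound k)\<^sup>2" by simp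
  then show "visser_bound k \<le> visser_bound (Suc k)" by (simp add: power2_eq_square algebra_simps)
qed

text \<open>The iterates are Cauchy because their increments are dominated by those of the convergent scalar
  iteration; this avoids any spectral decomposition.\<close>

lemma psd_sqrt_contraction:
  fixes B :: "nat \<Rightarrow> nat \<Rightarrow> real"
  assumes sym: "symf p B" and contr: "\<And>x. L2_set (mv p B x) {..<p} \<le> L2_set x {..<p}"
  shows "\<exists>S. psdf p S \<and> (\<forall>i<p. \<forall>j<p. dotp p (S i) (S j) = (if i = j then 1 else 0) - B i j)"
proof -
  let ?N = "\<lambda>x. L2_set x {..<p}"
  define Y where "Y = visser p B"
  define a where "a = visser_bound"
  have a: "0 \<le> a k" "a k \<le> 1" "a k \<le> a (Suc k)" for k using visser_bound_props by (auto simp: a_def)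
  have Y_sym: "symf p (Y k)" for k
    using sym by (induction k) (auto simp: Y_def symf_def dotp_commute)
  have Y_Suc: "mv p (Y (Suc k)) x i = 1/2 * (mv p B x i + mv p (Y k) (mv p (Y k) x) i)" if "i < p" for k x i
  proof -
    have "mv p (Y (Suc k)) x i = (\<Sum>j<p. 1/2 * (B i j * x j + dotp p (Y k i) (Y k j) * x j))"
      by (simp add: mv_def dotp_def Y_def algebra_simps add_divide_distrib)
    also have "\<dots> = 1/2 * (mv p B x i + (\<Sum>j<p. dotp p (Y k i) (Y k j) * x j))"
      by (simp add: mv_def dotp_def[of p _ x] sum.distrib sum_distrib_left distrib_left)
    also have "(\<Sum>j<p. dotp p (Y k i) (Y k j) * x j) = (\<Sum>j<p. x j * dotp p (Y k j) (Y k i))"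
      by (simp add: mult.commute dotp_commute)
    also have "\<dots> = dotp p (\<lambda>l. \<Sum>j<p. x j * Y k j l) (Y k i)" by (simp add: dotp_sum_left)
    also have "\<dots> = dotp p (mv p (Y k) x) (Y k i)"
      by (intro dotp_cong refl) (simp add: mv_eq_sum_rows[OF Y_sym])
    also have "\<dots> = mv p (Y k) (mv p (Y k) x) i" by (simp add: mv_def[of p "Y k" "mv p (Y k) x"] dotp_commute)
    finally show ?thesis .
  qed
  have Yn: "?N (mv p (Y k) x) \<le> a k * ?N x" for k x
  proof (induction k arbitrary: x)
    case 0
    have "?N (mv p (Y 0) x) = 0" by (simp add: Y_def L2_set_def mv_def dotp_def)
    then show ?case by (simp add: a_def)
  next
    case (Suc k)
    have "?N (mv p (Y (Suc k)) x) = ?N (\<lambda>i. 1/2 * (mv p B x i + mv p (Y k) (mv p (Y k) x) i))"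
      by (intro L2_set_cong refl Y_Suc) auto
    also have "\<dots> = 1/2 * ?N (\<lambda>i. mv p B x i + mv p (Y k) (mv p (Y k) x) i)" unfolding L2_set_cmult by simp
    also have "\<dots> \<le> 1/2 * (?N (mv p B x) + ?N (mv p (Y k) (mv p (Y k) x)))"
      by (intro mult_left_mono L2_set_triangle_ineq) auto
    also have "?N (mv p (Y k) (mv p (Y k) x)) \<le> a k * (a k * ?N x)"
      using Suc.IH[of "mv p (Y k) x"] Suc.IH[of x] a by (meson mult_left_mono order_trans)
    also have "1/2 * (?N (mv p B x) + a k * (a k * ?N x)) \<le> 1/2 * (?N x + a k * (a k * ?N x))"
      using contr by simp
    also have "\<dots> = a (Suc k) * ?N x" by (simp add: a_def power2_eq_square algebra_simps)
    finally show ?case by simp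
  qed
  have Yd: "?N (\<lambda>i. mv p (Y (Suc k)) x i - mv p (Y k) x i) \<le> (a (Suc k) - a k) * ?N x" for k x
  proof (induction k arbitrary: x)
    case 0
    have "?N (\<lambda>i. mv p (Y (Suc 0)) x i - mv p (Y 0) x i) = ?N (mv p (Y (Suc 0)) x)"
      by (intro L2_set_cong refl) (simp add: Y_def mv_def dotp_def)
    then show ?case using Yn[of "Suc 0" x] by (simp add: a_def)
  next
    case (Suc k)
    let ?d = "\<lambda>x i. mv p (Y (Suc k)) x i - mv p (Y k) x i"
    have "?N (\<lambda>i. mv p (Y (Suc (Suc k))) x i - mv p (Y (Suc k)) x i) =
       ?N (\<lambda>i. 1/2 * (mv p (Y (Suc k)) (?d x) i + ?d (mv p (Y k) x) i))"
      by (intro L2_set_cong refl) (simp add: Y_Suc mv_linear algebra_simps)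
    also have "\<dots> = 1/2 * ?N (\<lambda>i. mv p (Y (Suc k)) (?d x) i + ?d (mv p (Y k) x) i)" unfolding L2_set_cmult by simp
    also have "\<dots> \<le> 1/2 * (?N (mv p (Y (Suc k)) (?d x)) + ?N (?d (mv p (Y k) x)))"
      by (intro mult_left_mono L2_set_triangle_ineq) auto
    also have "?N (mv p (Y (Suc k)) (?d x)) \<le> a (Suc k) * ((a (Suc k) - a k) * ?N x)"
      using Yn[of "Suc k" "?d x"] Suc.IH[of x] a(1)[of "Suc k"] by (meson mult_left_mono order_trans)
    also have "?N (?d (mv p (Y k) x)) \<le> (a (Suc k) - a k) * (a k * ?N x)"
    proof -
      have "(a (Suc k) - a k) * ?N (mv p (Y k) x) \<le> (a (Suc k) - a k) * (a k * ?N x)"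
        using Yn a(3)[of k] by (intro mult_left_mono) auto
      then show ?thesis using Suc.IH[of "mv p (Y k) x"] by linarith
    qed
    also have "1/2 * (a (Suc k) * ((a (Suc k) - a k) * ?N x) + (a (Suc k) - a k) * (a k * ?N x)) =
       ((1 + (a (Suc k))\<^sup>2) / 2 - (1 + (a k)\<^sup>2) / 2) * ?N x"
      by (simp add: power2_eq_square algebra_simps)
    finally show ?case by (simp add: a_def)
  qed
  have step: "\<bar>Y (Suc k) i j - Y k i j\<bar> \<le> a (Suc k) - a k" if ij: "i < p" "j < p" for k i j
  proof -
    let ?e = "\<lambda>l. if l = j then 1 else (0::real)"
    have e: "mv p A ?e i = A i j" for A :: "nat \<Rightarrow> nat \<Rightarrow> real"
      using ij by (simp add: mv_def dotp_def if_distrib sum.delta cong: if_cong)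
    have "\<bar>Y (Suc k) i j - Y k i j\<bar> \<le> ?N (\<lambda>i. mv p (Y (Suc k)) ?e i - mv p (Y k) ?e i)"
      using member_le_L2_set[of "{..<p}" i "\<lambda>i. \<bar>mv p (Y (Suc k)) ?e i - mv p (Y k) ?e i\<bar>"] ij
      by (simp add: e L2_set_def)
    also have "\<dots> \<le> (a (Suc k) - a k) * ?N ?e" by (rule Yd)
    also have "?N ?e = 1" using ij by (simp add: L2_set_def if_distrib if_distribR sum.delta cong: if_cong)
    finally show ?thesis by simp
  qed
  have diff: "\<bar>Y (k + m) i j - Y k i j\<bar> \<le> a (k + m) - a k" if ij: "i < p" "j < p" for k m i j
  proof (induction m)
    case (Suc m)
    then show ?case using step[OF ij, of "k + m"] by simp
  qed simp
  have "convergent a"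
    by (rule Bseq_monoseq_convergent)
      (use a in \<open>auto intro!: BseqI'[where K = 1] simp: monoseq_Suc\<close>)
  then have Ca: "Cauchy a" by (rule convergent_Cauchy)
  have conv: "convergent (\<lambda>k. Y k i j)" if ij: "i < p" "j < p" for i j
  proof (rule Cauchy_convergent, rule CauchyI')
    fix e :: real assume "0 < e"
    then obtain N where N: "\<And>m n. m \<ge> N \<Longrightarrow> n \<ge> N \<Longrightarrow> norm (a m - a n) < e" using CauchyD[OF Ca] by blast
    show "\<exists>N. \<forall>m\<ge>N. \<forall>n>m. dist (Y m i j) (Y n i j) < e"
    proof (intro exI allI impI)
      fix m n assume m: "N \<le> m" and n: "m < n"
      have "dist (Y m i j) (Y n i j) \<le> a n - a m"
        using diff[OF ij, of m "n - m"] n by (simp add: dist_real_def abs_minus_commute)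
      also have "\<dots> < e" using N[of n m] m n by (simp add: abs_less_iff)
      finally show "dist (Y m i j) (Y n i j) < e" .
    qed
  qed
  define L where "L = (\<lambda>i j. lim (\<lambda>k. Y k i j))"
  have L: "(\<lambda>k. Y k i j) \<longlonglongrightarrow> L i j" if "i < p" "j < p" for i j
    using conv[OF that] by (simp add: L_def convergent_LIMSEQ_iff)
  have L_sym: "symf p L"
    unfolding symf_def L_def
  proof (intro allI impI)
    fix i j assume "i < p" "j < p"
    then have "(\<lambda>k. Y k i j) = (\<lambda>k. Y k j i)" using Y_sym by (auto simp: symf_def)
    then show "lim (\<lambda>k. Y k i j) = lim (\<lambda>k. Y k j i)" by simp
  qed
  have L_eq: "L i j = (B i j + dotp p (L i) (L j)) / 2" if ij: "i < p" "j < p" for i j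
  proof (rule LIMSEQ_unique)
    show "(\<lambda>k. Y (Suc k) i j) \<longlonglongrightarrow> L i j" using L[OF ij] by (rule LIMSEQ_Suc)
    have "(\<lambda>k. dotp p (Y k i) (Y k j)) \<longlonglongrightarrow> dotp p (L i) (L j)"
      unfolding dotp_def using ij L by (intro tendsto_sum tendsto_mult) auto
    then show "(\<lambda>k. Y (Suc k) i j) \<longlonglongrightarrow> (B i j + dotp p (L i) (L j)) / 2"
      unfolding Y_def visser.simps by (intro tendsto_intros) auto
  qed
  have L_le: "dotp p v (mv p L v) \<le> dotp p v v" for v
  proof (rule LIMSEQ_le_const2)
    show "(\<lambda>k. dotp p v (mv p (Y k) v)) \<longlonglongrightarrow> dotp p v (mv p L v)"
      unfolding dotp_def mv_def using L by (intro tendsto_sum tendsto_mult tendsto_const) auto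
    have "dotp p v (mv p (Y k) v) \<le> dotp p v v" for k
    proof -
      have "dotp p v (mv p (Y k) v) \<le> ?N v * ?N (mv p (Y k) v)" by (rule dotp_le_L2_set)
      also have "\<dots> \<le> ?N v * (1 * ?N v)"
        using Yn[of k v] mult_right_mono[OF a(2)[of k], of "?N v"] by (intro mult_left_mono) auto
      also have "\<dots> = dotp p v v" by (simp add: L2_set_dotp[symmetric] power2_eq_square)
      finally show ?thesis .
    qed
    then show "\<exists>N. \<forall>n\<ge>N. dotp p v (mv p (Y n) v) \<le> dotp p v v" by blast
  qed
  define S where "S = (\<lambda>i j. (if i = j then 1 else 0) - L i j)"
  note I_dotp = dotp_unit
  have Smv: "mv p S v i = v i - mv p L v i" if "i < p" for v i
    unfolding mv_def S_def dotp_linear I_dotp[OF that] ..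
  have "psdf p S"
    unfolding psdf_def
  proof (intro conjI allI)
    show "symf p S" using L_sym by (auto simp: symf_def S_def)
    fix v
    have "dotp p v (mv p S v) = dotp p v (\<lambda>i. v i - mv p L v i)" by (intro dotp_cong refl Smv)
    then show "0 \<le> dotp p v (mv p S v)" using L_le[of v] by (simp add: dotp_linear)
  qed
  moreover have "dotp p (S i) (S j) = (if i = j then 1 else 0) - B i j" if ij: "i < p" "j < p" for i j
  proof -
    have "dotp p (S i) (S j) = (if j = i then 1 else 0) - L j i - L i j + dotp p (L i) (L j)"
      unfolding S_def dotp_linear I_dotp[OF ij(1)] dotp_commute[of p "L i" "\<lambda>k. if j = k then 1 else 0"] I_dotp[OF ij(2)]
      by simp
    also have "L j i = L i j" using L_sym ij by (simp add: symf_def)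
    finally show ?thesis using L_eq[OF ij] by auto
  qed
  ultimately show ?thesis by blast
qed

lemma psd_sqrt_exists:
  assumes A: "psdf p A"
  shows "\<exists>S. psdf p S \<and> (\<forall>i<p. \<forall>j<p. dotp p (S i) (S j) = A i j)"
proof -
  define c where "c = sqrt (fro2 p A) + 1"
  have c: "0 < c" by (simp add: c_def add_nonneg_pos fro2_nonneg)
  have Ac: "dotp p x (mv p A x) \<le> c * dotp p x x" for x
  proof -
    have "fro2 p A \<le> c\<^sup>2"
    proof -
      have "(sqrt (fro2 p A))\<^sup>2 \<le> c\<^sup>2" by (intro power_mono) (auto simp: c_def fro2_nonneg)
      then show ?thesis by (simp add: fro2_nonneg)
    qed
    then show ?thesis using c by - (rule quadratic_form_le_fro2, auto)
  qed
  define B where "B = (\<lambda>i j. (if i = j then 1 else 0) - 1 / c * A i j)"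
  have Bmv: "mv p B x i = x i - (1 / c) * mv p A x i" if "i < p" for x i
    unfolding mv_def B_def dotp_linear dotp_unit[OF that] ..
  have Bq: "dotp p x (mv p B x) = dotp p x x - (1 / c) * dotp p x (mv p A x)" for x
  proof -
    have "dotp p x (mv p B x) = dotp p x (\<lambda>i. x i - (1 / c) * mv p A x i)" by (intro dotp_cong refl Bmv)
    then show ?thesis unfolding dotp_linear .
  qed
  have sym: "symf p B" using A by (auto simp: psdf_def symf_def B_def)
  have psd: "psdf p B" unfolding psdf_def Bq using sym Ac c by (simp add: field_simps mult.commute)
  have "dotp p (mv p B x) (mv p B x) \<le> 1 * dotp p x x" for x
  proof -
    have le: "dotp p x (mv p B x) \<le> 1 * dotp p x x" for x
      unfolding Bq using A c by (simp add: psdf_def)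
    show ?thesis using psdf_norm_mv_le[OF psd le, of x] le[of x] by simp
  qed
  then have "L2_set (mv p B x) {..<p} \<le> L2_set x {..<p}" for x
    by - (rule power2_le_imp_le, simp_all add: L2_set_dotp)
  from psd_sqrt_contraction[OF sym this] obtain S where S: "psdf p S"
    "\<And>i j. i < p \<Longrightarrow> j < p \<Longrightarrow> dotp p (S i) (S j) = (if i = j then 1 else 0) - B i j" by blast
  define R where "R = (\<lambda>i j. sqrt c * S i j)"
  have Rmv: "mv p R v = (\<lambda>i. sqrt c * mv p S v i)" for v unfolding mv_def R_def dotp_linear ..
  have "psdf p R" using S(1) c unfolding psdf_def Rmv dotp_linear by (auto simp: symf_def R_def)
  moreover have "dotp p (R i) (R j) = A i j" if "i < p" "j < p" for i j
    unfolding R_def dotp_linear using S(2)[OF that] c by (simp add: B_def mult.assoc[symmetric])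
  ultimately show ?thesis by blast
qed

section \<open>Inverses and the residual projection\<close>

definition fmat :: "nat \<Rightarrow> (nat \<Rightarrow> nat \<Rightarrow> real) \<Rightarrow> real mat" where
  "fmat n A = mat n n (\<lambda>(i, j). A i j)"

lemma fmat_carrier[simp]: "fmat n A \<in> carrier_mat n n" by (simp add: fmat_def)

lemma fmat_index[simp]: "i < n \<Longrightarrow> j < n \<Longrightarrow> fmat n A $$ (i, j) = A i j" by (simp add: fmat_def)

lemma fmat_dim[simp]: "dim_row (fmat n A) = n" "dim_col (fmat n A) = n" by (simp_all add: fmat_def)

lemma carrier_mat_fmat: "A \<in> carrier_mat n n \<Longrightarrow> A = fmat n (\<lambda>i j. A $$ (i, j))"
  by (intro eq_matI) auto

lemma scalar_prod_vec: "scalar_prod (vec p x) (vec p y) = dotp p x y"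
  by (simp add: scalar_prod_def dotp_def atLeast0LessThan)

lemma fmat_mult_vec: "fmat p A *\<^sub>v vec p x = vec p (mv p A x)"
  by (intro eq_vecI) (auto simp: mv_def scalar_prod_def dotp_def atLeast0LessThan)

lemma carrier_vec_eq: "v \<in> carrier_vec p \<Longrightarrow> v = vec p (\<lambda>i. v $ i)"
  by (intro eq_vecI) auto

lemma pos_semidef_fmat: "pos_semidef_mat (fmat p A) \<longleftrightarrow> psdf p A"
proof -
  have "transpose_mat (fmat p A) = fmat p A \<longleftrightarrow> symf p A"
  proof
    assume t: "transpose_mat (fmat p A) = fmat p A"
    have "A i j = A j i" if "i < p" "j < p" for i j
    proof -
      have "fmat p A $$ (i, j) = transpose_mat (fmat p A) $$ (i, j)" by (simp only: t)
      then show ?thesis using that by simp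
    qed
    then show "symf p A" by (simp add: symf_def)
  qed (auto simp: symf_def intro!: eq_matI)
  moreover have "(\<forall>v\<in>carrier_vec p. 0 \<le> scalar_prod v (fmat p A *\<^sub>v v)) \<longleftrightarrow> (\<forall>v. 0 \<le> dotp p v (mv p A v))"
  proof safe
    fix v assume "\<forall>v\<in>carrier_vec p. 0 \<le> scalar_prod v (fmat p A *\<^sub>v v)"
    then have "0 \<le> scalar_prod (vec p v) (fmat p A *\<^sub>v vec p v)" by simp
    then show "0 \<le> dotp p v (mv p A v)" by (simp add: fmat_mult_vec scalar_prod_vec)
  next
    fix v :: "real vec" assume *: "\<forall>v. 0 \<le> dotp p v (mv p A v)" and v: "v \<in> carrier_vec p"
    show "0 \<le> scalar_prod v (fmat p A *\<^sub>v v)"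
      by (subst (1 2) carrier_vec_eq[OF v]) (simp add: fmat_mult_vec scalar_prod_vec *)
  qed
  ultimately show ?thesis by (simp add: pos_semidef_mat_def psdf_def)
qed

lemma sqrt_mat_real:
  assumes "A \<in> carrier_mat p p" "pos_semidef_mat A"
  shows "sqrt_mat A \<in> carrier_mat p p" "transpose_mat (sqrt_mat A) = sqrt_mat A" "sqrt_mat A * sqrt_mat A = A"
proof -
  define f where "f = (\<lambda>i j. A $$ (i, j))"
  have A: "A = fmat p f" unfolding f_def by (rule carrier_mat_fmat[OF assms(1)])
  then have "psdf p f" using assms(2) pos_semidef_fmat by simp
  then obtain S where S: "psdf p S" "\<forall>i<p. \<forall>j<p. dotp p (S i) (S j) = f i j" using psd_sqrt_exists by blast
  have sS: "symf p S" using S by (simp add: psdf_def)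
  have "fmat p S * fmat p S = A"
  proof (intro eq_matI)
    fix i j assume "i < dim_row A" "j < dim_col A"
    then have ij: "i < p" "j < p" using assms by auto
    have "(fmat p S * fmat p S) $$ (i, j) = (\<Sum>k<p. S i k * S k j)"
      using ij by (simp add: scalar_prod_def atLeast0LessThan)
    also have "\<dots> = dotp p (S i) (S j)"
      using sS ij by (auto simp: dotp_def symf_def intro!: sum.cong)
    finally show "(fmat p S * fmat p S) $$ (i, j) = A $$ (i, j)" using S ij by (simp add: f_def)
  qed (use assms in auto)
  moreover have "pos_semidef_mat (fmat p S)" using S pos_semidef_fmat by simp
  ultimately have ex: "pos_semidef_mat (fmat p S) \<and> fmat p S * fmat p S = A" by blast
  have *: "pos_semidef_mat (sqrt_mat A) \<and> sqrt_mat A * sqrt_mat A = A"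
    unfolding sqrt_mat_def by (rule someI[where P = "\<lambda>B. pos_semidef_mat B \<and> B * B = A"], rule ex)
  then show "transpose_mat (sqrt_mat A) = sqrt_mat A" "sqrt_mat A * sqrt_mat A = A"
    by (auto simp: pos_semidef_mat_def)
  have "dim_row (sqrt_mat A) = dim_row A" using * by (metis index_mult_mat(2))
  then show "sqrt_mat A \<in> carrier_mat p p" using * assms by (auto simp: pos_semidef_mat_def intro!: carrier_matI)
qed

text \<open>Entries are quotients of determinants, which makes them measurable functions of the entries of
  \<open>H\<close>. For a singular \<open>H\<close> all entries are \<open>0\<close>, as division by zero yields zero.\<close>

definition finv :: "nat \<Rightarrow> (nat \<Rightarrow> nat \<Rightarrow> real) \<Rightarrow> nat \<Rightarrow> nat \<Rightarrow> real" where
  "finv p H = (\<lambda>i j. adj_mat (fmat p H) $$ (i, j) / det (fmat p H))"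

lemma finv_mat:
  assumes "det (fmat p H) \<noteq> 0"
  shows "fmat p H * fmat p (finv p H) = 1\<^sub>m p" "fmat p (finv p H) * fmat p H = 1\<^sub>m p"
proof -
  note adj = adj_mat[OF fmat_carrier[of p H]]
  have eq: "fmat p (finv p H) = (1 / det (fmat p H)) \<cdot>\<^sub>m adj_mat (fmat p H)"
    using adj(1) by (intro eq_matI) (auto simp: finv_def)
  have "(1 / det (fmat p H)) \<cdot>\<^sub>m (det (fmat p H) \<cdot>\<^sub>m 1\<^sub>m p) = (1\<^sub>m p :: real mat)"
    using assms by (intro eq_matI) auto
  then show "fmat p H * fmat p (finv p H) = 1\<^sub>m p" "fmat p (finv p H) * fmat p H = 1\<^sub>m p"
    unfolding eq using adj
    by (simp_all add: mult_smult_distrib[OF fmat_carrier adj(1)] mult_smult_assoc_mat[OF adj(1) fmat_carrier])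
qed

lemma finv_mv:
  assumes d: "det (fmat p H) \<noteq> 0" and i: "i < p"
  shows "mv p H (mv p (finv p H) v) i = v i" "mv p (finv p H) (mv p H v) i = v i"
proof -
  have "vec p (mv p H (mv p (finv p H) v)) = (fmat p H * fmat p (finv p H)) *\<^sub>v vec p v"
    by (simp add: assoc_mult_mat_vec[OF fmat_carrier fmat_carrier] fmat_mult_vec)
  also have "\<dots> = vec p v" unfolding finv_mat[OF d] by simp
  finally show "mv p H (mv p (finv p H) v) i = v i" using i by (metis index_vec)
  have "vec p (mv p (finv p H) (mv p H v)) = (fmat p (finv p H) * fmat p H) *\<^sub>v vec p v"
    by (simp add: assoc_mult_mat_vec[OF fmat_carrier fmat_carrier] fmat_mult_vec)
  also have "\<dots> = vec p v" unfolding finv_mat[OF d] by simp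
  finally show "mv p (finv p H) (mv p H v) i = v i" using i by (metis index_vec)
qed

lemma finv_sym:
  assumes d: "det (fmat p H) \<noteq> 0" and s: "symf p H"
  shows "symf p (finv p H)"
  unfolding symf_def
proof (intro allI impI)
  fix i j assume ij: "i < p" "j < p"
  let ?A = "finv p H"
  let ?e = "\<lambda>j l. if l = j then 1 else (0::real)"
  have e: "dotp p (?e i) v = v i" if "i < p" for i v
    using that by (simp add: dotp_def if_distrib if_distribR sum.delta cong: if_cong)
  have A: "mv p ?A (?e j) i = ?A i j" if "i < p" "j < p" for i j
    using that e[of j "?A i"] by (simp add: mv_def dotp_commute)
  have H: "dotp p (mv p H (mv p ?A (?e i))) y = dotp p (?e i) y" for i y
    by (intro dotp_cong finv_mv(1)[OF d] refl)
  have "?A i j = dotp p (?e i) (mv p ?A (?e j))" using e[OF ij(1)] A[OF ij] by simp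
  also have "\<dots> = dotp p (mv p H (mv p ?A (?e i))) (mv p ?A (?e j))" by (simp only: H)
  also have "\<dots> = dotp p (mv p ?A (?e i)) (mv p H (mv p ?A (?e j)))" using dotp_mv_sym[OF s] by simp
  also have "\<dots> = dotp p (mv p H (mv p ?A (?e j))) (mv p ?A (?e i))" by (rule dotp_commute)
  also have "\<dots> = dotp p (?e j) (mv p ?A (?e i))" by (simp only: H)
  also have "\<dots> = ?A j i" using e[OF ij(2)] A[OF ij(2) ij(1)] by simp
  finally show "?A i j = ?A j i" .
qed

lemma det_nonzero_if_coercive:
  assumes \<kappa>: "0 < \<kappa>" and le: "\<And>v. \<kappa> * dotp p v v \<le> dotp p v (mv p H v)"
  shows "det (fmat p H) \<noteq> 0"
proof
  assume "det (fmat p H) = 0"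
  then obtain v where v: "v \<in> carrier_vec p" "v \<noteq> 0\<^sub>v p" "fmat p H *\<^sub>v v = 0\<^sub>v p"
    using det_0_iff_vec_prod_zero_field[OF fmat_carrier] by blast
  define w where "w = (\<lambda>i. v $ i)"
  have v_eq: "v = vec p w" unfolding w_def by (rule carrier_vec_eq[OF v(1)])
  have "vec p (mv p H w) = 0\<^sub>v p" using v(3) unfolding v_eq fmat_mult_vec .
  then have "\<forall>i<p. mv p H w i = 0" by (metis index_vec index_zero_vec(1))
  then have "dotp p w (mv p H w) = 0" by (simp add: dotp_def)
  then have "\<kappa> * dotp p w w \<le> 0" using le[of w] by simp
  then have "dotp p w w = 0" using \<kappa> dotp_self_nonneg[of p w] by (simp add: mult_le_0_iff)
  then have "\<forall>i<p. w i = 0" by (simp add: dotp_self_eq_0)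
  then have "v = 0\<^sub>v p" unfolding v_eq by (intro eq_vecI) auto
  then show False using v(2) by simp
qed

lemma invertible_mat_iff_det:
  fixes A :: "real mat"
  assumes A: "A \<in> carrier_mat p p"
  shows "invertible_mat A \<longleftrightarrow> det A \<noteq> 0"
proof
  assume "invertible_mat A"
  then obtain B where B: "A * B = 1\<^sub>m p" "B * A = 1\<^sub>m (dim_row B)"
    using A by (auto simp: invertible_mat_def inverts_mat_def)
  have "dim_col B = p" using B(1) by (metis index_mult_mat(3) index_one_mat(3))
  moreover have "dim_row B = p" using B(2) A by (metis carrier_matD(2) index_mult_mat(3) index_one_mat(3))
  ultimately have "B \<in> carrier_mat p p" by auto
  then have "det A * det B = 1" using det_mult[OF A, of B] B(1) by simp
  then show "det A \<noteq> 0" by auto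
next
  assume d: "det A \<noteq> 0"
  have eq: "A = fmat p (\<lambda>i j. A $$ (i, j))" by (rule carrier_mat_fmat[OF A])
  note inv = finv_mat[of p "\<lambda>i j. A $$ (i, j)", folded eq, OF d]
  show "invertible_mat A" unfolding invertible_mat_def inverts_mat_def
    using inv A by (auto intro!: exI[of _ "fmat p (finv p (\<lambda>i j. A $$ (i, j)))"])
qed

definition gram :: "nat set \<Rightarrow> (nat \<Rightarrow> nat \<Rightarrow> real) \<Rightarrow> nat \<Rightarrow> nat \<Rightarrow> real" where
  "gram I z = (\<lambda>a b. \<Sum>i\<in>I. z i a * z i b)"

text \<open>The residual projection written with the raw rows \<open>z i\<close>. It is symmetric even where the Gram
  matrix is singular; there it is the identity.\<close>

definition resid :: "nat \<Rightarrow> nat \<Rightarrow> (nat \<Rightarrow> nat \<Rightarrow> real) \<Rightarrow> nat \<Rightarrow> nat \<Rightarrow> real" where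
  "resid n p z = (\<lambda>i j. (if i = j then 1 else 0) - dotp p (z i) (mv p (finv p (gram {..<n} z)) (z j)))"

text \<open>With \<open>G\<close> the square root of \<open>\<Gamma>\<close> the Gram matrix of the design is \<open>G H G\<close>, and the factors \<open>G\<close>
  cancel in the projection.\<close>

lemma design_mat_gram:
  fixes \<Gamma> :: "real mat" and n p :: nat and z :: "nat \<Rightarrow> nat \<Rightarrow> real"
  assumes Gam: "\<Gamma> \<in> carrier_mat p p" "pos_semidef_mat \<Gamma>" "invertible_mat \<Gamma>"
  defines "X \<equiv> design_mat n p \<Gamma> z"
  defines "H \<equiv> gram {..<n} z"
  shows "invertible_mat (transpose_mat X * X) \<longleftrightarrow> det (fmat p H) \<noteq> 0"
    and "det (fmat p H) \<noteq> 0 \<Longrightarrow> resid_mat X = fmat n (resid n p z)"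
proof -
  define G where "G = sqrt_mat \<Gamma>"
  have G: "G \<in> carrier_mat p p" "transpose_mat G = G" "G * G = \<Gamma>"
    using sqrt_mat_real[OF Gam(1,2)] by (auto simp: G_def)
  have "det \<Gamma> \<noteq> 0" using Gam invertible_mat_iff_det by blast
  then have dG: "det G \<noteq> 0" using det_mult[OF G(1) G(1)] G(3) by auto
  define Z where "Z = mat n p (\<lambda>(i, j). z i j)"
  have Z: "Z \<in> carrier_mat n p" by (simp add: Z_def)
  have X: "X = Z * G"
  proof (intro eq_matI)
    fix i j assume ij: "i < dim_row (Z * G)" "j < dim_col (Z * G)"
    then have ij: "i < n" "j < p" using Z G by auto
    have "X $$ (i, j) = scalar_prod (row G j) (vec p (z i))"
      using ij G(1) by (simp add: X_def design_mat_def G_def[symmetric])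
    also have "row G j = col G j" using G ij by (metis carrier_matD(2) row_transpose)
    also have "scalar_prod (col G j) (vec p (z i)) = scalar_prod (vec p (z i)) (col G j)"
      using G ij by (intro comm_scalar_prod[where n = p]) auto
    also have "vec p (z i) = row Z i" using ij by (intro eq_vecI) (auto simp: Z_def)
    also have "scalar_prod (row Z i) (col G j) = (Z * G) $$ (i, j)" using ij Z G by simp
    finally show "X $$ (i, j) = (Z * G) $$ (i, j)" .
  qed (use Z G in \<open>auto simp: X_def design_mat_def\<close>)
  have Zt: "transpose_mat Z \<in> carrier_mat p n" using Z by simp
  have ZtZ: "transpose_mat Z * Z = fmat p H"
    by (intro eq_matI) (auto simp: Z_def H_def gram_def scalar_prod_def atLeast0LessThan)
  have Xt: "transpose_mat X = G * transpose_mat Z"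
    unfolding X using transpose_mult[OF Z G(1)] G(2) by simp
  have XtX: "transpose_mat X * X = G * fmat p H * G"
  proof -
    have "transpose_mat X * X = G * transpose_mat Z * (Z * G)" unfolding Xt unfolding X ..
    also have "\<dots> = G * (transpose_mat Z * (Z * G))" using G Zt Z by (intro assoc_mult_mat[where n\<^sub>2 = p and n\<^sub>3 = n]) auto
    also have "transpose_mat Z * (Z * G) = fmat p H * G" unfolding ZtZ[symmetric] using assoc_mult_mat[OF Zt Z G(1)] by simp
    also have "G * (fmat p H * G) = G * fmat p H * G" using assoc_mult_mat[OF G(1) fmat_carrier G(1)] by simp
    finally show ?thesis .
  qed
  have XtXc: "transpose_mat X * X \<in> carrier_mat p p" unfolding XtX by (intro mult_carrier_mat[OF _ G(1)] mult_carrier_mat[OF G(1)] fmat_carrier)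
  have "det (transpose_mat X * X) = det G * det (fmat p H) * det G"
    unfolding XtX
    by (simp only: det_mult[OF mult_carrier_mat[OF G(1) fmat_carrier] G(1)] det_mult[OF G(1) fmat_carrier])
  then show inv: "invertible_mat (transpose_mat X * X) \<longleftrightarrow> det (fmat p H) \<noteq> 0"
    using invertible_mat_iff_det[OF XtXc] dG by simp
  assume dH: "det (fmat p H) \<noteq> 0"
  define Gi where "Gi = fmat p (finv p (\<lambda>i j. G $$ (i, j)))"
  have Gi: "G * Gi = 1\<^sub>m p" "Gi * G = 1\<^sub>m p" "Gi \<in> carrier_mat p p"
    using finv_mat[of p "\<lambda>i j. G $$ (i, j)", folded carrier_mat_fmat[OF G(1)], OF dG] by (auto simp: Gi_def)
  define Hm where "Hm = fmat p H"
  define Hi where "Hi = fmat p (finv p H)"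
  have Hm: "Hm \<in> carrier_mat p p" by (simp add: Hm_def)
  have Hi: "Hm * Hi = 1\<^sub>m p" "Hi \<in> carrier_mat p p" using finv_mat[OF dH] by (auto simp: Hi_def Hm_def)
  have "det (transpose_mat X * X) \<noteq> 0" using inv dH invertible_mat_iff_det[OF XtXc] by simp
  then have "transpose_mat X * X \<in> Units (ring_mat TYPE(real) p ())" by (rule det_non_zero_imp_unit[OF XtXc])
  then obtain W where W: "mat_inverse (transpose_mat X * X) = Some W"
    using mat_inverse(1)[OF XtXc, of "()"] by (cases "mat_inverse (transpose_mat X * X)") auto
  from mat_inverse(2)[OF XtXc W] have Wi: "W * (G * Hm * G) = 1\<^sub>m p" "W \<in> carrier_mat p p"
    unfolding XtX Hm_def by auto
  note am = assoc_mult_mat[of _ p p _ p _ p]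
  have GWG: "G * W * G = Hi"
  proof -
    have e1: "G * (Gi * Hi) = Hi" using am[OF G(1) Gi(3) Hi(2)] Gi(1) Hi by simp
    have N: "G * Hm * G \<in> carrier_mat p p" using G Hm by simp
    have "G * Hm * G * (Gi * Hi) = G * Hm * (G * (Gi * Hi))" using G Hm Gi Hi by (intro am) auto
    also have "\<dots> = G * (Hm * Hi)" unfolding e1 using am[OF G(1) Hm Hi(2)] by simp
    also have "\<dots> = G" using Hi G by simp
    finally have e2: "G * Hm * G * (Gi * Hi) = G" .
    have "W * G = W * (G * Hm * G) * (Gi * Hi)"
      using am[OF Wi(2) N, of "Gi * Hi"] Gi Hi e2 by simp
    also have "\<dots> = Gi * Hi" using Wi Gi Hi by simp
    finally have "W * G = Gi * Hi" .
    then have "G * (W * G) = Hi" using e1 by simp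
    then show ?thesis using am[OF G(1) Wi(2) G(1)] by simp
  qed
  have dX: "dim_row X = n" by (simp add: X_def design_mat_def)
  have "X * W * transpose_mat X = Z * Hi * transpose_mat Z"
  proof -
    have "X * W * transpose_mat X = Z * G * W * (G * transpose_mat Z)" unfolding Xt unfolding X ..
    also have "\<dots> = Z * (G * W) * (G * transpose_mat Z)"
      using assoc_mult_mat[OF Z G(1) Wi(2)] by simp
    also have "\<dots> = Z * ((G * W) * (G * transpose_mat Z))"
      using Z G Wi Zt by (intro assoc_mult_mat[where n\<^sub>2 = p and n\<^sub>3 = p]) auto
    also have "(G * W) * (G * transpose_mat Z) = G * W * G * transpose_mat Z"
      using assoc_mult_mat[of "G * W" p p G p "transpose_mat Z" n] G Wi Zt by simp
    also have "Z * (G * W * G * transpose_mat Z) = Z * Hi * transpose_mat Z"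
      unfolding GWG using assoc_mult_mat[OF Z Hi(2) Zt] by simp
    finally show ?thesis .
  qed
  then have res: "resid_mat X = 1\<^sub>m n - Z * Hi * transpose_mat Z"
    unfolding resid_mat_def dX W by simp
  show "resid_mat X = fmat n (resid n p z)"
  proof (rule eq_matI)
    fix i j assume "i < dim_row (fmat n (resid n p z))" "j < dim_col (fmat n (resid n p z))"
    then have ij: "i < n" "j < n" by auto
    have "(Z * Hi * transpose_mat Z) $$ (i, j) = (Z * (Hi * transpose_mat Z)) $$ (i, j)"
      using assoc_mult_mat[OF Z Hi(2) Zt] by simp
    also have "\<dots> = scalar_prod (row Z i) (col (Hi * transpose_mat Z) j)" using ij Z Hi Zt by simp
    also have "row Z i = vec p (z i)" using ij by (intro eq_vecI) (auto simp: Z_def)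
    also have "col (Hi * transpose_mat Z) j = Hi *\<^sub>v col (transpose_mat Z) j"
      using ij Hi Zt by (intro col_mult2) auto
    also have "col (transpose_mat Z) j = vec p (z j)" using ij by (intro eq_vecI) (auto simp: Z_def)
    also have "scalar_prod (vec p (z i)) (Hi *\<^sub>v vec p (z j)) = dotp p (z i) (mv p (finv p H) (z j))"
      unfolding Hi_def fmat_mult_vec scalar_prod_vec ..
    finally have *: "(Z * Hi * transpose_mat Z) $$ (i, j) = dotp p (z i) (mv p (finv p H) (z j))" .
    have "dim_row (Z * Hi * transpose_mat Z) = n" "dim_col (Z * Hi * transpose_mat Z) = n" using Z by auto
    then show "resid_mat X $$ (i, j) = fmat n (resid n p z) $$ (i, j)"
      unfolding res using ij * by (simp add: resid_def H_def)
  qed (use Z in \<open>auto simp: res\<close>)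
qed


section \<open>Eigenvalues of the Hadamard square of a projection\<close>

lemma spectrum_fmat_iff:
  "\<mu> \<in> spectrum (fmat n A) \<longleftrightarrow> (\<exists>v. (\<exists>i<n. v i \<noteq> 0) \<and> (\<forall>i<n. mv n A v i = \<mu> * v i))"
proof
  assume "\<mu> \<in> spectrum (fmat n A)"
  then obtain v where v: "v \<in> carrier_vec n" "v \<noteq> 0\<^sub>v n" "fmat n A *\<^sub>v v = \<mu> \<cdot>\<^sub>v v"
    by (auto simp: spectrum_def eigenvalue_def eigenvector_def)
  define w where "w = (\<lambda>i. v $ i)"
  have v_eq: "v = vec n w" unfolding w_def by (rule carrier_vec_eq[OF v(1)])
  have "mv n A w i = \<mu> * w i" if "i < n" for i
  proof -
    have "vec n (mv n A w) $ i = (\<mu> \<cdot>\<^sub>v vec n w) $ i" using v(3) unfolding v_eq fmat_mult_vec by simp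
    then show ?thesis using that by simp
  qed
  moreover have "\<exists>i<n. w i \<noteq> 0"
  proof (rule ccontr)
    assume "\<not> (\<exists>i<n. w i \<noteq> 0)"
    then have "v = 0\<^sub>v n" unfolding v_eq by (intro eq_vecI) auto
    then show False using v(2) by simp
  qed
  ultimately show "\<exists>v. (\<exists>i<n. v i \<noteq> 0) \<and> (\<forall>i<n. mv n A v i = \<mu> * v i)" by blast
next
  assume "\<exists>v. (\<exists>i<n. v i \<noteq> 0) \<and> (\<forall>i<n. mv n A v i = \<mu> * v i)"
  then obtain v i where v: "i < n" "v i \<noteq> 0" "\<forall>i<n. mv n A v i = \<mu> * v i" by blast
  have "vec n v \<noteq> 0\<^sub>v n" using v by (metis index_vec index_zero_vec(1))
  moreover have "fmat n A *\<^sub>v vec n v = \<mu> \<cdot>\<^sub>v vec n v"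
    unfolding fmat_mult_vec using v by (intro eq_vecI) auto
  ultimately show "\<mu> \<in> spectrum (fmat n A)"
    by (auto simp: spectrum_def eigenvalue_def eigenvector_def intro!: exI[of _ "vec n v"])
qed

text \<open>A complex eigenvalue exists. Symmetry makes its imaginary part vanish, and then the real or the
  imaginary part of the eigenvector is a real eigenvector. This ensures that the maximum and minimum
  defining \<open>lambda_max\<close> and \<open>lambda_min\<close> are those of a nonempty set.\<close>

lemma spectrum_sym_nonempty:
  assumes A: "symf n A" and n: "0 < n"
  shows "spectrum (fmat n A) \<noteq> {}"
proof -
  define Ac where "Ac = mat n n (\<lambda>(i, j). complex_of_real (A i j))"
  have Ac: "Ac \<in> carrier_mat n n" by (simp add: Ac_def)
  from spectrum_non_empty[OF Ac n] obtain \<mu> w where w: "w \<in> carrier_vec n" "w \<noteq> 0\<^sub>v n" "Ac *\<^sub>v w = \<mu> \<cdot>\<^sub>v w"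
    using Ac by (auto simp: spectrum_def eigenvalue_def eigenvector_def)
  define x where "x = (\<lambda>i. Re (w $ i))"
  define y where "y = (\<lambda>i. Im (w $ i))"
  define a where "a = Re \<mu>"
  define b where "b = Im \<mu>"
  have eq: "(\<Sum>j<n. complex_of_real (A i j) * w $ j) = \<mu> * w $ i" if i: "i < n" for i
  proof -
    have "(Ac *\<^sub>v w) $ i = (\<mu> \<cdot>\<^sub>v w) $ i" using w(3) by simp
    then show ?thesis using i w(1) by (simp add: Ac_def scalar_prod_def atLeast0LessThan)
  qed
  have Ax: "mv n A x i = a * x i - b * y i" if i: "i < n" for i
    using arg_cong[OF eq[OF i], of Re] by (simp add: mv_def dotp_def x_def y_def a_def b_def)
  have Ay: "mv n A y i = b * x i + a * y i" if i: "i < n" for i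
    using arg_cong[OF eq[OF i], of Im] by (simp add: mv_def dotp_def x_def y_def a_def b_def algebra_simps)
  have "dotp n y (mv n A x) = dotp n y (\<lambda>i. a * x i - b * y i)" by (intro dotp_cong refl Ax)
  then have 1: "dotp n y (mv n A x) = a * dotp n x y - b * dotp n y y" unfolding dotp_linear by (simp add: dotp_commute)
  have "dotp n x (mv n A y) = dotp n x (\<lambda>i. b * x i + a * y i)" by (intro dotp_cong refl Ay)
  then have 2: "dotp n x (mv n A y) = b * dotp n x x + a * dotp n x y" unfolding dotp_linear .
  have "dotp n x (mv n A y) = dotp n y (mv n A x)" using dotp_mv_sym[OF A, of x y] by (simp add: dotp_commute)
  then have b: "b * (dotp n x x + dotp n y y) = 0" using 1 2 by (simp add: algebra_simps)
  have ex: "\<exists>i<n. x i \<noteq> 0 \<or> y i \<noteq> 0"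
  proof (rule ccontr)
    assume "\<not> (\<exists>i<n. x i \<noteq> 0 \<or> y i \<noteq> 0)"
    then have "w = 0\<^sub>v n" using w(1) by (intro eq_vecI) (auto simp: x_def y_def complex_eq_iff)
    then show False using w(2) by simp
  qed
  have "dotp n x x + dotp n y y \<noteq> 0"
  proof
    assume "dotp n x x + dotp n y y = 0"
    then have "dotp n x x = 0" "dotp n y y = 0" using dotp_self_nonneg[of n x] dotp_self_nonneg[of n y] by linarith+
    then show False using ex by (auto simp: dotp_self_eq_0)
  qed
  then have b0: "b = 0" using b by simp
  have "a \<in> spectrum (fmat n A)"
    unfolding spectrum_fmat_iff using ex Ax Ay b0 by (auto intro: exI[of _ x] exI[of _ y])
  then show ?thesis by blast
qed

text \<open>The disc of row \<open>i\<close>, where \<open>i\<close> maximises the entries of an eigenvector, has centre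
  \<open>(q i i)\<^sup>2\<close> and radius \<open>q i i - (q i i)\<^sup>2\<close>.\<close>

lemma spectrum_square_projection:
  assumes \<mu>: "\<mu> \<in> spectrum (fmat n (\<lambda>i j. (q i j)\<^sup>2))"
    and q: "\<And>i. i < n \<Longrightarrow> (\<Sum>j<n. (q i j)\<^sup>2) = q i i"
  shows "\<exists>i<n. 2 * (q i i)\<^sup>2 - q i i \<le> \<mu> \<and> \<mu> \<le> q i i"
proof -
  obtain v i0 where v: "i0 < n" "v i0 \<noteq> 0" "\<And>i. i < n \<Longrightarrow> mv n (\<lambda>i j. (q i j)\<^sup>2) v i = \<mu> * v i"
    using \<mu> unfolding spectrum_fmat_iff by blast
  define i where "i = arg_max_on (\<lambda>i. \<bar>v i\<bar>) {..<n}"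
  have i: "i < n" "\<And>j. j < n \<Longrightarrow> \<bar>v j\<bar> \<le> \<bar>v i\<bar>"
  proof -
    have "finite ((\<lambda>i. \<bar>v i\<bar>) ` {..<n})" "(\<lambda>i. \<bar>v i\<bar>) ` {..<n} \<noteq> {}" using v(1) by auto
    from Max_in[OF this] obtain j where "j < n" "\<bar>v j\<bar> = Max ((\<lambda>i. \<bar>v i\<bar>) ` {..<n})" by auto
    then have "is_arg_max (\<lambda>i. \<bar>v i\<bar>) (\<lambda>x. x \<in> {..<n}) j"
      by (auto simp: is_arg_max_linorder)
    then have "is_arg_max (\<lambda>i. \<bar>v i\<bar>) (\<lambda>x. x \<in> {..<n}) i"
      unfolding i_def arg_max_on_def arg_max_def by (rule someI)
    then show "i < n" "\<And>j. j < n \<Longrightarrow> \<bar>v j\<bar> \<le> \<bar>v i\<bar>" by (auto simp: is_arg_max_linorder)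
  qed
  have vi: "0 < \<bar>v i\<bar>" using i(2)[OF v(1)] v(2) by simp
  have "(\<mu> - (q i i)\<^sup>2) * v i = (\<Sum>j\<in>{..<n} - {i}. (q i j)\<^sup>2 * v j)"
    using v(3)[OF i(1)] i(1) by (simp add: mv_def dotp_def sum.remove[of "{..<n}" i] algebra_simps)
  then have "\<bar>\<mu> - (q i i)\<^sup>2\<bar> * \<bar>v i\<bar> = \<bar>\<Sum>j\<in>{..<n} - {i}. (q i j)\<^sup>2 * v j\<bar>" by (simp add: abs_mult[symmetric])
  also have "\<dots> \<le> (\<Sum>j\<in>{..<n} - {i}. (q i j)\<^sup>2 * \<bar>v i\<bar>)"
    by (rule order_trans[OF sum_abs]) (auto simp: abs_mult intro!: sum_mono mult_left_mono i(2))
  also have "\<dots> = (q i i - (q i i)\<^sup>2) * \<bar>v i\<bar>"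
    using q[OF i(1)] i(1) by (simp add: sum_distrib_right[symmetric] sum.remove[of "{..<n}" i])
  finally have "\<bar>\<mu> - (q i i)\<^sup>2\<bar> \<le> q i i - (q i i)\<^sup>2" using vi by (simp add: mult_le_cancel_right)
  then show ?thesis using i(1) by (intro exI[of _ i]) (auto simp: abs_le_iff)
qed

section \<open>Leaving one row out of a Gram matrix\<close>

lemma gram_sym: "symf p (gram I z)" by (simp add: gram_def symf_def mult.commute)

lemma gram_mv: "mv p (gram I z) v a = (\<Sum>i\<in>I. z i a * dotp p (z i) v)"
  by (simp add: mv_def dotp_def gram_def sum_distrib_left sum_distrib_right mult.assoc sum.swap[of _ "{..<p}"])

lemma gram_quad: "dotp p v (mv p (gram I z) v) = (\<Sum>i\<in>I. (dotp p v (z i))\<^sup>2)"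
proof -
  have "dotp p v (mv p (gram I z) v) = (\<Sum>a<p. \<Sum>i\<in>I. v a * z i a * dotp p (z i) v)"
    by (simp add: dotp_def[of p v "mv _ _ _"] gram_mv sum_distrib_left mult.assoc)
  also have "\<dots> = (\<Sum>i\<in>I. dotp p v (z i) * dotp p (z i) v)"
    by (subst sum.swap) (simp add: dotp_def[of p v "z _"] sum_distrib_right)
  finally show ?thesis by (simp add: power2_eq_square dotp_commute)
qed

lemma fmat_cong: "(\<And>i j. i < p \<Longrightarrow> j < p \<Longrightarrow> H i j = H' i j) \<Longrightarrow> fmat p H = fmat p H'"
  by (intro eq_matI) auto

lemma finv_gram_cong:
  assumes "\<And>i j. i \<in> I \<Longrightarrow> j < p \<Longrightarrow> z i j = z' i j"
  shows "finv p (gram I z) = finv p (gram I z')"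
  using assms by (simp add: finv_def gram_def cong: fmat_cong)

context
  fixes p :: nat and H A :: "nat \<Rightarrow> nat \<Rightarrow> real"
  assumes det: "det (fmat p H) \<noteq> 0" and H: "symf p H"
  defines "A \<equiv> finv p H"
begin

lemma finv_dotp: "dotp p w (mv p H (mv p A v)) = dotp p w v" "dotp p w (mv p A (mv p H v)) = dotp p w v"
  using finv_mv[OF det] by (auto simp: A_def intro!: dotp_cong)

lemma finv_row: "i < p \<Longrightarrow> j < p \<Longrightarrow> mv p A (\<lambda>l. if i = l then 1 else 0) j = A i j"
  using finv_sym[OF det H, folded A_def] dotp_unit[of i p "A j"] by (simp add: mv_def dotp_commute symf_def)

lemma finv_trace: "(\<Sum>a<p. dotp p (A a) (H a)) = p"
proof -
  have "dotp p (A a) (H a) = 1" if a: "a < p" for a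
  proof -
    let ?e = "\<lambda>l. if a = l then 1 else (0::real)"
    have "dotp p (A a) (H a) = dotp p (H a) (mv p A ?e)"
      using a by (subst dotp_commute) (intro dotp_cong refl, simp add: finv_row)
    also have "\<dots> = mv p H (mv p A ?e) a" by (simp add: mv_def)
    also have "\<dots> = 1" using finv_mv(1)[OF det a, of ?e] by (simp add: A_def)
    finally show ?thesis .
  qed
  then show ?thesis by simp
qed

text \<open>Column \<open>a\<close> of the inverse solves \<open>H x = e\<close> with a unit vector \<open>e\<close>, so its norm is at most
  \<open>1 / \<kappa>\<close>.\<close>

lemma fro2_finv_le:
  assumes \<kappa>: "0 < \<kappa>" and coer: "\<And>v. \<kappa> * dotp p v v \<le> dotp p v (mv p H v)"
  shows "fro2 p A \<le> p / \<kappa>\<^sup>2"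
proof -
  have "dotp p (A a) (A a) \<le> 1 / \<kappa>\<^sup>2" if a: "a < p" for a
  proof -
    let ?e = "\<lambda>l. if a = l then 1 else (0::real)"
    define s where "s = dotp p (A a) (A a)"
    have row: "dotp p x (mv p H (A a)) = x a" for x
    proof -
      have "mv p H (A a) = mv p H (mv p A ?e)"
        unfolding mv_def[of p H] using a by (intro ext dotp_cong refl) (simp add: finv_row)
      then have "dotp p x (mv p H (A a)) = dotp p x ?e" by (simp add: finv_dotp)
      also have "\<dots> = x a" using dotp_unit[OF a, of x] by (simp add: dotp_commute)
      finally show ?thesis .
    qed
    have s0: "0 \<le> s" by (simp add: s_def dotp_self_nonneg)
    have 1: "\<kappa> * s \<le> A a a" using coer[of "A a"] row[of "A a"] by (simp add: s_def)
    have "(A a a)\<^sup>2 \<le> s"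
      unfolding s_def dotp_def power2_eq_square by (rule member_le_sum) (use a in auto)
    moreover have "(\<kappa> * s)\<^sup>2 \<le> (A a a)\<^sup>2" using 1 s0 \<kappa> by (intro power_mono) auto
    ultimately have 2: "(\<kappa> * s)\<^sup>2 \<le> s" by simp
    have "\<kappa>\<^sup>2 * s \<le> 1"
    proof (cases "s = 0")
      case False
      then have "0 < s" using s0 by simp
      have "(\<kappa>\<^sup>2 * s) * s \<le> 1 * s" using 2 by (simp add: power2_eq_square mult_ac)
      then show ?thesis using \<open>0 < s\<close> by (simp only: mult_le_cancel_right_pos)
    qed simp
    then show ?thesis using \<kappa> unfolding s_def[symmetric] by (simp add: le_divide_eq mult.commute)
  qed
  then have "fro2 p A \<le> (\<Sum>a<p. 1 / \<kappa>\<^sup>2)" unfolding fro2_def by (intro sum_mono) auto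
  then show ?thesis by simp
qed

end

lemma resid_props:
  assumes det: "det (fmat p (gram {..<n} z)) \<noteq> 0"
  shows "symf n (resid n p z)"
    and "i < n \<Longrightarrow> (\<Sum>j<n. (resid n p z i j)\<^sup>2) = resid n p z i i"
    and "(\<Sum>i<n. resid n p z i i) = real n - real p"
proof -
  let ?H = "gram {..<n} z"
  define A where "A = finv p ?H"
  note s = finv_sym[OF det gram_sym, folded A_def]
  define P where "P = (\<lambda>i j. dotp p (z i) (mv p A (z j)))"
  have r: "resid n p z i j = (if i = j then 1 else 0) - P i j" for i j
    by (simp add: resid_def P_def A_def)
  have P_sym: "P i j = P j i" for i j
    unfolding P_def using dotp_mv_sym[OF s, of "z i" "z j"] by (simp add: dotp_commute)
  then show "symf n (resid n p z)" by (auto simp: symf_def r)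
  have PP: "(\<Sum>j<n. (P i j)\<^sup>2) = P i i" for i
  proof -
    let ?u = "mv p A (z i)"
    have "(\<Sum>j<n. (P i j)\<^sup>2) = (\<Sum>j<n. (dotp p ?u (z j))\<^sup>2)"
      unfolding P_def dotp_mv_sym[OF s] ..
    also have "\<dots> = dotp p ?u (mv p ?H ?u)" by (rule gram_quad[symmetric])
    also have "\<dots> = dotp p ?u (z i)" unfolding A_def by (rule finv_dotp(1)[OF det gram_sym])
    also have "\<dots> = P i i" by (simp add: P_def dotp_commute)
    finally show ?thesis .
  qed
  show "(\<Sum>j<n. (resid n p z i j)\<^sup>2) = resid n p z i i" if i: "i < n"
  proof -
    have "(\<Sum>j<n. (resid n p z i j)\<^sup>2) = (\<Sum>j<n. (if i = j then 1 - 2 * P i j else 0) + (P i j)\<^sup>2)"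
      by (intro sum.cong refl) (simp add: r power2_eq_square algebra_simps)
    also have "\<dots> = 1 - 2 * P i i + P i i" using i by (simp add: sum.distrib PP sum.delta')
    finally show ?thesis by (simp add: r)
  qed
  have "(\<Sum>i<n. P i i) = (\<Sum>i<n. \<Sum>a<p. \<Sum>b<p. A a b * (z i a * z i b))"
    by (simp add: P_def dotp_def mv_def sum_distrib_left algebra_simps)
  also have "\<dots> = (\<Sum>a<p. \<Sum>i<n. \<Sum>b<p. A a b * (z i a * z i b))" by (rule sum.swap)
  also have "\<dots> = (\<Sum>a<p. \<Sum>b<p. \<Sum>i<n. A a b * (z i a * z i b))" by (intro sum.cong refl sum.swap)
  also have "\<dots> = (\<Sum>a<p. dotp p (A a) (?H a))" by (simp add: dotp_def gram_def sum_distrib_left)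
  also have "\<dots> = p" unfolding A_def by (rule finv_trace[OF det gram_sym])
  finally have "(\<Sum>i<n. P i i) = p" .
  then show "(\<Sum>i<n. resid n p z i i) = real n - real p" by (simp add: r sum_subtractf)
qed

text \<open>Sherman--Morrison for the removal of row \<open>i\<close>. The trace changes by \<open>u \<bullet> u / (1 + y)\<close> with
  \<open>u = A' x\<close>, and coercivity gives \<open>\<kappa> * (u \<bullet> u) \<le> y\<close>, so the change is at most \<open>1 / \<kappa>\<close> however large
  the quadratic form \<open>y\<close> is.\<close>

lemma leave_one_out:
  fixes z :: "nat \<Rightarrow> nat \<Rightarrow> real"
  assumes I: "finite I" "i \<in> I" and \<kappa>: "0 < \<kappa>"
    and coer: "\<And>v. \<kappa> * dotp p v v \<le> (\<Sum>j\<in>I - {i}. (dotp p v (z j))\<^sup>2)"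
  defines "H \<equiv> gram I z" and "H' \<equiv> gram (I - {i}) z"
  defines "y \<equiv> dotp p (z i) (mv p (finv p H') (z i))"
  shows "det (fmat p H) \<noteq> 0" and "det (fmat p H') \<noteq> 0" and "0 \<le> y"
    and "1 - dotp p (z i) (mv p (finv p H) (z i)) = 1 / (1 + y)"
    and "trf p (finv p H) \<le> trf p (finv p H')" "trf p (finv p H') \<le> trf p (finv p H) + 1 / \<kappa>"
proof -
  define x where "x = z i"
  have coer': "\<kappa> * dotp p v v \<le> dotp p v (mv p H' v)" for v unfolding H'_def gram_quad by (rule coer)
  have Hmv: "mv p H v a = mv p H' v a + x a * dotp p x v" for v a
    unfolding H_def H'_def gram_mv x_def using I by (simp add: sum.remove)
  have coerH: "\<kappa> * dotp p v v \<le> dotp p v (mv p H v)" for v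
  proof -
    have "dotp p v (mv p H v) = (\<Sum>j\<in>I - {i}. (dotp p v (z j))\<^sup>2) + (dotp p v (z i))\<^sup>2"
      unfolding H_def gram_quad using I by (simp add: sum.remove)
    then show ?thesis using coer[of v] by (simp add: add_increasing2)
  qed
  show dH: "det (fmat p H) \<noteq> 0" by (rule det_nonzero_if_coercive[OF \<kappa> coerH])
  show dH': "det (fmat p H') \<noteq> 0" by (rule det_nonzero_if_coercive[OF \<kappa> coer'])
  have sH: "symf p H" "symf p H'" by (simp_all add: H_def H'_def gram_sym)
  define A where "A = finv p H"
  define A' where "A' = finv p H'"
  have sA': "symf p A'" unfolding A'_def by (rule finv_sym[OF dH' sH(2)])
  define u where "u = mv p A' x"
  have y: "y = dotp p x u" by (simp add: y_def x_def u_def A'_def)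
  have uH: "dotp p u (mv p H' u) = y"
    unfolding y u_def A'_def finv_dotp(1)[OF dH' sH(2)] by (rule dotp_commute)
  have "0 \<le> \<kappa> * dotp p u u" using \<kappa> dotp_self_nonneg by simp
  then show y0: "0 \<le> y" using coer'[of u] uH by simp
  have cong: "mv p B v = mv p B w" if "\<And>a. a < p \<Longrightarrow> v a = w a" for B v w
    unfolding mv_def using that by (intro ext dotp_cong) auto
  \<comment> \<open>Apply \<open>A\<close> to \<open>H (A' v) = v + (u \<bullet> v) x\<close>.\<close>
  have SM: "mv p A' v a = mv p A v a + dotp p u v * mv p A x a" if a: "a < p" for v a
  proof -
    have "mv p A' v a = mv p A (mv p H (mv p A' v)) a" unfolding A_def by (rule finv_mv(2)[OF dH a, symmetric])
    also have "mv p A (mv p H (mv p A' v)) = mv p A (\<lambda>b. v b + dotp p u v * x b)"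
    proof (rule cong)
      fix b assume b: "b < p"
      have "dotp p x (mv p A' v) = dotp p u v" unfolding u_def by (rule dotp_mv_sym[OF sA'])
      then show "mv p H (mv p A' v) b = v b + dotp p u v * x b"
        unfolding Hmv using finv_mv(1)[OF dH' b, of v] by (simp add: A'_def mult.commute)
    qed
    finally show ?thesis by (simp add: mv_linear)
  qed
  have Ax: "mv p A x a = u a / (1 + y)" if "a < p" for a
  proof -
    have "u a = (1 + y) * mv p A x a" using SM[OF that, of x] by (simp add: u_def[symmetric] y dotp_commute algebra_simps)
    then show ?thesis using y0 by simp
  qed
  have "dotp p x (mv p A x) = dotp p x (\<lambda>a. 1 / (1 + y) * u a)" by (intro dotp_cong refl) (simp add: Ax)
  also have "\<dots> = y / (1 + y)" unfolding dotp_linear y[symmetric] by simp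
  finally have "1 - dotp p x (mv p A x) = 1 - y / (1 + y)" by simp
  also have "\<dots> = 1 / (1 + y)" using y0 by (simp add: field_simps)
  finally show "1 - dotp p (z i) (mv p (finv p H) (z i)) = 1 / (1 + y)" by (simp add: x_def A_def)
  have diag: "A' a a = A a a + u a * u a / (1 + y)" if a: "a < p" for a
  proof -
    let ?e = "\<lambda>l. if a = l then 1 else (0::real)"
    have "A' a a = mv p A' ?e a" "A a a = mv p A ?e a"
      using finv_row[OF dH' sH(2) a a] finv_row[OF dH sH(1) a a] by (simp_all add: A_def A'_def)
    moreover have "dotp p u ?e = u a" using dotp_unit[OF a, of u] by (simp add: dotp_commute)
    ultimately show ?thesis using SM[OF a, of ?e] Ax[OF a] by simp
  qed
  have tr: "trf p A' = trf p A + dotp p u u / (1 + y)"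
  proof -
    have "trf p A' = (\<Sum>a<p. A a a + u a * u a / (1 + y))" unfolding trf_def by (intro sum.cong) (auto simp: diag)
    then show ?thesis by (simp add: sum.distrib trf_def dotp_def sum_divide_distrib)
  qed
  have "0 \<le> dotp p u u / (1 + y)" using dotp_self_nonneg y0 by simp
  then show "trf p (finv p H) \<le> trf p (finv p H')" using tr by (simp add: A_def A'_def)
  have "dotp p u u \<le> y / \<kappa>" using coer'[of u] uH \<kappa> by (simp add: le_divide_eq mult.commute)
  then have "dotp p u u / (1 + y) \<le> y / \<kappa> / (1 + y)" using y0 by (intro divide_right_mono) auto
  also have "\<dots> = 1 / \<kappa> * (y / (1 + y))" by simp
  also have "\<dots> \<le> 1 / \<kappa> * 1" using y0 \<kappa> by (intro mult_left_mono) auto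
  finally have "dotp p u u / (1 + y) \<le> 1 / \<kappa>" by simp
  then show "trf p (finv p H') \<le> trf p (finv p H) + 1 / \<kappa>" using tr by (simp add: A_def A'_def)
qed

text \<open>All quadratic forms are within \<open>2 t\<close> of the common trace \<open>T\<close>, so the diagonal entries differ by
  at most \<open>4 t\<close> from each other, hence from their mean, which is \<open>1 - p / n\<close> since the trace of the
  projection is known.\<close>

lemma resid_diag_concentration:
  fixes z :: "nat \<Rightarrow> nat \<Rightarrow> real"
  assumes n: "0 < n" and \<kappa>: "0 < \<kappa>" "1 / \<kappa> \<le> t"
    and coer: "\<And>i v. i < n \<Longrightarrow> \<kappa> * dotp p v v \<le> (\<Sum>j\<in>{..<n} - {i}. (dotp p v (z j))\<^sup>2)"
    and dev: "\<And>i. i < n \<Longrightarrow> \<bar>dotp p (z i) (mv p (finv p (gram ({..<n} - {i}) z)) (z i))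
       - trf p (finv p (gram ({..<n} - {i}) z))\<bar> \<le> t"
  shows "det (fmat p (gram {..<n} z)) \<noteq> 0"
    and "i < n \<Longrightarrow> 0 \<le> resid n p z i i \<and> resid n p z i i \<le> 1 \<and> \<bar>resid n p z i i - (1 - p / n)\<bar> \<le> 4 * t"
proof -
  have LO: "i \<in> {..<n}" if "i < n" for i using that by simp
  show det: "det (fmat p (gram {..<n} z)) \<noteq> 0"
    by (rule leave_one_out(1)[OF _ LO[OF n] \<kappa>(1) coer[OF n]]) simp
  define T where "T = trf p (finv p (gram {..<n} z))"
  define y where "y = (\<lambda>i. dotp p (z i) (mv p (finv p (gram ({..<n} - {i}) z)) (z i)))"
  have y0: "0 \<le> y i" and r: "resid n p z i i = 1 / (1 + y i)"
    and T: "\<bar>y i - T\<bar> \<le> 2 * t" if i: "i < n" for i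
  proof -
    note lo = leave_one_out[OF finite_lessThan LO[OF i] \<kappa>(1) coer[OF i]]
    show "0 \<le> y i" using lo(3) by (simp add: y_def)
    show "resid n p z i i = 1 / (1 + y i)" using lo(4) by (simp add: y_def resid_def)
    show "\<bar>y i - T\<bar> \<le> 2 * t" using lo(5,6) dev[OF i] \<kappa>(2) by (simp add: y_def T_def abs_le_iff)
  qed
  have diff: "\<bar>1 / (1 + y i) - 1 / (1 + y j)\<bar> \<le> 4 * t" if ij: "i < n" "j < n" for i j
  proof -
    have "\<bar>1 / (1 + y i) - 1 / (1 + y j)\<bar> = \<bar>y j - y i\<bar> / ((1 + y i) * (1 + y j))"
      using y0[OF ij(1)] y0[OF ij(2)] by (simp add: divide_simps abs_mult abs_divide)
    also have "\<dots> \<le> \<bar>y j - y i\<bar> / 1"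
    proof (intro divide_left_mono)
      show "1 \<le> (1 + y i) * (1 + y j)" using y0[OF ij(1)] y0[OF ij(2)] by (simp add: algebra_simps)
      then show "0 < (1 + y i) * (1 + y j) * 1" by linarith
    qed auto
    also have "\<dots> \<le> 4 * t" using T[OF ij(1)] T[OF ij(2)] by (simp add: abs_le_iff)
    finally show ?thesis .
  qed
  show "0 \<le> resid n p z i i \<and> resid n p z i i \<le> 1 \<and> \<bar>resid n p z i i - (1 - p / n)\<bar> \<le> 4 * t" if i: "i < n"
  proof (intro conjI)
    show "0 \<le> resid n p z i i" "resid n p z i i \<le> 1" using y0[OF i] by (simp_all add: r[OF i])
    have "real n * (1 - p / n) = (\<Sum>j<n. resid n p z j j)"
      using resid_props(3)[OF det] n by (simp add: right_diff_distrib)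
    then have "real n * (resid n p z i i - (1 - p / n)) = (\<Sum>j<n. resid n p z i i - resid n p z j j)"
      by (simp add: sum_subtractf right_diff_distrib)
    then have "real n * \<bar>resid n p z i i - (1 - p / n)\<bar> = \<bar>\<Sum>j<n. resid n p z i i - resid n p z j j\<bar>"
      by (metis abs_mult abs_of_nat)
    also have "\<dots> \<le> (\<Sum>j<n. 4 * t)"
      by (rule order_trans[OF sum_abs]) (intro sum_mono, use diff i in \<open>simp add: r\<close>)
    finally have "real n * \<bar>resid n p z i i - (1 - p / n)\<bar> \<le> real n * (4 * t)" by simp
    then show "\<bar>resid n p z i i - (1 - p / n)\<bar> \<le> 4 * t" using n by simp
  qed
qed

section \<open>Measurability of the eigenvalue event\<close>

lemma borel_measurable_det:
  assumes A: "\<And>\<omega>. A \<omega> \<in> carrier_mat n n"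
    and m: "\<And>i j. i < n \<Longrightarrow> j < n \<Longrightarrow> (\<lambda>\<omega>. A \<omega> $$ (i, j) :: real) \<in> borel_measurable N"
  shows "(\<lambda>\<omega>. det (A \<omega>)) \<in> borel_measurable N"
  unfolding det_def'[OF A]
  by (intro borel_measurable_sum borel_measurable_times borel_measurable_const borel_measurable_prod m)
    (auto simp: permutes_in_image)

lemma borel_measurable_finv:
  assumes m: "\<And>i j. i < p \<Longrightarrow> j < p \<Longrightarrow> (\<lambda>\<omega>. H \<omega> i j) \<in> borel_measurable N" and ab: "a < p" "b < p"
  shows "(\<lambda>\<omega>. finv p (H \<omega>) a b) \<in> borel_measurable N"
proof -
  have d: "(\<lambda>\<omega>. det (fmat p (H \<omega>))) \<in> borel_measurable N"
    by (rule borel_measurable_det[where n = p]) (use m in auto)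
  have "(\<lambda>\<omega>. det (mat_delete (fmat p (H \<omega>)) b a)) \<in> borel_measurable N"
    by (rule borel_measurable_det[where n = "p - 1"]) (auto simp: mat_delete_def intro!: m)
  then show ?thesis
    using d ab by (simp add: finv_def adj_mat_def cofactor_def)
qed

lemma borel_measurable_gram:
  assumes "\<And>i a. i \<in> I \<Longrightarrow> a < p \<Longrightarrow> (\<lambda>\<omega>. z \<omega> i a) \<in> borel_measurable N" "a < p" "b < p"
  shows "(\<lambda>\<omega>. gram I (z \<omega>) a b) \<in> borel_measurable N"
  unfolding gram_def using assms by (intro borel_measurable_sum borel_measurable_times) auto

text \<open>A zero on a half-line is detected by countably many conditions: on some compact interval the
  function takes arbitrarily small values at rational points, and by continuity and compactness its
  infimum \<open>0\<close> is attained.\<close>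

lemma zero_exists_measurable:
  fixes g :: "real \<Rightarrow> 'a \<Rightarrow> real"
  assumes m[measurable]: "\<And>s. g s \<in> borel_measurable M"
    and cont: "\<And>\<omega>. continuous_on UNIV (\<lambda>s. g s \<omega>)"
  shows "{\<omega> \<in> space M. \<exists>s\<ge>0. g s \<omega> = 0} \<in> sets M"
proof -
  have eq: "(\<exists>s\<ge>0. g s \<omega> = 0) \<longleftrightarrow> (\<exists>N::nat. \<forall>k::nat. \<exists>r\<in>\<rat>. 0 \<le> r \<and> r \<le> N \<and> \<bar>g r \<omega>\<bar> < 1 / (real k + 1))" for \<omega>
  proof
    assume "\<exists>s\<ge>0. g s \<omega> = 0"
    then obtain s where s: "s \<ge> 0" "g s \<omega> = 0" by blast
    obtain N :: nat where N: "s < N" using reals_Archimedean2 by blast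
    have "\<exists>r\<in>\<rat>. 0 \<le> r \<and> r \<le> N \<and> \<bar>g r \<omega>\<bar> < 1 / (real k + 1)" for k :: nat
    proof -
      have "isCont (\<lambda>s. g s \<omega>) s" using cont by (simp add: continuous_on_eq_continuous_at)
      then have "\<forall>\<epsilon>>0. \<exists>d>0. \<forall>r. \<bar>r - s\<bar> < d \<longrightarrow> \<bar>g r \<omega> - g s \<omega>\<bar> < \<epsilon>"
        unfolding continuous_at_eps_delta dist_real_def .
      from this[rule_format, of "1 / (real k + 1)"]
      obtain d where d: "d > 0" "\<And>r. \<bar>r - s\<bar> < d \<Longrightarrow> \<bar>g r \<omega> - g s \<omega>\<bar> < 1 / (real k + 1)"
        by auto
      have "s < min N (s + d)" using N d(1) by simp
      from Rats_dense_in_real[OF this] obtain r where r: "r \<in> \<rat>" "s < r" "r < min N (s + d)" by blast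
      then have "\<bar>g r \<omega> - g s \<omega>\<bar> < 1 / (real k + 1)" using d(2)[of r] by simp
      then have "\<bar>g r \<omega>\<bar> < 1 / (real k + 1)" unfolding s(2) diff_0_right .
      moreover have "0 \<le> r" "r \<le> N" using r s by auto
      ultimately show ?thesis using r(1) by blast
    qed
    then show "\<exists>N::nat. \<forall>k::nat. \<exists>r\<in>\<rat>. 0 \<le> r \<and> r \<le> N \<and> \<bar>g r \<omega>\<bar> < 1 / (real k + 1)"
      by (intro exI[of _ N] allI)
  next
    assume "\<exists>N::nat. \<forall>k::nat. \<exists>r\<in>\<rat>. 0 \<le> r \<and> r \<le> N \<and> \<bar>g r \<omega>\<bar> < 1 / (real k + 1)"
    then obtain N :: nat where N0: "\<forall>k::nat. \<exists>r\<in>\<rat>. 0 \<le> r \<and> r \<le> N \<and> \<bar>g r \<omega>\<bar> < 1 / (real k + 1)" by (elim exE)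
    have N: "\<exists>r::real. 0 \<le> r \<and> r \<le> N \<and> \<bar>g r \<omega>\<bar> < 1 / (real k + 1)" for k :: nat
      using N0[rule_format, of k] by (elim bexE) (rule exI)
    have "\<exists>s\<in>{0..real N}. \<forall>r\<in>{0..real N}. \<bar>g s \<omega>\<bar> \<le> \<bar>g r \<omega>\<bar>"
      by (rule continuous_attains_inf)
        (auto intro!: continuous_intros continuous_on_subset[OF cont])
    then obtain s where s: "s \<in> {0..real N}" "\<And>r. r \<in> {0..real N} \<Longrightarrow> \<bar>g s \<omega>\<bar> \<le> \<bar>g r \<omega>\<bar>" by blast
    have lt: "\<bar>g s \<omega>\<bar> < 1 / (real k + 1)" for k :: nat
      using N[of k] s(2) by (meson atLeastAtMost_iff order_le_less_trans)
    have "g s \<omega> = 0"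
    proof (rule ccontr)
      assume "g s \<omega> \<noteq> 0"
      then obtain k where "inverse (real (Suc k)) < \<bar>g s \<omega>\<bar>" using reals_Archimedean[of "\<bar>g s \<omega>\<bar>"] by auto
      then show False using lt[of k] by (simp add: inverse_eq_divide add.commute)
    qed
    then show "\<exists>s\<ge>0. g s \<omega> = 0" using s by auto
  qed
  have "{\<omega> \<in> space M. \<exists>N::nat. \<forall>k::nat. \<exists>r\<in>\<rat>. 0 \<le> r \<and> r \<le> N \<and> \<bar>g r \<omega>\<bar> < 1 / (real k + 1)} \<in> sets M"
    by (intro sets.sets_Collect_countable_Ex sets.sets_Collect_countable_All
        sets.sets_Collect_countable_Ex' countable_rat) measurable
  then show ?thesis unfolding eq .
qed

lemma spectrum_det: "\<mu> \<in> spectrum (fmat n A) \<longleftrightarrow> det (fmat n (\<lambda>i j. A i j - (if i = j then \<mu> else 0))) = 0"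
proof -
  have "char_matrix (fmat n A) \<mu> = fmat n (\<lambda>i j. A i j - (if i = j then \<mu> else 0))"
    by (intro eq_matI) (auto simp: char_matrix_def)
  then show ?thesis using eigenvalue_det[OF fmat_carrier, of n A \<mu>] by (simp add: spectrum_def)
qed

lemma spectrum_ray_measurable:
  assumes A: "\<And>i j. i < n \<Longrightarrow> j < n \<Longrightarrow> (\<lambda>\<omega>. A \<omega> i j) \<in> borel_measurable M"
  shows "{\<omega> \<in> space M. \<exists>s\<ge>0. c + e * s \<in> spectrum (fmat n (A \<omega>))} \<in> sets M"
  unfolding spectrum_det
proof (rule zero_exists_measurable)
  show "(\<lambda>\<omega>. det (fmat n (\<lambda>i j. A \<omega> i j - (if i = j then c + e * s else 0)))) \<in> borel_measurable M" for s
    by (rule borel_measurable_det[where n = n]) (use A in auto)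
  show "continuous_on UNIV (\<lambda>s. det (fmat n (\<lambda>i j. A \<omega> i j - (if i = j then c + e * s else 0))))" for \<omega>
    unfolding det_def'[OF fmat_carrier]
  proof (intro continuous_on_sum continuous_on_mult continuous_on_const continuous_on_prod)
    fix \<pi> i assume \<pi>: "\<pi> \<in> {p. p permutes {0..<n}}" and i: "i \<in> {0..<n}"
    then have "\<pi> i < n" using permutes_in_image by fastforce
    then show "continuous_on UNIV (\<lambda>s. fmat n (\<lambda>i j. A \<omega> i j - (if i = j then c + e * s else 0)) $$ (i, \<pi> i))"
      using i by (cases "i = \<pi> i") (auto intro!: continuous_intros)
  qed
qed

text \<open>The two conditions say that the characteristic determinant has no zero on the ray upwards from
  \<open>c\<close> and none on the ray downwards from \<open>d\<close>.\<close>

lemma lambda_bounds_measurable: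
  assumes A: "\<And>i j. i < n \<Longrightarrow> j < n \<Longrightarrow> (\<lambda>\<omega>. A \<omega> i j) \<in> borel_measurable M"
    and sym: "\<And>\<omega>. symf n (A \<omega>)" and n: "0 < n"
  shows "{\<omega> \<in> space M. lambda_max (fmat n (A \<omega>)) < c \<and> d < lambda_min (fmat n (A \<omega>))} \<in> sets M"
proof -
  let ?S = "\<lambda>\<omega>. spectrum (fmat n (A \<omega>))"
  have fin: "finite (?S \<omega>)" and ne: "?S \<omega> \<noteq> {}" for \<omega>
    using card_finite_spectrum(1)[OF fmat_carrier] spectrum_sym_nonempty[OF sym n] by auto
  have 1: "lambda_max (fmat n (A \<omega>)) < c \<longleftrightarrow> \<not> (\<exists>s\<ge>0. c + 1 * s \<in> ?S \<omega>)" for \<omega>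
  proof -
    have "lambda_max (fmat n (A \<omega>)) < c \<longleftrightarrow> (\<forall>\<mu>\<in>?S \<omega>. \<mu> < c)"
      unfolding lambda_max_def using fin ne by (simp add: Max_less_iff)
    also have "\<dots> \<longleftrightarrow> \<not> (\<exists>s\<ge>0. c + 1 * s \<in> ?S \<omega>)"
    proof safe
      fix s assume "\<forall>\<mu>\<in>?S \<omega>. \<mu> < c" "0 \<le> s" "c + 1 * s \<in> ?S \<omega>" then show False by force
    next
      fix \<mu> assume *: "\<not> (\<exists>s\<ge>0. c + 1 * s \<in> ?S \<omega>)" and \<mu>: "\<mu> \<in> ?S \<omega>"
      show "\<mu> < c"
      proof (rule ccontr)
        assume "\<not> \<mu> < c"
        then have "0 \<le> \<mu> - c" "c + 1 * (\<mu> - c) \<in> ?S \<omega>" using \<mu> by auto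
        then show False using * by blast
      qed
    qed
    finally show ?thesis .
  qed
  have 2: "d < lambda_min (fmat n (A \<omega>)) \<longleftrightarrow> \<not> (\<exists>s\<ge>0. d + (-1) * s \<in> ?S \<omega>)" for \<omega>
  proof -
    have "d < lambda_min (fmat n (A \<omega>)) \<longleftrightarrow> (\<forall>\<mu>\<in>?S \<omega>. d < \<mu>)"
      unfolding lambda_min_def using fin ne by (simp add: Min_gr_iff)
    also have "\<dots> \<longleftrightarrow> \<not> (\<exists>s\<ge>0. d + (-1) * s \<in> ?S \<omega>)"
    proof safe
      fix s assume "\<forall>\<mu>\<in>?S \<omega>. d < \<mu>" "0 \<le> s" "d + (-1) * s \<in> ?S \<omega>" then show False by force
    next
      fix \<mu> assume *: "\<not> (\<exists>s\<ge>0. d + (-1) * s \<in> ?S \<omega>)" and \<mu>: "\<mu> \<in> ?S \<omega>"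
      show "d < \<mu>"
      proof (rule ccontr)
        assume "\<not> d < \<mu>"
        then have "0 \<le> d - \<mu>" "d + (-1) * (d - \<mu>) \<in> ?S \<omega>" using \<mu> by auto
        then show False using * by blast
      qed
    qed
    finally show ?thesis .
  qed
  have "{\<omega> \<in> space M. \<not> (\<exists>s\<ge>0. c + 1 * s \<in> ?S \<omega>) \<and> \<not> (\<exists>s\<ge>0. d + (-1) * s \<in> ?S \<omega>)} \<in> sets M"
    using A by (intro sets.sets_Collect_conj sets.sets_Collect_neg spectrum_ray_measurable)
  then show ?thesis unfolding 1 2 .
qed


section \<open>Probability of the eigenvalue bounds\<close>

text \<open>The lower bound is the worse of the two: \<open>2 a\<^sup>2 - a\<close> changes by at most three times the
  change of \<open>a\<close> on the unit interval, which turns \<open>4 t\<close> into \<open>12 t\<close>.\<close>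

lemma hadamard_square_eigenvalue_bounds:
  assumes n: "0 < n" and t: "16 * t \<le> \<xi>" "0 < \<xi>"
    and sym: "symf n q" and sq: "\<And>i. i < n \<Longrightarrow> (\<Sum>j<n. (q i j)\<^sup>2) = q i i"
    and close: "\<And>i. i < n \<Longrightarrow> 0 \<le> q i i \<and> q i i \<le> 1 \<and> \<bar>q i i - (1 - \<gamma>)\<bar> \<le> 4 * t"
    and \<gamma>: "0 \<le> \<gamma>" "\<gamma> \<le> 1"
  shows "lambda_max (fmat n (\<lambda>i j. (q i j)\<^sup>2)) < 1 - \<gamma> + \<xi>"
    and "(1 - \<gamma>) * (1 - 2 * \<gamma>) - \<xi> < lambda_min (fmat n (\<lambda>i j. (q i j)\<^sup>2))"
proof -
  let ?S = "spectrum (fmat n (\<lambda>i j. (q i j)\<^sup>2))"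
  have "symf n (\<lambda>i j. (q i j)\<^sup>2)" using sym by (simp add: symf_def)
  then have ne: "?S \<noteq> {}" using spectrum_sym_nonempty n by blast
  have fin: "finite ?S" by (rule card_finite_spectrum(1)[OF fmat_carrier])
  have "\<mu> < 1 - \<gamma> + \<xi> \<and> (1 - \<gamma>) * (1 - 2 * \<gamma>) - \<xi> < \<mu>" if \<mu>: "\<mu> \<in> ?S" for \<mu>
  proof -
    from spectrum_square_projection[OF \<mu> sq] obtain i where i: "i < n"
      "2 * (q i i)\<^sup>2 - q i i \<le> \<mu>" "\<mu> \<le> q i i" by blast
    define a where "a = q i i"
    define g where "g = 1 - \<gamma>"
    have a: "0 \<le> a" "a \<le> 1" "\<bar>a - g\<bar> \<le> 4 * t" using close[OF i(1)] by (auto simp: a_def g_def)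
    have g: "0 \<le> g" "g \<le> 1" using \<gamma> by (auto simp: g_def)
    have "\<bar>(2 * a\<^sup>2 - a) - (2 * g\<^sup>2 - g)\<bar> = \<bar>a - g\<bar> * \<bar>2 * (a + g) - 1\<bar>"
      by (simp add: abs_mult[symmetric] power2_eq_square algebra_simps)
    also have "\<dots> \<le> 4 * t * 3" using a g by (intro mult_mono) (auto simp: abs_le_iff)
    finally have d: "\<bar>(2 * a\<^sup>2 - a) - (2 * g\<^sup>2 - g)\<bar> \<le> 12 * t" by simp
    have t12: "12 * t < \<xi>" "4 * t < \<xi>"
    proof -
      have "0 \<le> t" using a(3) by linarith
      then show "12 * t < \<xi>" "4 * t < \<xi>" using t by (cases "t = 0"; simp)+
    qed
    have "2 * g\<^sup>2 - g = (1 - \<gamma>) * (1 - 2 * \<gamma>)" by (simp add: g_def power2_eq_square algebra_simps)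
    moreover have "2 * a\<^sup>2 - a \<le> \<mu>" "\<mu> \<le> a" using i by (auto simp: a_def)
    ultimately show ?thesis using d t12 a(3) by (auto simp: g_def abs_le_iff)
  qed
  then show "lambda_max (fmat n (\<lambda>i j. (q i j)\<^sup>2)) < 1 - \<gamma> + \<xi>"
    "(1 - \<gamma>) * (1 - 2 * \<gamma>) - \<xi> < lambda_min (fmat n (\<lambda>i j. (q i j)\<^sup>2))"
    unfolding lambda_max_def lambda_min_def using fin ne by (simp_all add: Max_less_iff Min_gr_iff)
qed

text \<open>Enumerates the indices other than \<open>i\<close>.\<close>

definition skip :: "nat \<Rightarrow> nat \<Rightarrow> nat" where
  "skip i s = (if s < i then s else Suc s)"

lemma skip_bij: "i < n \<Longrightarrow> bij_betw (skip i) {..<n - 1} ({..<n} - {i})"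
proof (rule bij_betw_imageI)
  assume i: "i < n"
  show "inj_on (skip i) {..<n - 1}" by (auto simp: inj_on_def skip_def split: if_splits)
  show "skip i ` {..<n - 1} = {..<n} - {i}"
  proof (intro equalityI subsetI)
    fix s assume "s \<in> {..<n} - {i}"
    then show "s \<in> skip i ` {..<n - 1}"
      using i by (intro image_eqI[of _ _ "if s < i then s else s - 1"]) (auto simp: skip_def)
  qed (use i in \<open>auto simp: skip_def split: if_splits\<close>)
qed

context prob_space begin

text \<open>The event \<open>good\<close> depends on the other rows only, so the row \<open>i\<close> can be frozen out: for fixed other
  rows the inner probability is at most \<open>quad_const q K * (p / \<kappa>\<^sup>2) powr (q / 2) / t powr q\<close> by Markov's
  inequality.\<close>

lemma quadratic_form_leave_one_out_tail:
  fixes z :: "nat \<times> nat \<Rightarrow> 'a \<Rightarrow> real" and good :: "(nat \<Rightarrow> nat \<Rightarrow> real) \<Rightarrow> bool"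
  assumes q: "2 \<le> q" and ind: "indep_vars (\<lambda>_. borel) z ({..<n} \<times> {..<p})"
    and mean: "\<And>i. i \<in> {..<n} \<times> {..<p} \<Longrightarrow> expectation (z i) = 0"
    and var: "\<And>i. i \<in> {..<n} \<times> {..<p} \<Longrightarrow> expectation (\<lambda>\<omega>. (z i \<omega>)\<^sup>2) = 1"
    and mi: "\<And>i. i \<in> {..<n} \<times> {..<p} \<Longrightarrow> integrable M (\<lambda>\<omega>. \<bar>z i \<omega>\<bar> powr (2 * q))"
    and mK: "\<And>i. i \<in> {..<n} \<times> {..<p} \<Longrightarrow> expectation (\<lambda>\<omega>. \<bar>z i \<omega>\<bar> powr (2 * q)) \<le> K" and K: "0 \<le> K"
    and i: "i < n" and \<kappa>: "0 < \<kappa>" and t: "0 < t" and p: "0 < p"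
    and good_meas: "Measurable.pred (Pi\<^sub>M (({..<n} - {i}) \<times> {..<p}) (\<lambda>_. borel)) (\<lambda>f. good (\<lambda>s j. f (s, j)))"
    and good_cong: "\<And>x y. (\<And>s j. s \<in> {..<n} - {i} \<Longrightarrow> j < p \<Longrightarrow> x s j = y s j) \<Longrightarrow> good x = good y"
    and good: "\<And>x v. good x \<Longrightarrow> \<kappa> * dotp p v v \<le> (\<Sum>j\<in>{..<n} - {i}. (dotp p v (x j))\<^sup>2)"
  defines "Z \<equiv> \<lambda>\<omega> s j. z (s, j) \<omega>"
  defines "A \<equiv> \<lambda>x. finv p (gram ({..<n} - {i}) x)"
  shows "prob {\<omega> \<in> space M. good (Z \<omega>) \<and>
      t < \<bar>dotp p (Z \<omega> i) (mv p (A (Z \<omega>)) (Z \<omega> i)) - trf p (A (Z \<omega>))\<bar>} \<le>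
     quad_const q K * (p / \<kappa>\<^sup>2) powr (q / 2) / t powr q"
    and "{\<omega> \<in> space M. good (Z \<omega>) \<and>
      t < \<bar>dotp p (Z \<omega> i) (mv p (A (Z \<omega>)) (Z \<omega> i)) - trf p (A (Z \<omega>))\<bar>} \<in> events"
proof -
  define I where "I = ({..<n} - {i}) \<times> {..<p}"
  define R where "R = {i} \<times> {..<p}"
  define V where "V = quad_const q K * (p / \<kappa>\<^sup>2) powr (q / 2) / t powr q"
  have V: "0 \<le> V" using quad_const_pos[OF q K] t by (simp add: V_def)
  define g where "g = (\<lambda>(y :: nat \<times> nat \<Rightarrow> real, w :: nat \<times> nat \<Rightarrow> real).
     good (\<lambda>s j. y (s, j)) \<and> t < \<bar>dotp p (\<lambda>j. w (i, j)) (mv p (A (\<lambda>s j. y (s, j))) (\<lambda>j. w (i, j))) - trf p (A (\<lambda>s j. y (s, j)))\<bar>)"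
  define zz where "zz = (\<lambda>\<omega> ij. z ij \<omega>)"
  have zm: "ij \<in> {..<n} \<times> {..<p} \<Longrightarrow> random_variable borel (z ij)" for ij using ind by (auto simp: indep_vars_def)
  have iv: "indep_var (Pi\<^sub>M I (\<lambda>_. borel)) (\<lambda>\<omega>. restrict (zz \<omega>) I) (Pi\<^sub>M R (\<lambda>_. borel)) (\<lambda>\<omega>. restrict (zz \<omega>) R)"
    unfolding zz_def using i by (intro indep_var_restrict[OF ind]) (auto simp: I_def R_def)
  have A_restrict: "A (\<lambda>s j. restrict f I (s, j)) = A (\<lambda>s j. f (s, j))" for f
    unfolding A_def by (rule finv_gram_cong) (auto simp: I_def)
  have good_restrict: "good (\<lambda>s j. restrict f I (s, j)) = good (\<lambda>s j. f (s, j))" for f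
    by (rule good_cong) (auto simp: I_def)
  have row_restrict: "dotp p (\<lambda>j. restrict f R (i, j)) (mv p B (\<lambda>j. restrict f R (i, j))) =
      dotp p (\<lambda>j. f (i, j)) (mv p B (\<lambda>j. f (i, j)))" for f B
  proof -
    have "mv p B (\<lambda>j. restrict f R (i, j)) = mv p B (\<lambda>j. f (i, j))"
      unfolding mv_def by (intro ext dotp_cong) (auto simp: R_def)
    then show ?thesis by (intro dotp_cong) (auto simp: R_def)
  qed
  have g_restrict: "g (restrict f I, restrict h R) = g (f, h)" for f h
    unfolding g_def prod.case A_restrict good_restrict row_restrict ..
  have gm: "Measurable.pred (Pi\<^sub>M I (\<lambda>_. borel) \<Otimes>\<^sub>M Pi\<^sub>M R (\<lambda>_. borel)) g"
  proof -
    let ?N = "Pi\<^sub>M I (\<lambda>_. borel :: real measure) \<Otimes>\<^sub>M Pi\<^sub>M R (\<lambda>_. borel :: real measure)"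
    have Am: "(\<lambda>yw. A (\<lambda>s j. fst yw (s, j)) a b) \<in> borel_measurable ?N" if "a < p" "b < p" for a b
      unfolding A_def using that
      by (intro borel_measurable_finv borel_measurable_gram measurable_compose[OF measurable_fst] measurable_component_singleton)
        (auto simp: I_def)
    have wm: "(\<lambda>yw. snd yw (i, j)) \<in> borel_measurable ?N" if "j < p" for j
      using that by (intro measurable_compose[OF measurable_snd] measurable_component_singleton) (auto simp: R_def)
    have "(\<lambda>yw. dotp p (\<lambda>j. snd yw (i, j)) (mv p (A (\<lambda>s j. fst yw (s, j))) (\<lambda>j. snd yw (i, j)))) \<in> borel_measurable ?N"
      unfolding mv_def by (intro borel_measurable_dotp Am wm)
    moreover have "(\<lambda>yw. trf p (A (\<lambda>s j. fst yw (s, j)))) \<in> borel_measurable ?N"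
      unfolding trf_def by (intro borel_measurable_sum Am) auto
    moreover have "Measurable.pred ?N (\<lambda>yw. good (\<lambda>s j. fst yw (s, j)))"
      using measurable_compose[OF measurable_fst good_meas] by (simp add: I_def)
    ultimately show ?thesis unfolding g_def case_prod_beta' by measurable
  qed
  define E where "E = {\<omega> \<in> space M. g (restrict (zz \<omega>) I, restrict (zz \<omega>) R)}"
  have E_eq: "{\<omega> \<in> space M. good (Z \<omega>) \<and>
      t < \<bar>dotp p (Z \<omega> i) (mv p (A (Z \<omega>)) (Z \<omega> i)) - trf p (A (Z \<omega>))\<bar>} = E"
    unfolding E_def g_restrict by (simp add: g_def zz_def Z_def)
  have E_meas: "E \<in> events"
  proof -
    have "(\<lambda>\<omega>. (restrict (zz \<omega>) I, restrict (zz \<omega>) R)) \<in> M \<rightarrow>\<^sub>M Pi\<^sub>M I (\<lambda>_. borel) \<Otimes>\<^sub>M Pi\<^sub>M R (\<lambda>_. borel)"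
      using indep_var_rv1[OF iv] indep_var_rv2[OF iv] by measurable
    from measurable_compose[OF this gm] show ?thesis unfolding E_def by (simp add: pred_def)
  qed
  then show "{\<omega> \<in> space M. good (Z \<omega>) \<and>
      t < \<bar>dotp p (Z \<omega> i) (mv p (A (Z \<omega>)) (Z \<omega> i)) - trf p (A (Z \<omega>))\<bar>} \<in> events" unfolding E_eq .
  define x where "x = (\<lambda>j. z (i, j))"
  have ind_x: "indep_vars (\<lambda>_. borel) x {..<p}"
    unfolding x_def
  proof (rule indep_vars_reindex)
    show "indep_vars (\<lambda>_. borel) z (Pair i ` {..<p})" using i by (intro indep_vars_subset[OF ind]) auto
  qed (simp add: inj_on_def)
  have inner: "(\<integral>\<^sup>+\<omega>'. indicator {yw. g yw} (restrict (zz \<omega>) I, restrict (zz \<omega>') R) \<partial>M) \<le> ennreal V" for \<omega>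
  proof (cases "good (Z \<omega>)")
    case False
    then have "\<not> g (restrict (zz \<omega>) I, restrict (zz \<omega>') R)" for \<omega>'
      unfolding g_restrict by (simp add: g_def zz_def Z_def)
    then show ?thesis by simp
  next
    case True
    define B where "B = A (Z \<omega>)"
    define H where "H = gram ({..<n} - {i}) (Z \<omega>)"
    have coer: "\<kappa> * dotp p v v \<le> dotp p v (mv p H v)" for v
      unfolding H_def gram_quad by (rule good[OF True])
    have det: "det (fmat p H) \<noteq> 0" by (rule det_nonzero_if_coercive[OF \<kappa> coer])
    have Hs: "symf p H" by (simp add: H_def gram_sym)
    have B_eq: "B = finv p H" by (simp add: B_def A_def H_def)
    have Bs: "symf p B" unfolding B_eq by (rule finv_sym[OF det Hs])
    have Bf: "fro2 p B \<le> p / \<kappa>\<^sup>2" unfolding B_eq by (rule fro2_finv_le[OF det Hs \<kappa> coer])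
    define D where "D = (\<lambda>\<omega>'. \<bar>dotp p (\<lambda>j. x j \<omega>') (mv p B (\<lambda>j. x j \<omega>')) - trf p B\<bar>)"
    have D: "integrable M (\<lambda>\<omega>'. D \<omega>' powr q) \<and> expectation (\<lambda>\<omega>'. D \<omega>' powr q) \<le> quad_const q K * (p / \<kappa>\<^sup>2) powr (q / 2)"
      unfolding D_def
      by (rule quadratic_form_moment[OF q ind_x]) (use mean var mi mK K i p \<kappa> Bs Bf in \<open>auto simp: x_def\<close>)
    have "(\<integral>\<^sup>+\<omega>'. indicator {yw. g yw} (restrict (zz \<omega>) I, restrict (zz \<omega>') R) \<partial>M) \<le> (\<integral>\<^sup>+\<omega>'. ennreal (D \<omega>' powr q / t powr q) \<partial>M)"
    proof (intro nn_integral_mono)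
      fix \<omega>'
      show "indicator {yw. g yw} (restrict (zz \<omega>) I, restrict (zz \<omega>') R) \<le> ennreal (D \<omega>' powr q / t powr q)"
      proof (cases "g (restrict (zz \<omega>) I, restrict (zz \<omega>') R)")
        case True
        then have "t < D \<omega>'" unfolding g_restrict by (simp add: g_def zz_def D_def x_def B_def Z_def)
        then have "t powr q \<le> D \<omega>' powr q" using t q by (intro powr_mono2) auto
        then have "1 \<le> D \<omega>' powr q / t powr q" using t by (simp add: le_divide_eq)
        then show ?thesis using True by simp
      qed simp
    qed
    also have "\<dots> = ennreal (expectation (\<lambda>\<omega>'. D \<omega>' powr q / t powr q))"
      using D by (intro nn_integral_eq_integral) auto
    also have "\<dots> \<le> ennreal V"
      unfolding V_def using D by (intro ennreal_leI) (auto intro: divide_right_mono)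
    finally show ?thesis .
  qed
  have "emeasure M E = (\<integral>\<^sup>+\<omega>. indicator E \<omega> \<partial>M)" using E_meas by simp
  also have "\<dots> = (\<integral>\<^sup>+\<omega>. indicator {yw. g yw} (restrict (zz \<omega>) I, restrict (zz \<omega>) R) \<partial>M)"
    by (intro nn_integral_cong) (simp add: E_def indicator_def)
  also have "\<dots> = (\<integral>\<^sup>+\<omega>. \<integral>\<^sup>+\<omega>'. indicator {yw. g yw} (restrict (zz \<omega>) I, restrict (zz \<omega>') R) \<partial>M \<partial>M)"
  proof (rule nn_integral_indep_var[OF iv])
    show "indicator {yw. g yw} \<in> borel_measurable (Pi\<^sub>M I (\<lambda>_. borel) \<Otimes>\<^sub>M Pi\<^sub>M R (\<lambda>_. borel))"
      using gm by (simp add: borel_measurable_indicator_iff pred_def)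
  qed
  also have "\<dots> \<le> (\<integral>\<^sup>+\<omega>. ennreal V \<partial>M)" by (intro nn_integral_mono inner)
  also have "\<dots> = ennreal V" by (simp add: emeasure_space_1)
  finally have "prob E \<le> V" using V by (simp add: emeasure_eq_measure)
  then show "prob {\<omega> \<in> space M. good (Z \<omega>) \<and>
      t < \<bar>dotp p (Z \<omega> i) (mv p (A (Z \<omega>)) (Z \<omega> i)) - trf p (A (Z \<omega>))\<bar>} \<le>
     quad_const q K * (p / \<kappa>\<^sup>2) powr (q / 2) / t powr q" unfolding E_eq V_def .
qed

end


lemma resid_sym: "symf n (resid n p z)"
proof (cases "det (fmat p (gram {..<n} z)) = 0")
  case True
  then have "finv p (gram {..<n} z) = (\<lambda>i j. 0)" by (simp add: finv_def)
  then show ?thesis by (simp add: symf_def resid_def mv_def dotp_def)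
qed (rule resid_props(1))

context prob_space begin

text \<open>The complement of the event is covered by \<open>2 n\<close> bad events: for each row the level of the other
  rows is too low, or it is high enough and the quadratic form deviates by more than \<open>\<xi> / 16\<close>.\<close>

lemma eigenvalue_bounds_probability:
  fixes z :: "nat \<times> nat \<Rightarrow> 'a \<Rightarrow> real" and \<Gamma> :: "real mat" and \<alpha> B :: real and n p :: nat
  assumes q: "2 \<le> q" and ind: "indep_vars (\<lambda>_. borel) z ({..<n} \<times> {..<p})"
    and mean: "\<And>i. i \<in> {..<n} \<times> {..<p} \<Longrightarrow> expectation (z i) = 0"
    and var: "\<And>i. i \<in> {..<n} \<times> {..<p} \<Longrightarrow> expectation (\<lambda>\<omega>. (z i \<omega>)\<^sup>2) = 1"
    and mi: "\<And>i. i \<in> {..<n} \<times> {..<p} \<Longrightarrow> integrable M (\<lambda>\<omega>. \<bar>z i \<omega>\<bar> powr (2 * q))"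
    and mK: "\<And>i. i \<in> {..<n} \<times> {..<p} \<Longrightarrow> expectation (\<lambda>\<omega>. \<bar>z i \<omega>\<bar> powr (2 * q)) \<le> K" and K: "0 \<le> K"
    and Gam: "\<Gamma> \<in> carrier_mat p p" "pos_semidef_mat \<Gamma>" "invertible_mat \<Gamma>"
    and p: "0 < p" "p \<le> n" and \<kappa>: "0 < \<kappa>" "1 / \<kappa> \<le> \<xi> / 16" and \<xi>: "0 < \<xi>"
  defines "lev \<equiv> eigen_level \<alpha> B (n - 1) p"
  assumes level: "\<And>x v. \<kappa> \<le> lev x \<Longrightarrow> \<kappa> * dotp p v v \<le> (\<Sum>s<n - 1. (dotp p v (x s))\<^sup>2)"
    and level_prob: "\<And>i. i < n \<Longrightarrow> prob {\<omega> \<in> space M. lev (\<lambda>s j. z (skip i s, j) \<omega>) < \<kappa>} \<le> e"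
  defines "X \<equiv> \<lambda>\<omega>. design_mat n p \<Gamma> (\<lambda>i j. z (i, j) \<omega>)"
  defines "T \<equiv> \<lambda>\<omega>. resid_mat (X \<omega>) \<odot> resid_mat (X \<omega>)"
  shows "1 - n * (e + quad_const q K * (p / \<kappa>\<^sup>2) powr (q / 2) / (\<xi> / 16) powr q) \<le>
    prob {\<omega> \<in> space M. invertible_mat (transpose_mat (X \<omega>) * X \<omega>) \<and>
      lambda_max (T \<omega>) < 1 - p / n + \<xi> \<and> lambda_min (T \<omega>) > (1 - p / n) * (1 - 2 * (p / n)) - \<xi>}"
proof -
  define V where "V = quad_const q K * (p / \<kappa>\<^sup>2) powr (q / 2) / (\<xi> / 16) powr q"
  define Z where "Z = (\<lambda>\<omega> s j. z (s, j) \<omega>)"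
  define t where "t = \<xi> / 16"
  have t: "0 < t" using \<xi> by (simp add: t_def)
  have n: "0 < n" using p by simp
  define H where "H = (\<lambda>\<omega>. gram {..<n} (Z \<omega>))"
  define S where "S = (\<lambda>\<omega> i j. (resid n p (Z \<omega>) i j)\<^sup>2)"
  define E where "E = {\<omega> \<in> space M. det (fmat p (H \<omega>)) \<noteq> 0 \<and>
     lambda_max (fmat n (S \<omega>)) < 1 - p / n + \<xi> \<and> (1 - p / n) * (1 - 2 * (p / n)) - \<xi> < lambda_min (fmat n (S \<omega>))}"
  have zm: "ij \<in> {..<n} \<times> {..<p} \<Longrightarrow> random_variable borel (z ij)" for ij using ind by (auto simp: indep_vars_def)
  have E_eq: "{\<omega> \<in> space M. invertible_mat (transpose_mat (X \<omega>) * X \<omega>) \<and>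
      lambda_max (T \<omega>) < 1 - p / n + \<xi> \<and> lambda_min (T \<omega>) > (1 - p / n) * (1 - 2 * (p / n)) - \<xi>} = E"
  proof -
    have inv: "invertible_mat (transpose_mat (X \<omega>) * X \<omega>) \<longleftrightarrow> det (fmat p (H \<omega>)) \<noteq> 0" for \<omega>
      unfolding X_def H_def Z_def by (rule design_mat_gram(1)[OF Gam])
    have "T \<omega> = fmat n (S \<omega>)" if "det (fmat p (H \<omega>)) \<noteq> 0" for \<omega>
    proof -
      have "resid_mat (X \<omega>) = fmat n (resid n p (Z \<omega>))"
        using design_mat_gram(2)[OF Gam] that unfolding X_def H_def Z_def by blast
      then show ?thesis
        by (intro eq_matI) (auto simp: T_def hadamard_prod_def S_def power2_eq_square)
    qed
    then show ?thesis unfolding E_def inv by (intro Collect_cong) auto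
  qed
  have Zm: "(\<lambda>\<omega>. Z \<omega> s j) \<in> borel_measurable M" if "s < n" "j < p" for s j
    using zm that by (simp add: Z_def)
  have E_meas: "E \<in> events"
  proof -
    have Hm: "(\<lambda>\<omega>. H \<omega> a b) \<in> borel_measurable M" if "a < p" "b < p" for a b
      unfolding H_def using that by (intro borel_measurable_gram Zm) auto
    have "(\<lambda>\<omega>. det (fmat p (H \<omega>))) \<in> borel_measurable M"
      by (rule borel_measurable_det[where n = p]) (use Hm in auto)
    then have 1: "{\<omega> \<in> space M. det (fmat p (H \<omega>)) \<noteq> 0} \<in> events" by measurable
    have "(\<lambda>\<omega>. S \<omega> i j) \<in> borel_measurable M" if "i < n" "j < n" for i j
    proof -
      have "(\<lambda>\<omega>. dotp p (Z \<omega> i) (mv p (finv p (H \<omega>)) (Z \<omega> j))) \<in> borel_measurable M"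
        unfolding mv_def using that by (intro borel_measurable_dotp borel_measurable_finv Hm Zm)
      then show ?thesis unfolding S_def resid_def H_def by measurable
    qed
    moreover have "symf n (S \<omega>)" for \<omega> using resid_sym[of n p "Z \<omega>"] by (simp add: symf_def S_def)
    ultimately have 2: "{\<omega> \<in> space M. lambda_max (fmat n (S \<omega>)) < 1 - p / n + \<xi> \<and>
        (1 - p / n) * (1 - 2 * (p / n)) - \<xi> < lambda_min (fmat n (S \<omega>))} \<in> events"
      by (intro lambda_bounds_measurable n)
    have "E = {\<omega> \<in> space M. det (fmat p (H \<omega>)) \<noteq> 0} \<inter> {\<omega> \<in> space M. lambda_max (fmat n (S \<omega>)) < 1 - p / n + \<xi> \<and>
        (1 - p / n) * (1 - 2 * (p / n)) - \<xi> < lambda_min (fmat n (S \<omega>))}" by (auto simp: E_def)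
    then show ?thesis using 1 2 by auto
  qed
  define good where "good = (\<lambda>i x. \<kappa> \<le> lev (\<lambda>s j. x (skip i s) j))"
  have skip: "skip i s \<in> {..<n} - {i}" if "i < n" "s < n - 1" for i s
    using bij_betwE[OF skip_bij[OF that(1)]] that by blast
  have good: "\<kappa> * dotp p v v \<le> (\<Sum>j\<in>{..<n} - {i}. (dotp p v (x j))\<^sup>2)" if "good i x" "i < n" for i x v
  proof -
    have "\<kappa> * dotp p v v \<le> (\<Sum>s<n - 1. (dotp p v (x (skip i s)))\<^sup>2)"
      using level[of "\<lambda>s j. x (skip i s) j" v] that by (simp add: good_def)
    also have "\<dots> = (\<Sum>j\<in>{..<n} - {i}. (dotp p v (x j))\<^sup>2)"
      by (rule sum.reindex_bij_betw[OF skip_bij[OF that(2)]])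
    finally show ?thesis .
  qed
  define A where "A = (\<lambda>i \<omega>. finv p (gram ({..<n} - {i}) (Z \<omega>)))"
  define F where "F = (\<lambda>i. {\<omega> \<in> space M. good i (Z \<omega>) \<and>
      t < \<bar>dotp p (Z \<omega> i) (mv p (A i \<omega>) (Z \<omega> i)) - trf p (A i \<omega>)\<bar>})"
  define G where "G = (\<lambda>i. {\<omega> \<in> space M. \<not> good i (Z \<omega>)})"
  have F: "prob (F i) \<le> V \<and> F i \<in> events" if i: "i < n" for i
  proof -
    have "Measurable.pred (Pi\<^sub>M (({..<n} - {i}) \<times> {..<p}) (\<lambda>_. borel)) (\<lambda>f. good i (\<lambda>s j. f (s, j)))"
    proof -
      have "(\<lambda>f. lev (\<lambda>s j. f (skip i s, j))) \<in> borel_measurable (Pi\<^sub>M (({..<n} - {i}) \<times> {..<p}) (\<lambda>_. borel))"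
        unfolding lev_def eigen_level_def
        by (intro borel_measurable_barrier measurable_component_singleton) (use skip i in auto)
      then show ?thesis unfolding good_def by measurable
    qed
    moreover have "good i x = good i y" if "\<And>s j. s \<in> {..<n} - {i} \<Longrightarrow> j < p \<Longrightarrow> x s j = y s j" for x y
    proof -
      have "lev (\<lambda>s j. x (skip i s) j) = lev (\<lambda>s j. y (skip i s) j)"
        unfolding lev_def eigen_level_def using that skip[OF i]
        by (intro conjunct2[OF barrier_cong]) auto
      then show ?thesis by (simp add: good_def)
    qed
    ultimately show ?thesis
      using quadratic_form_leave_one_out_tail[OF q ind mean var mi mK K i \<kappa>(1) t p(1), of "good i"] good i
      unfolding F_def A_def V_def Z_def t_def by blast
  qed
  have G: "prob (G i) \<le> e \<and> G i \<in> events" if i: "i < n" for i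
  proof -
    have "random_variable borel (\<lambda>\<omega>. lev (\<lambda>s j. z (skip i s, j) \<omega>))"
      unfolding lev_def eigen_level_def
      by (intro borel_measurable_barrier zm) (use skip i in auto)
    then show ?thesis using level_prob[OF i] by (simp add: G_def good_def Z_def not_le)
  qed
  have sub: "space M - E \<subseteq> (\<Union>i<n. G i \<union> F i)"
  proof
    fix \<omega> assume \<omega>: "\<omega> \<in> space M - E"
    show "\<omega> \<in> (\<Union>i<n. G i \<union> F i)"
    proof (rule ccontr)
      assume "\<omega> \<notin> (\<Union>i<n. G i \<union> F i)"
      then have ok: "good i (Z \<omega>)"
        "\<bar>dotp p (Z \<omega> i) (mv p (A i \<omega>) (Z \<omega> i)) - trf p (A i \<omega>)\<bar> \<le> t" if "i < n" for i
        using that \<omega> by (auto simp: G_def F_def not_less)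
      note conc = resid_diag_concentration[OF n \<kappa>(1) \<kappa>(2)[folded t_def] good[OF ok(1)] ok(2)[unfolded A_def]]
      have det: "det (fmat p (gram {..<n} (Z \<omega>))) \<noteq> 0" by (rule conc(1))
      have "lambda_max (fmat n (S \<omega>)) < 1 - p / n + \<xi> \<and> (1 - p / n) * (1 - 2 * (p / n)) - \<xi> < lambda_min (fmat n (S \<omega>))"
        unfolding S_def
        by (intro conjI hadamard_square_eigenvalue_bounds[where t = t])
          (use n p \<xi> conc(2) resid_props[OF det] in \<open>auto simp: t_def resid_sym\<close>)
      then have "\<omega> \<in> E" using \<omega> det by (simp add: E_def H_def)
      then show False using \<omega> by simp
    qed
  qed
  have "1 - prob E = prob (space M - E)" using prob_compl[OF E_meas] by simp
  also have "\<dots> \<le> prob (\<Union>i<n. G i \<union> F i)" using F G by (intro finite_measure_mono sub) auto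
  also have "\<dots> \<le> (\<Sum>i<n. prob (G i \<union> F i))" using F G by (intro finite_measure_subadditive_finite) auto
  also have "\<dots> \<le> (\<Sum>i<n. e + V)"
  proof (intro sum_mono)
    fix i assume "i \<in> {..<n}"
    then show "prob (G i \<union> F i) \<le> e + V"
      using F[of i] G[of i] measure_Un_le[of "G i" M "F i"] by fastforce
  qed
  finally show ?thesis unfolding E_eq V_def by simp
qed

end

theorem mainTheorem4:
  fixes \<delta> K :: real
    and n p :: "nat \<Rightarrow> nat"
    and M :: "nat \<Rightarrow> 'a measure"
    and z :: "nat \<Rightarrow> nat \<Rightarrow> nat \<Rightarrow> 'a \<Rightarrow> real"
    and \<Gamma> :: "nat \<Rightarrow> real mat"
    and X Q T :: "nat \<Rightarrow> 'a \<Rightarrow> real mat"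
    and \<gamma> :: "nat \<Rightarrow> real"
  assumes "\<delta> > 0"
    and prob: "\<And>k. prob_space (M k)"
    and indep: "\<And>k. prob_space.indep_vars (M k) (\<lambda>_. borel) (\<lambda>(i, j). z k i j)
          ({..<n k} \<times> {..<p k})"
    and ident: "\<And>k i j i' j'. i < n k \<Longrightarrow> j < p k \<Longrightarrow> i' < n k \<Longrightarrow> j' < p k \<Longrightarrow>
          distr (M k) borel (z k i j) = distr (M k) borel (z k i' j')"
    and mean: "\<And>k i j. i < n k \<Longrightarrow> j < p k \<Longrightarrow> prob_space.expectation (M k) (z k i j) = 0"
    and var: "\<And>k i j. i < n k \<Longrightarrow> j < p k \<Longrightarrow> prob_space.variance (M k) (z k i j) = 1"
    and moment_integrable: "\<And>k i j. i < n k \<Longrightarrow> j < p k \<Longrightarrow>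
          integrable (M k) (\<lambda>\<omega>. \<bar>z k i j \<omega>\<bar> powr (8 + \<delta>))"
    and moment_bound: "\<And>k i j. i < n k \<Longrightarrow> j < p k \<Longrightarrow>
          prob_space.expectation (M k) (\<lambda>\<omega>. \<bar>z k i j \<omega>\<bar> powr (8 + \<delta>)) \<le> K"
    and Gamma_dim: "\<And>k. \<Gamma> k \<in> carrier_mat (p k) (p k)"
    and Gamma_cov: "\<And>k. pos_semidef_mat (\<Gamma> k)"
    and Gamma_inv: "\<And>k. invertible_mat (\<Gamma> k)"
    and n_lim: "filterlim n at_top sequentially"
    and p_lim: "filterlim p at_top sequentially"
    and gamma_def: "\<And>k. \<gamma> k = real (p k) / real (n k)"
    and gamma_limsup: "limsup (\<lambda>k. ereal (\<gamma> k)) < ereal (1 / 2)"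
    and X_def: "\<And>k \<omega>. X k \<omega> = design_mat (n k) (p k) (\<Gamma> k) (\<lambda>i j. z k i j \<omega>)"
    and Q_def: "\<And>k \<omega>. Q k \<omega> = resid_mat (X k \<omega>)"
    and T_def: "\<And>k \<omega>. T k \<omega> = Q k \<omega> \<odot> Q k \<omega>"
  shows "\<exists>C>0. \<forall>\<xi>>0. \<forall>\<^sub>F k in sequentially.
           prob_space.prob (M k) {\<omega> \<in> space (M k).
               invertible_mat (transpose_mat (X k \<omega>) * X k \<omega>) \<and>
               lambda_max (T k \<omega>) < 1 - \<gamma> k + \<xi> \<and>
               lambda_min (T k \<omega>) > (1 - \<gamma> k) * (1 - 2 * \<gamma> k) - \<xi>}
             \<ge> 1 - C * real (n k) powr (- 1 - \<delta> / 4) * \<xi> powr (- 4 - \<delta> / 2)"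
proof -
  define q where "q = 4 + \<delta> / 2"
  have q: "2 \<le> q" "8 + \<delta> = 2 * q" using \<open>\<delta> > 0\<close> by (auto simp: q_def)
  define K' where "K' = max K 0"
  have K': "0 \<le> K'" "K \<le> K'" by (auto simp: K'_def)
  obtain c0 where c0: "limsup (\<lambda>k. ereal (\<gamma> k)) < ereal c0" "ereal c0 < ereal (1 / 2)"
    using ereal_dense2[OF gamma_limsup] by blast
  define c1 where "c1 = max c0 0"
  define \<eta> where "\<eta> = (1 / 2 - c1) / 2"
  have \<eta>: "0 < \<eta>" "\<eta> < 1 / 2" "c1 = 1 / 2 - 2 * \<eta>" using c0(2) by (auto simp: \<eta>_def c1_def field_simps)
  obtain \<kappa> c \<alpha> B m0 where \<kappa>: "0 < \<kappa>" and c: "0 < c" and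
    eb: "\<And>m p x v. m0 \<le> m \<Longrightarrow> 0 < p \<Longrightarrow> real p \<le> (1 / 2 - \<eta>) * real m \<Longrightarrow>
      \<kappa> * real m \<le> eigen_level \<alpha> B m p x \<Longrightarrow> \<kappa> * real m * dotp p v v \<le> (\<Sum>s<m. (dotp p v (x s))\<^sup>2)"
    "\<And>m p (M :: 'a measure) z. m0 \<le> m \<Longrightarrow> 0 < p \<Longrightarrow> real p \<le> (1 / 2 - \<eta>) * real m \<Longrightarrow>
      prob_space M \<Longrightarrow> prob_space.indep_vars M (\<lambda>_. borel) z ({..<m} \<times> {..<p}) \<Longrightarrow>
      \<forall>i\<in>{..<m} \<times> {..<p}. integral\<^sup>L M (z i) = 0 \<and> integral\<^sup>L M (\<lambda>\<omega>. (z i \<omega>)\<^sup>2) = 1 \<and>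
        integrable M (\<lambda>\<omega>. \<bar>z i \<omega>\<bar> powr 4) \<and> integral\<^sup>L M (\<lambda>\<omega>. \<bar>z i \<omega>\<bar> powr 4) \<le> 1 + K' \<Longrightarrow>
      measure M {\<omega> \<in> space M. eigen_level \<alpha> B m p (\<lambda>s j. z (s, j) \<omega>) < \<kappa> * real m} \<le> exp (- c * real m)"
    by (rule smallest_eigenvalue_bound[OF \<eta>(1,2), of "1 + K'"]) (use K' in \<open>simp, blast\<close>)
  define C2 where "C2 = quad_const q K' * (4 / \<kappa>\<^sup>2) powr (q / 2) * 16 powr q"
  have C2: "0 < C2" unfolding C2_def using quad_const_pos[OF q(1) K'(1)] \<kappa> by simp
  have ev_gamma: "eventually (\<lambda>k. \<gamma> k < c0) sequentially"
    using Limsup_lessD[OF c0(1)] by simp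
  have fin: "1 - (1 + C2) * real (n k) powr (- 1 - \<delta> / 4) * \<xi> powr (- 4 - \<delta> / 2) \<le>
      prob_space.prob (M k) {\<omega> \<in> space (M k).
               invertible_mat (transpose_mat (X k \<omega>) * X k \<omega>) \<and>
               lambda_max (T k \<omega>) < 1 - \<gamma> k + \<xi> \<and>
               lambda_min (T k \<omega>) > (1 - \<gamma> k) * (1 - 2 * \<gamma> k) - \<xi>}"
    if \<xi>: "0 < \<xi>" and k: "\<gamma> k < c0" "0 < p k" "Suc m0 \<le> n k" "1 / (2 * \<eta>) \<le> n k" "2 \<le> n k"
      "1 / (\<kappa> * (real (n k) - 1)) \<le> \<xi> / 16"
      "n k * exp (- c * (real (n k) - 1)) \<le> real (n k) powr (- 1 - \<delta> / 4) * \<xi> powr (- 4 - \<delta> / 2)" for \<xi> k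
  proof -
    interpret prob_space "M k" by (rule prob)
    define N where "N = n k"
    define P where "P = p k"
    define m where "m = N - 1"
    define w where "w = (\<lambda>(i, j). z k i j)"
    have m: "real m = real N - 1" "m0 \<le> m" "0 < m" using k by (auto simp: m_def N_def)
    have ind: "indep_vars (\<lambda>_. borel) w ({..<N} \<times> {..<P})" unfolding w_def N_def P_def by (rule indep)
    have wm: "i \<in> {..<N} \<times> {..<P} \<Longrightarrow> random_variable borel (w i)" for i using ind by (auto simp: indep_vars_def)
    have w_mean: "expectation (w i) = 0" if "i \<in> {..<N} \<times> {..<P}" for i
      using that mean by (auto simp: w_def N_def P_def)
    have w_var: "expectation (\<lambda>\<omega>. (w i \<omega>)\<^sup>2) = 1" if "i \<in> {..<N} \<times> {..<P}" for i
      using var[of "fst i" k "snd i"] mean[of "fst i" k "snd i"] that by (auto simp: w_def N_def P_def)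
    have w_mi: "integrable (M k) (\<lambda>\<omega>. \<bar>w i \<omega>\<bar> powr (2 * q))" if "i \<in> {..<N} \<times> {..<P}" for i
      using moment_integrable[of "fst i" k "snd i"] that by (auto simp: w_def N_def P_def q(2))
    have w_mK: "expectation (\<lambda>\<omega>. \<bar>w i \<omega>\<bar> powr (2 * q)) \<le> K'" if "i \<in> {..<N} \<times> {..<P}" for i
      using moment_bound[of "fst i" k "snd i"] that K' by (auto simp: w_def N_def P_def q(2))
    have w_4: "integrable (M k) (\<lambda>\<omega>. \<bar>w i \<omega>\<bar> powr 4) \<and> expectation (\<lambda>\<omega>. \<bar>w i \<omega>\<bar> powr 4) \<le> 1 + K'"
      if "i \<in> {..<N} \<times> {..<P}" for i
      using integrable_powr_mono[OF wm[OF that] w_mi[OF that], of 4] w_mK[OF that] q by simp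
    have N: "0 < N" "0 < P" using k by (auto simp: N_def P_def)
    have Pm: "P \<le> (1 / 2 - \<eta>) * m"
    proof -
      have "\<gamma> k \<le> c1" using k(1) by (simp add: c1_def)
      then have "\<gamma> k * N \<le> c1 * N" by (intro mult_right_mono) auto
      then have "real P \<le> c1 * N" using N by (simp add: gamma_def N_def P_def)
      moreover have "1 \<le> 2 * \<eta> * N" using k(4) \<eta> by (simp add: N_def divide_le_eq mult.commute)
      moreover have "c1 * N = N / 2 - 2 * (\<eta> * N)" unfolding \<eta>(3) by (simp add: algebra_simps)
      moreover have "(1 / 2 - \<eta>) * m = N / 2 - \<eta> * N - 1 / 2 + \<eta>" unfolding m(1) by (simp add: algebra_simps diff_divide_distrib)
      ultimately show ?thesis using \<eta> by linarith
    qed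
    have PN: "P \<le> N"
    proof -
      have "(1 / 2 - \<eta>) * m \<le> 1 * real m" using \<eta> by (intro mult_right_mono) auto
      then show ?thesis using Pm m(1) by linarith
    qed
    note ebm = eb(1)[OF m(2) N(2) Pm] eb(2)[OF m(2) N(2) Pm]
    have "1 - N * (exp (- c * m) + quad_const q K' * (P / (\<kappa> * m)\<^sup>2) powr (q / 2) / (\<xi> / 16) powr q) \<le>
      prob {\<omega> \<in> space (M k). invertible_mat (transpose_mat (design_mat N P (\<Gamma> k) (\<lambda>i j. w (i, j) \<omega>)) * design_mat N P (\<Gamma> k) (\<lambda>i j. w (i, j) \<omega>)) \<and>
      lambda_max (resid_mat (design_mat N P (\<Gamma> k) (\<lambda>i j. w (i, j) \<omega>)) \<odot> resid_mat (design_mat N P (\<Gamma> k) (\<lambda>i j. w (i, j) \<omega>))) < 1 - P / N + \<xi> \<and>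
      lambda_min (resid_mat (design_mat N P (\<Gamma> k) (\<lambda>i j. w (i, j) \<omega>)) \<odot> resid_mat (design_mat N P (\<Gamma> k) (\<lambda>i j. w (i, j) \<omega>))) > (1 - P / N) * (1 - 2 * (P / N)) - \<xi>}"
    proof (rule eigenvalue_bounds_probability[OF q(1) ind w_mean w_var w_mi w_mK K'(1), where \<alpha> = \<alpha> and B = B])
      show "\<Gamma> k \<in> carrier_mat P P" using Gamma_dim by (simp add: P_def)
      show "1 / (\<kappa> * m) \<le> \<xi> / 16" using k(6) by (simp add: m(1) N_def)
      show "\<kappa> * m * dotp P v v \<le> (\<Sum>s<N - 1. (dotp P v (x s))\<^sup>2)"
        if "\<kappa> * m \<le> eigen_level \<alpha> B (N - 1) P x" for x v
        using ebm(1)[of x v] that by (simp add: m_def)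
      fix i assume i: "i < N"
      define w' where "w' = (\<lambda>sj. w (skip i (fst sj), snd sj))"
      have sk: "skip i s < N" if "s < m" for s using that by (auto simp: skip_def m_def)
      have ind': "indep_vars (\<lambda>_. borel) w' ({..<m} \<times> {..<P})"
        unfolding w'_def
      proof (rule indep_vars_reindex)
        show "indep_vars (\<lambda>_. borel) w ((\<lambda>sj. (skip i (fst sj), snd sj)) ` ({..<m} \<times> {..<P}))"
          by (intro indep_vars_subset[OF ind]) (use sk in auto)
        show "inj_on (\<lambda>sj. (skip i (fst sj), snd sj)) ({..<m} \<times> {..<P})"
          by (auto simp: inj_on_def skip_def split: if_splits)
      qed
      have mom: "\<forall>j\<in>{..<m} \<times> {..<P}. expectation (w' j) = 0 \<and> expectation (\<lambda>\<omega>. (w' j \<omega>)\<^sup>2) = 1 \<and>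
        integrable (M k) (\<lambda>\<omega>. \<bar>w' j \<omega>\<bar> powr 4) \<and> expectation (\<lambda>\<omega>. \<bar>w' j \<omega>\<bar> powr 4) \<le> 1 + K'"
        unfolding w'_def using sk w_mean w_var w_4 by auto
      have "prob {\<omega> \<in> space (M k). eigen_level \<alpha> B m P (\<lambda>s j. w' (s, j) \<omega>) < \<kappa> * m} \<le> exp (- c * m)"
        by (rule ebm(2)[OF prob ind' mom])
      then show "prob {\<omega> \<in> space (M k). eigen_level \<alpha> B (N - 1) P (\<lambda>s j. w (skip i s, j) \<omega>) < \<kappa> * m} \<le> exp (- c * m)"
        by (simp add: w'_def m_def)
    qed (use Gamma_cov Gamma_inv N PN \<kappa> m \<xi> in auto)
    also have "\<dots> = prob {\<omega> \<in> space (M k).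
               invertible_mat (transpose_mat (X k \<omega>) * X k \<omega>) \<and>
               lambda_max (T k \<omega>) < 1 - \<gamma> k + \<xi> \<and>
               lambda_min (T k \<omega>) > (1 - \<gamma> k) * (1 - 2 * \<gamma> k) - \<xi>}"
      by (simp add: X_def T_def Q_def gamma_def w_def N_def P_def)
    finally have main: "1 - N * (exp (- c * m) + quad_const q K' * (P / (\<kappa> * m)\<^sup>2) powr (q / 2) / (\<xi> / 16) powr q) \<le> \<dots>" .
    define g where "g = real N powr (- 1 - \<delta> / 4) * \<xi> powr (- 4 - \<delta> / 2)"
    have "N * exp (- c * m) \<le> g" using k(7) by (simp add: g_def N_def m(1))
    moreover have "N * (quad_const q K' * (P / (\<kappa> * m)\<^sup>2) powr (q / 2) / (\<xi> / 16) powr q) \<le> C2 * g"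
    proof -
      have N2: "real N \<le> 2 * m" using k(5) m(1) by (simp add: N_def)
      have Pm': "real P \<le> m"
      proof -
        have "(1 / 2 - \<eta>) * m \<le> 1 * real m" using \<eta> by (intro mult_right_mono) auto
        then show ?thesis using Pm by linarith
      qed
      have "P / (\<kappa> * m)\<^sup>2 \<le> m / (\<kappa> * m)\<^sup>2" using Pm' by (intro divide_right_mono) auto
      also have "\<dots> = 1 / (\<kappa>\<^sup>2 * m)" using m(3) by (simp add: power2_eq_square)
      also have "\<dots> \<le> 1 / (\<kappa>\<^sup>2 * (N / 4))"
        using N2 N \<kappa> by (intro divide_left_mono mult_left_mono) (auto simp: m(3))
      also have "\<dots> = 4 / \<kappa>\<^sup>2 * (1 / N)" by simp
      finally have "(P / (\<kappa> * m)\<^sup>2) powr (q / 2) \<le> (4 / \<kappa>\<^sup>2 * (1 / N)) powr (q / 2)"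
        using q by (intro powr_mono2) auto
      also have "\<dots> = (4 / \<kappa>\<^sup>2) powr (q / 2) * real N powr (- (q / 2))"
        using N by (simp only: powr_mult) (simp add: powr_minus powr_divide inverse_eq_divide)
      finally have 1: "(P / (\<kappa> * m)\<^sup>2) powr (q / 2) \<le> (4 / \<kappa>\<^sup>2) powr (q / 2) * real N powr (- (q / 2))" .
      have 2: "1 / (\<xi> / 16) powr q = 16 powr q * \<xi> powr (- q)"
        using \<xi> by (simp add: powr_divide powr_minus field_simps)
      have "N * (quad_const q K' * (P / (\<kappa> * m)\<^sup>2) powr (q / 2) / (\<xi> / 16) powr q) =
          N * quad_const q K' * (P / (\<kappa> * m)\<^sup>2) powr (q / 2) * (1 / (\<xi> / 16) powr q)" by simp
      also have "\<dots> \<le> N * quad_const q K' * ((4 / \<kappa>\<^sup>2) powr (q / 2) * real N powr (- (q / 2))) * (1 / (\<xi> / 16) powr q)"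
        using 1 quad_const_pos[OF q(1) K'(1)] by (intro mult_right_mono mult_left_mono) auto
      also have "\<dots> = C2 * ((real N powr 1 * real N powr (- (q / 2))) * \<xi> powr (- q))"
        unfolding 2 C2_def using N by simp
      also have "real N powr 1 * real N powr (- (q / 2)) = real N powr (- 1 - \<delta> / 4)"
      proof -
        have "1 + - (q / 2) = - 1 - \<delta> / 4" by (simp add: q_def add_divide_distrib)
        then show ?thesis unfolding powr_add[symmetric] by (rule arg_cong)
      qed
      also have "- q = - 4 - \<delta> / 2" by (simp add: q_def)
      finally show ?thesis by (simp add: g_def)
    qed
    ultimately have "N * (exp (- c * m) + quad_const q K' * (P / (\<kappa> * m)\<^sup>2) powr (q / 2) / (\<xi> / 16) powr q) \<le> g + C2 * g"
      by (simp add: distrib_left)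
    also have "g + C2 * g = (1 + C2) * real N powr (- 1 - \<delta> / 4) * \<xi> powr (- 4 - \<delta> / 2)"
      by (simp add: g_def distrib_right mult.assoc)
    finally show ?thesis using main unfolding N_def by linarith
  qed
  show ?thesis
  proof (intro exI[of _ "1 + C2"] conjI allI impI)
    show "0 < 1 + C2" using C2 by simp
    fix \<xi> :: real assume \<xi>: "0 < \<xi>"
    have n_ev: "eventually (\<lambda>k. N \<le> n k) sequentially" for N
      using n_lim by (simp add: filterlim_at_top)
    have nr: "filterlim (\<lambda>k. real (n k)) at_top sequentially"
      by (rule filterlim_compose[OF filterlim_real_sequentially n_lim])
    have e1: "eventually (\<lambda>k. 1 / (2 * \<eta>) \<le> n k) sequentially"
      using nr by (simp add: filterlim_at_top)
    have "eventually (\<lambda>x::real. 1 / (\<kappa> * (x - 1)) \<le> \<xi> / 16) at_top"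
      using \<kappa> \<xi> by real_asymp
    from eventually_compose_filterlim[OF this nr]
    have e2: "eventually (\<lambda>k. 1 / (\<kappa> * (real (n k) - 1)) \<le> \<xi> / 16) sequentially" .
    have "eventually (\<lambda>x::real. x * exp (- c * (x - 1)) \<le> x powr (- 1 - \<delta> / 4) * \<xi> powr (- 4 - \<delta> / 2)) at_top"
    proof -
      have "0 < \<xi> powr (- 4 - \<delta> / 2)" using \<xi> by simp
      then show ?thesis using c by real_asymp
    qed
    from eventually_compose_filterlim[OF this nr]
    have e3: "eventually (\<lambda>k. n k * exp (- c * (real (n k) - 1)) \<le> real (n k) powr (- 1 - \<delta> / 4) * \<xi> powr (- 4 - \<delta> / 2)) sequentially" .
    have e4: "eventually (\<lambda>k. 0 < p k) sequentially"
      using p_lim by (simp add: filterlim_at_top eventually_mono Suc_le_eq[symmetric])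
    show "\<forall>\<^sub>F k in sequentially.
           prob_space.prob (M k) {\<omega> \<in> space (M k).
               invertible_mat (transpose_mat (X k \<omega>) * X k \<omega>) \<and>
               lambda_max (T k \<omega>) < 1 - \<gamma> k + \<xi> \<and>
               lambda_min (T k \<omega>) > (1 - \<gamma> k) * (1 - 2 * \<gamma> k) - \<xi>}
             \<ge> 1 - (1 + C2) * real (n k) powr (- 1 - \<delta> / 4) * \<xi> powr (- 4 - \<delta> / 2)"
      using ev_gamma e4 n_ev[of "Suc m0"] e1 n_ev[of 2] e2 e3
      by eventually_elim (rule fin[OF \<xi>])
  qed
qed

end
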